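(* Let $u, v:\mathbb R^3\to\mathbb R^3$ be smooth vector fields satisfying, together with some scalar function $\pi:\mathbb R^3\to\mathbb R$ (the pressure), the steady-state Stokes system with drift $$u\cdot\nabla v-\Delta v=\nabla \pi,\qquad \operatorname{div} v=0,\qquad \operatorname{div} u=0\qquad\text{in }\mathbb R^3.$$ Suppose that, for some $q$ with $\tfrac32<q\le 3$, $$M:=\sup_{R>0} R^{1-\frac 3q}\,\|u\|_{L^{q,\infty}(B(R))}<\infty,$$ and that, for some $s$ with $2\le s\le 6$, $$N:=\sup_{R>0} R^{\frac12-\frac3s}\,\|v\|_{s,B(R)}<\infty.$$ Then $v\equiv 0$ in $\mathbb R^3$.
   Context: $B(R)$ denotes the ball in $\mathbb R^3$ of radius $R$ centred at the origin. $\|v\|_{s,B(R)}$ denotes the usual Lebesgue norm of $v$ in $L_s(B(R))$. For a domain $\Omega\subset\mathbb R^3$, $L^{q,\infty}(\Omega)$ denotes the weak Lebesgue space (the Lorentz space $L^{q,r}(\Omega)$ with $r=\infty$), with the (quasi-)norm $\|u\|_{L^{q,\infty}(\Omega)}=\sup_{\lambda>0}\lambda\,|\{x\in\Omega:|u(x)|>\lambda\}|^{1/q}$, where $|\cdot|$ of a set is Lebesgue measure. The vector field $u\cdot\nabla v$ has components $(u\cdot\nabla v)_i=\sum_{j=1}^3 u_j\,\partial_j v_i$. *)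

theory Defs
  imports "HOL-Analysis.Analysis"
begin

definition partial_deriv :: "'n::finite \<Rightarrow> (real^'n \<Rightarrow> 'b::real_normed_vector) \<Rightarrow> real^'n \<Rightarrow> 'b" where
  "partial_deriv j f x = frechet_derivative f (at x) (axis j 1)"

fun C_k :: "nat \<Rightarrow> (real^'n::finite \<Rightarrow> 'b::real_normed_vector) \<Rightarrow> bool" where
  "C_k 0 f = continuous_on UNIV f"
| "C_k (Suc k) f = (f differentiable_on UNIV \<and> (\<forall>j. C_k k (partial_deriv j f)))"

definition smooth :: "(real^'n::finite \<Rightarrow> 'b::real_normed_vector) \<Rightarrow> bool" where
  "smooth f \<longleftrightarrow> (\<forall>k. C_k k f)"

definition grad :: "(real^'n::finite \<Rightarrow> real) \<Rightarrow> real^'n \<Rightarrow> real^'n" where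
  "grad p x = (\<chi> i. partial_deriv i p x)"

definition divergence :: "(real^'n::finite \<Rightarrow> real^'n) \<Rightarrow> real^'n \<Rightarrow> real" where
  "divergence v x = (\<Sum>i\<in>UNIV. partial_deriv i (\<lambda>y. v y $ i) x)"

definition laplacian :: "(real^'n::finite \<Rightarrow> real^'n) \<Rightarrow> real^'n \<Rightarrow> real^'n" where
  "laplacian v x = (\<chi> i. \<Sum>j\<in>UNIV. partial_deriv j (partial_deriv j (\<lambda>y. v y $ i)) x)"

definition convection :: "(real^'n::finite \<Rightarrow> real^'n) \<Rightarrow> (real^'n \<Rightarrow> real^'n) \<Rightarrow> real^'n \<Rightarrow> real^'n" where
  "convection u v x = (\<chi> i. \<Sum>j\<in>UNIV. u x $ j * partial_deriv j (\<lambda>y. v y $ i) x)"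

text \<open>Real powers of extended nonnegative reals, meant for positive exponents only.\<close>

definition ennreal_rpow :: "ennreal \<Rightarrow> real \<Rightarrow> ennreal" where
  "ennreal_rpow a r = (if a = \<infinity> then \<infinity> else ennreal (enn2real a powr r))"

definition Leb_norm :: "real \<Rightarrow> 'a::euclidean_space set \<Rightarrow> ('a \<Rightarrow> 'b::real_normed_vector) \<Rightarrow> ennreal" where
  "Leb_norm s \<Omega> v = ennreal_rpow (\<integral>\<^sup>+x\<in>\<Omega>. ennreal (norm (v x) powr s) \<partial>lebesgue) (1 / s)"

definition weak_Leb_norm :: "real \<Rightarrow> 'a::euclidean_space set \<Rightarrow> ('a \<Rightarrow> 'b::real_normed_vector) \<Rightarrow> ennreal" where
  "weak_Leb_norm q \<Omega> u =
     (SUP l\<in>{0<..}. ennreal l * ennreal_rpow (emeasure lebesgue {x\<in>\<Omega>. norm (u x) > l}) (1 / q))"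

end

theory Submission
  imports Defs
begin

text \<open>
  The proof rests on one scale-invariant Caccioppoli inequality,
  \<open>\<integral>\<^bsub>B(R)\<^esub> \<bar>\<nabla>v\<bar>\<^sup>2 \<le> C R\<^sup>-\<^sup>2 \<integral>\<^bsub>B(2R)\<^esub> \<bar>v\<bar>\<^sup>2\<close> (lemma \<open>caccioppoli\<close>), and on a Hardy inequality.

  The two norm conditions enter only through two consequences. Splitting \<open>v\<close> at height \<open>R\<^sup>-\<^sup>1\<^sup>/\<^sup>2\<close> gives
  \<open>\<integral>\<^bsub>B(R)\<^esub> \<bar>v\<bar>\<^sup>2 \<le> N R\<^sup>2\<close> (lemma \<open>Leb_norm_square\<close>). A layer-cake estimate turns the weak Lebesgue bound into a
  Morrey bound: after rescaling to unit size, the mean of \<open>\<bar>u\<bar>\<close> over a ball of radius \<open>s \<le> 1\<close> is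
  \<open>O(s\<^sup>-\<^sup>3\<^sup>/\<^sup>q)\<close> (lemma \<open>weak_norm_morrey\<close>). The assumption \<open>q > 3/2\<close> says that this exponent is less than two.

  The difficulty in the Caccioppoli inequality is the pressure: \<open>\<psi> v\<close> is not divergence free when \<open>\<psi>\<close> is a
  cut-off function. Let \<open>S v\<close> be the average of the translates \<open>v(x - h y)\<close> against a fixed kernel in \<open>y\<close>.
  Because \<open>div v = 0\<close>, the rate of change \<open>- h (y \<cdot> \<nabla>) v\<close> of \<open>v(x - t h y)\<close> in \<open>t\<close> is the divergence of the
  antisymmetric tensor \<open>h (y\<^sub>i v\<^sub>k - y\<^sub>k v\<^sub>i)\<close>, so averaging over \<open>t\<close> and \<open>y\<close> yields an antisymmetric \<open>A\<close>
  with \<open>S v - v = div A\<close> (lemma \<open>div_vpot\<close>). The field \<open>w = div (\<psi> A)\<close> has compact support and annihilates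
  every gradient, and it equals \<open>\<psi> (S v - v)\<close> up to derivatives of \<open>\<psi>\<close>. Testing with \<open>w\<close> bounds \<open>\<psi> \<bar>\<nabla>v\<bar>\<^sup>2\<close>,
  up to a divergence, by terms that contain \<open>S v\<close>, \<open>\<nabla>S v\<close>, \<open>S v - v\<close>, \<open>A\<close> or \<open>\<nabla>A\<close>
  (lemmas \<open>energy_identity\<close> and \<open>energy_inequality\<close>). In the first two the derivatives fall on the kernel; the
  others are averages of \<open>h \<nabla>v\<close> or \<open>h v\<close> along segments of length at most \<open>h\<close>. In place of singular
  integrals and Sobolev embeddings, the Cauchy-Schwarz inequality and Tonelli's theorem show that such averages are
  square integrable against any weight with a Morrey exponent below two (lemma \<open>morrey_pot\<close>), the weight being \<open>1\<close> or
  \<open>\<bar>u\<bar>\<close>. The resulting bound \<open>h\<^sup>2\<^sup>-\<^sup>3\<^sup>/\<^sup>q \<integral>\<bar>\<nabla>v\<bar>\<^sup>2 + h\<^sup>-\<^sup>4 \<integral>\<bar>v\<bar>\<^sup>2\<close> on a slightly larger ball is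
  absorbed by taking \<open>h\<close> small and iterating over radii (lemmas \<open>hole_filling_iteration\<close> and \<open>caccioppoli_unit\<close>).

  The conclusion is then short. The Caccioppoli inequality and the growth of \<open>\<integral>\<^bsub>B(R)\<^esub> \<bar>v\<bar>\<^sup>2\<close> bound
  \<open>\<integral>\<bar>\<nabla>v\<bar>\<^sup>2\<close> over the whole space, so \<open>\<bar>v\<bar>\<^sup>2 / (1 + \<bar>x\<bar>\<^sup>2)\<close> is integrable (lemma \<open>hardy\<close>). By dominated
  convergence \<open>R\<^sup>-\<^sup>2 \<integral>\<^bsub>B(R)\<^esub> \<bar>v\<bar>\<^sup>2 \<longlonglongrightarrow> 0\<close>, and the Caccioppoli inequality, used once more, gives \<open>\<nabla>v = 0\<close>. A
  constant whose square has integral \<open>O(R\<^sup>2)\<close> over balls of volume of order \<open>R\<^sup>3\<close> vanishes.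
\<close>

abbreviation D :: "'n::finite \<Rightarrow> (real^'n \<Rightarrow> 'b::real_normed_vector) \<Rightarrow> real^'n \<Rightarrow> 'b" where
  "D \<equiv> partial_deriv"

abbreviation ball_int :: "('a::euclidean_space \<Rightarrow> real) \<Rightarrow> real \<Rightarrow> ennreal" where
  "ball_int f r \<equiv> \<integral>\<^sup>+x. ennreal (f x) * indicator (ball 0 r) x \<partial>lborel"

abbreviation weighted_int :: "('a::euclidean_space \<Rightarrow> ennreal) \<Rightarrow> ('a \<Rightarrow> real) \<Rightarrow> ennreal" where
  "weighted_int U f \<equiv> \<integral>\<^sup>+x. U x * ennreal (f x) \<partial>lborel"


section \<open>Calculus with partial derivatives\<close>

lemma has_derivative_partial:
  fixes f :: "real^'n::finite \<Rightarrow> 'b::real_normed_vector"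
  assumes "f differentiable at x"
  shows "(f has_derivative (\<lambda>h. \<Sum>j\<in>UNIV. h $ j *\<^sub>R D j f x)) (at x)"
proof -
  have d: "(f has_derivative frechet_derivative f (at x)) (at x)"
    using assms frechet_derivative_works by blast
  then have lin: "linear (frechet_derivative f (at x))"
    using has_derivative_linear by blast
  have "frechet_derivative f (at x) h = (\<Sum>j\<in>UNIV. h $ j *\<^sub>R D j f x)" for h
  proof -
    have "frechet_derivative f (at x) h = frechet_derivative f (at x) (\<Sum>j\<in>UNIV. h $ j *\<^sub>R axis j 1)"
      by (metis (no_types, lifting) basis_expansion scalar_mult_eq_scaleR sum.cong)
    also have "\<dots> = (\<Sum>j\<in>UNIV. h $ j *\<^sub>R D j f x)"
      by (simp add: linear_sum[OF lin] linear_scale[OF lin] partial_deriv_def)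
    finally show ?thesis .
  qed
  with d show ?thesis by (metis (no_types, lifting) ext)
qed

lemma partial_deriv_eqI:
  assumes "(f has_derivative f') (at x)"
  shows "D j f x = f' (axis j 1)"
  using frechet_derivative_at[OF assms] by (simp add: partial_deriv_def)

lemma partial_deriv_line:
  fixes f :: "real^'n::finite \<Rightarrow> 'b::real_normed_vector"
  assumes "f differentiable at (x + t *\<^sub>R y)"
  shows "((\<lambda>t. f (x + t *\<^sub>R y)) has_vector_derivative
           (\<Sum>j\<in>UNIV. y $ j *\<^sub>R D j f (x + t *\<^sub>R y))) (at t within S)"
proof -
  have 1: "((\<lambda>t. x + t *\<^sub>R y) has_derivative (\<lambda>h. h *\<^sub>R y)) (at t within S)"
    by (auto intro!: derivative_eq_intros)
  have "((\<lambda>t. f (x + t *\<^sub>R y)) has_derivative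
          (\<lambda>h. \<Sum>j\<in>UNIV. (h *\<^sub>R y) $ j *\<^sub>R D j f (x + t *\<^sub>R y))) (at t within S)"
    using has_derivative_compose[OF 1 has_derivative_partial[OF assms]] by simp
  then show ?thesis
    by (simp add: has_vector_derivative_def scaleR_sum_right)
qed

lemma C_k_Suc_differentiable: "C_k (Suc k) f \<Longrightarrow> f differentiable at x"
  by (simp add: differentiable_on_def)

lemma C_k_SucD: "C_k (Suc k) f \<Longrightarrow> C_k k (D j f)"
  by simp

lemma C_k_down: "C_k (Suc k) f \<Longrightarrow> C_k k f"
proof (induction k arbitrary: f)
  case 0
  then show ?case by (auto intro: differentiable_imp_continuous_on)
next
  case (Suc k)
  have "f differentiable_on UNIV" using Suc.prems by (subst (asm) C_k.simps) blast
  moreover have "C_k k (D j f)" for j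
    by (rule Suc.IH) (use Suc.prems in \<open>subst (asm) C_k.simps(2), blast\<close>)
  ultimately show ?case by simp
qed

lemma C_k_mono: "C_k m f \<Longrightarrow> k \<le> m \<Longrightarrow> C_k k f"
proof (induction "m - k" arbitrary: k)
  case (Suc d)
  then have "C_k (Suc k) f" by (metis Suc_diff_Suc diff_Suc_1' not_less_eq_eq zero_less_Suc zero_less_diff Suc_leI)
  then show ?case by (rule C_k_down)
qed simp

lemma C_k_continuous: "C_k k f \<Longrightarrow> continuous_on S f"
  using C_k_mono[of k f 0] continuous_on_subset by fastforce

lemma C_k_const: "C_k k (\<lambda>_. c)"
proof (induction k arbitrary: c)
  case (Suc k)
  have "D j (\<lambda>_. c) = (\<lambda>_. 0)" for j :: 'a
    by (rule ext) (simp add: partial_deriv_def)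
  then show ?case using Suc by (simp add: )
qed simp

lemma partial_deriv_add:
  assumes "f differentiable at x" "g differentiable at x"
  shows "D j (\<lambda>x. f x + g x) x = D j f x + D j g x"
  using partial_deriv_eqI[OF has_derivative_add[OF assms[THEN has_derivative_partial]]]
    partial_deriv_eqI[OF has_derivative_partial[OF assms(1)]]
    partial_deriv_eqI[OF has_derivative_partial[OF assms(2)]] by metis

lemma partial_deriv_mult:
  fixes f g :: "real^'n::finite \<Rightarrow> real"
  assumes "f differentiable at x" "g differentiable at x"
  shows "D j (\<lambda>x. f x * g x) x = D j f x * g x + f x * D j g x"
  using partial_deriv_eqI[OF has_derivative_mult[OF assms[THEN has_derivative_partial]], of j]
    partial_deriv_eqI[OF has_derivative_partial[OF assms(1)], of j]
    partial_deriv_eqI[OF has_derivative_partial[OF assms(2)], of j] by simp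

lemma partial_deriv_cmult:
  fixes f :: "real^'n::finite \<Rightarrow> real"
  assumes "f differentiable at x"
  shows "D j (\<lambda>x. c * f x) x = c * D j f x"
  using partial_deriv_mult[of "\<lambda>_. c" x f j] assms by (simp add: partial_deriv_def)

lemma C_k_add: "C_k k f \<Longrightarrow> C_k k g \<Longrightarrow> C_k k (\<lambda>x. f x + g x)"
proof (induction k arbitrary: f g)
  case 0
  then show ?case by (simp add: continuous_on_add)
next
  case (Suc k)
  have "D j (\<lambda>x. f x + g x) = (\<lambda>x. D j f x + D j g x)" for j
    using Suc.prems by (intro ext partial_deriv_add C_k_Suc_differentiable)
  then show ?case using Suc by simp
qed

lemma C_k_mult:
  fixes f g :: "real^'n::finite \<Rightarrow> real"
  shows "C_k k f \<Longrightarrow> C_k k g \<Longrightarrow> C_k k (\<lambda>x. f x * g x)"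
proof (induction k arbitrary: f g)
  case 0
  then show ?case by (simp add: continuous_on_mult)
next
  case (Suc k)
  have "D j (\<lambda>x. f x * g x) = (\<lambda>x. D j f x * g x + f x * D j g x)" for j
    using Suc.prems by (intro ext partial_deriv_mult C_k_Suc_differentiable)
  moreover have "C_k k (\<lambda>x. D j f x * g x + f x * D j g x)" for j
    using Suc.prems C_k_down[OF Suc.prems(1)] C_k_down[OF Suc.prems(2)]
    by (intro C_k_add Suc.IH C_k_SucD)
  moreover have "(\<lambda>x. f x * g x) differentiable_on UNIV"
    using Suc.prems by (simp add: differentiable_on_mult)
  ultimately show ?case by simp
qed

lemma C_k_sum:
  assumes "finite I" "\<And>i. i \<in> I \<Longrightarrow> C_k k (f i)"
  shows "C_k k (\<lambda>x. \<Sum>i\<in>I. f i x)"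
  using assms by (induction I rule: finite_induct) (auto intro: C_k_add C_k_const)

lemma partial_deriv_sum:
  assumes "finite I" "\<And>i. i \<in> I \<Longrightarrow> f i differentiable at x"
  shows "D j (\<lambda>x. \<Sum>i\<in>I. f i x) x = (\<Sum>i\<in>I. D j (f i) x)"
proof -
  have "((\<lambda>x. \<Sum>i\<in>I. f i x) has_derivative (\<lambda>h. \<Sum>i\<in>I. \<Sum>j\<in>UNIV. h $ j *\<^sub>R D j (f i) x)) (at x)"
    using assms by (intro has_derivative_sum has_derivative_partial)
  then have "D j (\<lambda>x. \<Sum>i\<in>I. f i x) x = (\<Sum>i\<in>I. \<Sum>k\<in>UNIV. axis j 1 $ k *\<^sub>R D k (f i) x)"
    by (rule partial_deriv_eqI)
  also have "\<dots> = (\<Sum>i\<in>I. D j (f i) x)"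
    using partial_deriv_eqI[OF has_derivative_partial[OF assms(2)]] by (intro sum.cong) auto
  finally show ?thesis .
qed

lemma C_k_cmult:
  fixes f :: "real^'n::finite \<Rightarrow> real"
  shows "C_k k f \<Longrightarrow> C_k k (\<lambda>x. c * f x)"
  by (intro C_k_mult C_k_const)

lemma C_k_diff:
  fixes f g :: "real^'n::finite \<Rightarrow> real"
  shows "C_k k f \<Longrightarrow> C_k k g \<Longrightarrow> C_k k (\<lambda>x. f x - g x)"
  using C_k_add[of k f "\<lambda>x. (-1) * g x"] C_k_cmult[of k g "-1"] by simp

lemma partial_deriv_diff:
  fixes f g :: "real^'n::finite \<Rightarrow> real"
  assumes "f differentiable at x" "g differentiable at x"
  shows "D j (\<lambda>x. f x - g x) x = D j f x - D j g x"
  using partial_deriv_add[OF assms(1), of "\<lambda>x. (-1) * g x" j] partial_deriv_cmult[OF assms(2), of j "-1"] assms(2)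
  by simp

lemma partial_deriv_component:
  assumes "v differentiable at x"
  shows "D j (\<lambda>y. v y $ i) x = D j v x $ i"
proof -
  have "((\<lambda>y. v y $ i) has_derivative (\<lambda>h. (\<Sum>j\<in>UNIV. h $ j *\<^sub>R D j v x) $ i)) (at x)"
    using has_derivative_partial[OF assms] by (rule bounded_linear.has_derivative[OF bounded_linear_vec_nth])
  then have "D j (\<lambda>y. v y $ i) x = (\<Sum>k\<in>UNIV. axis j 1 $ k *\<^sub>R D k v x) $ i"
    by (rule partial_deriv_eqI)
  also have "(\<Sum>k\<in>UNIV. axis j 1 $ k *\<^sub>R D k v x) = D j v x"
    by (rule partial_deriv_eqI[OF has_derivative_partial[OF assms], symmetric])
  finally show ?thesis .
qed

lemma C_k_component: "C_k k v \<Longrightarrow> C_k k (\<lambda>y. v y $ i)"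
proof (induction k arbitrary: v)
  case 0
  then show ?case by (simp add: continuous_on_component)
next
  case (Suc k)
  have "D j (\<lambda>y. v y $ i) = (\<lambda>y. D j v y $ i)" for j
    using Suc.prems by (intro ext partial_deriv_component C_k_Suc_differentiable)
  moreover have "(\<lambda>y. v y $ i) differentiable at x" for x
    using bounded_linear.has_derivative[OF bounded_linear_vec_nth
        has_derivative_partial[OF C_k_Suc_differentiable[OF Suc.prems]]]
    unfolding differentiable_def by blast
  ultimately show ?case using Suc by (simp add: differentiable_on_def)
qed

lemma partial_deriv_affine:
  assumes "f differentiable at (b + c *\<^sub>R x)"
  shows "D j (\<lambda>x. f (b + c *\<^sub>R x)) x = c *\<^sub>R D j f (b + c *\<^sub>R x)"
proof -
  have 1: "((\<lambda>x. b + c *\<^sub>R x) has_derivative (\<lambda>h. c *\<^sub>R h)) (at x)"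
    by (auto intro!: derivative_eq_intros)
  have 2: "(f has_derivative frechet_derivative f (at (b + c *\<^sub>R x))) (at (b + c *\<^sub>R x))"
    using assms frechet_derivative_works by blast
  then have lin: "linear (frechet_derivative f (at (b + c *\<^sub>R x)))"
    using has_derivative_linear by blast
  show ?thesis
    using partial_deriv_eqI[OF has_derivative_compose[OF 1 2], of j] linear_scale[OF lin]
    by (simp add: partial_deriv_def)
qed

lemma C_k_affine:
  fixes f :: "real^'n::finite \<Rightarrow> real"
  shows "C_k k f \<Longrightarrow> C_k k (\<lambda>x. f (b + c *\<^sub>R x))"
proof (induction k arbitrary: f)
  case 0
  then show ?case by (auto intro!: continuous_intros continuous_on_compose2[of UNIV f])
next
  case (Suc k)
  have "D j (\<lambda>x. f (b + c *\<^sub>R x)) = (\<lambda>x. c * D j f (b + c *\<^sub>R x))" for j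
    using partial_deriv_affine[OF C_k_Suc_differentiable[OF Suc.prems]] by auto
  moreover have "C_k k (\<lambda>x. c * D j f (b + c *\<^sub>R x))" for j
    using Suc.prems by (intro C_k_cmult Suc.IH C_k_SucD)
  moreover have "(\<lambda>x. f (b + c *\<^sub>R x)) differentiable_on UNIV"
    unfolding differentiable_on_def
  proof
    fix x show "(\<lambda>x. f (b + c *\<^sub>R x)) differentiable at x within UNIV"
      using differentiable_chain_at[of "\<lambda>x. b + c *\<^sub>R x" x f] C_k_Suc_differentiable[OF Suc.prems]
      by (auto simp: o_def)
  qed
  ultimately show ?case by simp
qed

lemma has_real_derivative_axis:
  fixes g :: "real^'n::finite \<Rightarrow> real"
  assumes "\<And>y. g differentiable at y"
  shows "((\<lambda>t. g (a + t *\<^sub>R axis j 1)) has_real_derivative D j g (a + t *\<^sub>R axis j 1)) (at t within S)"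
proof -
  have "(\<Sum>l\<in>UNIV. axis j 1 $ l *\<^sub>R D l g (a + t *\<^sub>R axis j 1)) = D j g (a + t *\<^sub>R axis j 1)"
    by (rule partial_deriv_eqI[OF has_derivative_partial[OF assms], symmetric])
  then show ?thesis
    using partial_deriv_line[of g a t "axis j 1" S] assms
    by (simp add: has_real_derivative_iff_has_vector_derivative)
qed

text \<open>Both iterated derivatives are limits of the same second difference quotient.\<close>

lemma second_difference_mean_value:
  fixes f :: "real^'n::finite \<Rightarrow> real"
  assumes f: "C_k 2 f" and h: "h > 0"
  shows "\<exists>y. dist y x \<le> 2 * h \<and>
    f (x + h *\<^sub>R axis i 1 + h *\<^sub>R axis k 1) - f (x + h *\<^sub>R axis i 1) - f (x + h *\<^sub>R axis k 1) + f x
      = h^2 * D k (D i f) y"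
proof -
  have C1: "C_k (Suc (Suc 0)) f" using f by (simp add: numeral_2_eq_2)
  have d0: "f differentiable at y" for y using C_k_Suc_differentiable[OF C1] .
  have d1: "D i f differentiable at y" for y
    using C_k_Suc_differentiable[OF C_k_SucD[OF C1]] .
  note line = has_real_derivative_axis
  define a where "a = x + h *\<^sub>R axis k 1"
  let ?g = "\<lambda>t. f (a + t *\<^sub>R axis i 1) - f (x + t *\<^sub>R axis i 1)"
  have "\<exists>t>0. t < h \<and> ?g h - ?g 0 = (h - 0) * (D i f (a + t *\<^sub>R axis i 1) - D i f (x + t *\<^sub>R axis i 1))"
    using h by (intro MVT2 DERIV_diff line d0)
  then obtain t where t: "0 < t" "t < h"
    and 1: "?g h - ?g 0 = h * (D i f (a + t *\<^sub>R axis i 1) - D i f (x + t *\<^sub>R axis i 1))" by auto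
  let ?k = "\<lambda>s. D i f (x + t *\<^sub>R axis i 1 + s *\<^sub>R axis k 1)"
  have "\<exists>s>0. s < h \<and> ?k h - ?k 0 = (h - 0) * D k (D i f) (x + t *\<^sub>R axis i 1 + s *\<^sub>R axis k 1)"
    using h by (intro MVT2 line d1)
  then obtain s where s: "0 < s" "s < h"
    and 2: "?k h - ?k 0 = h * D k (D i f) (x + t *\<^sub>R axis i 1 + s *\<^sub>R axis k 1)" by auto
  have "norm (t *\<^sub>R axis i 1 + s *\<^sub>R axis k 1 :: real^'n) \<le> t + s"
    using norm_triangle_ineq[of "t *\<^sub>R axis i 1" "s *\<^sub>R axis k 1 :: real^'n"] t s by simp
  then have "dist (x + t *\<^sub>R axis i 1 + s *\<^sub>R axis k 1) x \<le> 2 * h"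
    using t s by (simp add: dist_norm add.assoc)
  moreover have "f (x + h *\<^sub>R axis i 1 + h *\<^sub>R axis k 1) - f (x + h *\<^sub>R axis i 1) - f (x + h *\<^sub>R axis k 1) + f x
      = h^2 * D k (D i f) (x + t *\<^sub>R axis i 1 + s *\<^sub>R axis k 1)"
    using 1 2 by (simp add: a_def algebra_simps power2_eq_square)
  ultimately show ?thesis by blast
qed

lemma partial_deriv_commute:
  fixes f :: "real^'n::finite \<Rightarrow> real"
  assumes f: "C_k 2 f"
  shows "D k (D i f) x = D i (D k f) x"
proof (rule ccontr)
  let ?F = "D k (D i f)" and ?G = "D i (D k f)"
  assume ne: "?F x \<noteq> ?G x"
  define e where "e = \<bar>?F x - ?G x\<bar> / 2"
  have e: "e > 0" using ne by (simp add: e_def)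
  have C: "isCont ?F x" "isCont ?G x"
    using f C_k_continuous[of 0 _ UNIV] by (auto simp: numeral_2_eq_2 continuous_on_eq_continuous_at)
  obtain d1 where d1: "d1 > 0" "\<And>y. dist y x < d1 \<Longrightarrow> dist (?F y) (?F x) < e"
    using C(1) e unfolding continuous_at_eps_delta by blast
  obtain d2 where d2: "d2 > 0" "\<And>y. dist y x < d2 \<Longrightarrow> dist (?G y) (?G x) < e"
    using C(2) e unfolding continuous_at_eps_delta by blast
  define h where "h = min d1 d2 / 3"
  have h: "h > 0" "2 * h < d1" "2 * h < d2" using d1(1) d2(1) by (auto simp: h_def)
  from second_difference_mean_value[OF f h(1), of x i k] obtain y where
    y: "dist y x \<le> 2 * h" "f (x + h *\<^sub>R axis i 1 + h *\<^sub>R axis k 1) - f (x + h *\<^sub>R axis i 1) - f (x + h *\<^sub>R axis k 1) + f x = h^2 * ?F y" by blast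
  from second_difference_mean_value[OF f h(1), of x k i] obtain z where
    z: "dist z x \<le> 2 * h" "f (x + h *\<^sub>R axis k 1 + h *\<^sub>R axis i 1) - f (x + h *\<^sub>R axis k 1) - f (x + h *\<^sub>R axis i 1) + f x = h^2 * ?G z" by blast
  have "h^2 * ?F y = h^2 * ?G z" using y(2) z(2) by (simp add: algebra_simps)
  then have "?F y = ?G z" using h by simp
  moreover have "dist (?F y) (?F x) < e" "dist (?G z) (?G x) < e"
    using d1(2)[of y] d2(2)[of z] y(1) z(1) h by auto
  ultimately show False unfolding e_def dist_real_def by (auto simp: abs_if split: if_splits)
qed

section \<open>Integrals of compactly supported functions\<close>

lemma integrable_continuous_cball:
  fixes f :: "'a::euclidean_space \<Rightarrow> real"
  assumes "continuous_on UNIV f" "\<And>x. norm x > r \<Longrightarrow> f x = 0"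
  shows "integrable lborel f"
proof -
  have "integrable lborel (\<lambda>x. indicator (cball 0 r) x *\<^sub>R f x)"
    by (rule borel_integrable_compact) (auto intro: continuous_on_subset[OF assms(1)])
  moreover have "(\<lambda>x. indicator (cball 0 r) x *\<^sub>R f x) = f"
    using assms(2) by (auto simp: indicator_def fun_eq_iff)
  ultimately show ?thesis by simp
qed

lemma bounded_continuous_cball:
  fixes f :: "'a::euclidean_space \<Rightarrow> real"
  assumes "continuous_on UNIV f" "\<And>x. norm x > r \<Longrightarrow> f x = 0"
  shows "\<exists>B>0. \<forall>x. \<bar>f x\<bar> \<le> B"
proof -
  have "compact (f ` cball 0 r)"
    by (intro compact_continuous_image continuous_on_subset[OF assms(1)]) auto
  then have "bounded (f ` cball 0 r)"
    by (rule compact_imp_bounded)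
  then obtain B where "B > 0" and B: "\<And>y. y \<in> f ` cball 0 r \<Longrightarrow> norm y \<le> B"
    unfolding bounded_pos by blast
  moreover have "\<bar>f x\<bar> \<le> B" for x
  proof (cases "norm x > r")
    case True
    then show ?thesis using assms(2)[OF True] \<open>B > 0\<close> by simp
  next
    case False
    then have "f x \<in> f ` cball 0 r" by simp
    from B[OF this] show ?thesis by simp
  qed
  ultimately show ?thesis by blast
qed

lemma partial_deriv_zero_outside:
  assumes "\<And>x. norm x > r \<Longrightarrow> f x = 0" "norm x > r"
  shows "D j f x = 0"
proof -
  have "((\<lambda>x. 0) has_derivative (\<lambda>h. 0)) (at x)" by simp
  moreover have "open {y :: real^'a. norm y > r}"
    by (intro open_Collect_less continuous_intros)
  ultimately have "(f has_derivative (\<lambda>h. 0)) (at x)"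
    by (rule has_derivative_transform_within_open) (use assms in auto)
  then show ?thesis by (rule partial_deriv_eqI)
qed

lemma lborel_integral_shift:
  fixes f :: "'a::euclidean_space \<Rightarrow> real"
  assumes "f \<in> borel_measurable borel"
  shows "(\<integral>x. f (c + x) \<partial>lborel) = (\<integral>x. f x \<partial>lborel)"
  using integral_distr[of "(+) c" lborel borel f] assms by (simp add: lborel_distr_plus)

text \<open>Translation invariance makes the difference quotients integrate to zero, and they converge
  dominatedly.\<close>

lemma integral_partial_deriv_eq_0:
  fixes f :: "real^'n::finite \<Rightarrow> real"
  assumes f: "C_k 1 f" and supp: "\<And>x. norm x > r \<Longrightarrow> f x = 0"
  shows "(\<integral>x. D j f x \<partial>lborel) = 0"
proof -
  have C1: "C_k (Suc 0) f" using f by simp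
  have d: "f differentiable at y" for y using C_k_Suc_differentiable[OF C1] .
  have cf: "continuous_on UNIV f" and cD: "continuous_on UNIV (D j f)"
    using C_k_continuous[OF C1] C_k_continuous[OF C_k_SucD[OF C1]] by auto
  have [measurable]: "f \<in> borel_measurable borel" "D j f \<in> borel_measurable borel"
    using cf cD borel_measurable_continuous_onI by auto
  have If: "integrable lborel f" by (rule integrable_continuous_cball[OF cf supp])
  have D0: "D j f x = 0" if "norm x > r" for x
    using supp that by (rule partial_deriv_zero_outside)
  have "\<exists>B>0. \<forall>x. \<bar>D j f x\<bar> \<le> B"
    using cD D0 by (rule bounded_continuous_cball)
  then obtain B where B: "B > 0" "\<And>x. \<bar>D j f x\<bar> \<le> B"
    by auto
  let ?e = "axis j 1 :: real^'n"
  define t where "t = (\<lambda>n. 1 / real (Suc n))"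
  have t: "t n > 0" "t n \<le> 1" for n by (auto simp: t_def divide_simps)
  have tlim: "filterlim t (at 0) sequentially"
    unfolding filterlim_at
  proof
    show "t \<longlonglongrightarrow> 0"
      unfolding t_def by (rule LIMSEQ_Suc[OF lim_1_over_n])
    show "\<forall>\<^sub>F n in sequentially. t n \<in> UNIV \<and> t n \<noteq> 0"
      by (rule always_eventually) (simp add: t_def)
  qed
  define q where "q = (\<lambda>n x. (f (t n *\<^sub>R ?e + x) - f x) / t n)"
  have "(\<lambda>n. \<integral>x. q n x \<partial>lborel) \<longlonglongrightarrow> (\<integral>x. D j f x \<partial>lborel)"
  proof (rule integral_dominated_convergence[where w="\<lambda>x. B * indicator (cball 0 (r + 1)) x"])
    show "AE x in lborel. (\<lambda>n. q n x) \<longlonglongrightarrow> D j f x"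
    proof (rule AE_I2)
      fix x :: "real^'n"
      have "((\<lambda>h. (f (x + (0 + h) *\<^sub>R ?e) - f (x + 0 *\<^sub>R ?e)) / h) \<longlongrightarrow> D j f (x + 0 *\<^sub>R ?e)) (at 0)"
        using has_real_derivative_axis[OF d, where a=x and t=0] unfolding has_field_derivative_iff by simp
      then have "(\<lambda>n. (f (x + (0 + t n) *\<^sub>R ?e) - f (x + 0 *\<^sub>R ?e)) / t n) \<longlonglongrightarrow> D j f (x + 0 *\<^sub>R ?e)"
        by (rule filterlim_compose[OF _ tlim])
      then show "(\<lambda>n. q n x) \<longlonglongrightarrow> D j f x"
        by (simp add: q_def add.commute)
    qed
    show "AE x in lborel. norm (q n x) \<le> B * indicator (cball 0 (r + 1)) x" for n
    proof (rule AE_I2)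
      fix x :: "real^'n"
      have "\<exists>s>0. s < t n \<and> f (x + t n *\<^sub>R ?e) - f (x + 0 *\<^sub>R ?e) = (t n - 0) * D j f (x + s *\<^sub>R ?e)"
        by (intro MVT2 t has_real_derivative_axis d)
      then obtain s where s: "0 < s" "s < t n" "q n x = D j f (x + s *\<^sub>R ?e)"
        using t(1)[of n] by (auto simp: q_def add.commute)
      show "norm (q n x) \<le> B * indicator (cball 0 (r + 1)) x"
      proof (cases "norm x \<le> r + 1")
        case True
        then show ?thesis using B(2) s(3) by simp
      next
        case False
        have "norm x \<le> norm (x + s *\<^sub>R ?e) + s" 
          using norm_triangle_ineq4[of "x + s *\<^sub>R ?e" "s *\<^sub>R ?e"] s(1) by simp
        then have "norm (x + s *\<^sub>R ?e) > r" using False s(2) t(2)[of n] by linarith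
        then show ?thesis using D0 s(3) B(1) by simp
      qed
    qed
    show "integrable lborel (\<lambda>x::real^'n. B * indicator (cball 0 (r + 1)) x :: real)"
      by (intro integrable_mult_right integrable_real_indicator) (use emeasure_lborel_cball_finite[of "0::real^'n" "r + 1"] in \<open>simp_all\<close>)
  qed (auto simp: q_def)
  moreover have "(\<integral>x. q n x \<partial>lborel) = 0" for n
  proof -
    have "integrable lborel (\<lambda>x. f (t n *\<^sub>R ?e + x))"
    proof (rule integrable_continuous_cball)
      show "continuous_on UNIV (\<lambda>x. f (t n *\<^sub>R ?e + x))"
        by (intro continuous_on_compose2[OF cf] continuous_intros) auto
      show "norm x > r + 1 \<Longrightarrow> f (t n *\<^sub>R ?e + x) = 0" for x
        using supp[of "t n *\<^sub>R ?e + x"] norm_triangle_ineq4[of "t n *\<^sub>R ?e + x" "t n *\<^sub>R ?e"] t[of n]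
        by simp
    qed
    with If have "(\<integral>x. f (t n *\<^sub>R ?e + x) - f x \<partial>lborel) = 0"
      by (simp add: lborel_integral_shift)
    then show ?thesis by (simp add: q_def)
  qed
  ultimately show ?thesis by (simp add: LIMSEQ_const_iff)
qed

lemma integral_divergence_eq_0:
  fixes P :: "'n::finite \<Rightarrow> real^'n \<Rightarrow> real"
  assumes "\<And>j. C_k 1 (P j)" "\<And>j x. norm x > r \<Longrightarrow> P j x = 0"
  shows "integrable lborel (\<lambda>x. \<Sum>j\<in>UNIV. D j (P j) x)"
    "(\<integral>x. (\<Sum>j\<in>UNIV. D j (P j) x) \<partial>lborel) = 0"
proof -
  have c: "continuous_on UNIV (D j (P j))" for j
    using assms(1)[of j] C_k_continuous[of 0] by auto
  have i: "integrable lborel (D j (P j))" for j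
  proof (rule integrable_continuous_cball[OF c])
    show "D j (P j) x = 0" if "norm x > r" for x
      using assms(2) that by (rule partial_deriv_zero_outside)
  qed
  then show "integrable lborel (\<lambda>x. \<Sum>j\<in>UNIV. D j (P j) x)" by simp
  show "(\<integral>x. (\<Sum>j\<in>UNIV. D j (P j) x) \<partial>lborel) = 0"
    using i integral_partial_deriv_eq_0[OF assms] by (simp add: Bochner_Integration.integral_sum)
qed

text \<open>Every estimate below is a pointwise inequality up to a divergence. The bounds are integrals in
  \<open>[0, \<infinity>]\<close>, where the signed divergence cannot be cancelled, so it is removed before passing to them.\<close>

lemma nn_integral_le_divergence:
  fixes P :: "'n::finite \<Rightarrow> real^'n \<Rightarrow> real"
  assumes P: "\<And>j. C_k 1 (P j)" "\<And>j x. norm x > r \<Longrightarrow> P j x = 0"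
    and f: "continuous_on UNIV f" "\<And>x. norm x > r \<Longrightarrow> f x = 0" "\<And>x. f x \<ge> 0"
    and le: "\<And>x. f x \<le> g x + (\<Sum>j\<in>UNIV. D j (P j) x)"
  shows "(\<integral>\<^sup>+x. ennreal (f x) \<partial>lborel) \<le> (\<integral>\<^sup>+x. ennreal (g x) \<partial>lborel)"
proof -
  let ?d = "\<lambda>x. \<Sum>j\<in>UNIV. D j (P j) x"
  have I: "integrable lborel f" by (rule integrable_continuous_cball[OF f(1,2)])
  note d = integral_divergence_eq_0[OF P]
  have "(\<integral>\<^sup>+x. ennreal (f x) \<partial>lborel) = ennreal (\<integral>x. f x \<partial>lborel)"
    using I f(3) by (intro nn_integral_eq_integral) auto
  also have "(\<integral>x. f x \<partial>lborel) = (\<integral>x. f x - ?d x \<partial>lborel)"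
    using I d by (subst Bochner_Integration.integral_diff) auto
  also have "ennreal \<dots> \<le> (\<integral>\<^sup>+x. ennreal (f x - ?d x) \<partial>lborel)"
  proof -
    have I2: "integrable lborel (\<lambda>x. f x - ?d x)" using I d(1) by (rule Bochner_Integration.integrable_diff)
    have "(\<integral>x. f x - ?d x \<partial>lborel) \<le> (\<integral>x. max 0 (f x - ?d x) \<partial>lborel)"
      using I2 by (intro integral_mono) auto
    moreover have "ennreal (\<integral>x. max 0 (f x - ?d x) \<partial>lborel) = (\<integral>\<^sup>+x. ennreal (max 0 (f x - ?d x)) \<partial>lborel)"
      using I2 by (intro nn_integral_eq_integral[symmetric]) auto
    moreover have "ennreal (max 0 (f x - ?d x)) = ennreal (f x - ?d x)" for x
      by (simp add: max_def ennreal_neg)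
    ultimately show ?thesis by (metis (no_types, lifting) ennreal_leI nn_integral_cong)
  qed
  also have "\<dots> \<le> (\<integral>\<^sup>+x. ennreal (g x) \<partial>lborel)"
    using le by (intro nn_integral_mono ennreal_leI) (simp add: algebra_simps)
  finally show ?thesis .
qed

lemma nn_integral_lborel_shift:
  fixes c :: "'a::euclidean_space"
  assumes "f \<in> borel_measurable borel"
  shows "(\<integral>\<^sup>+x. f (c + x) \<partial>lborel) = (\<integral>\<^sup>+x. f x \<partial>lborel)"
  using nn_integral_distr[of "(+) c" lborel borel f] assms by (simp add: lborel_distr_plus)

lemma nn_integral_lborel_affine:
  fixes b :: "'a::euclidean_space"
  assumes "f \<in> borel_measurable borel" "c > 0"
  shows "(\<integral>\<^sup>+x. f x \<partial>lborel) = ennreal (c ^ DIM('a)) * (\<integral>\<^sup>+x. f (b + c *\<^sub>R x) \<partial>lborel)"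
  using assms
  by (subst lborel_affine[of c b]) (auto simp: nn_integral_density nn_integral_distr nn_integral_cmult)

lemma integral_cbox_le_nn_integral:
  fixes g :: "'a::euclidean_space \<Rightarrow> real"
  assumes "continuous_on UNIV g"
  shows "ennreal \<bar>integral (cbox a b) g\<bar> \<le> (\<integral>\<^sup>+x. ennreal \<bar>g x\<bar> * indicator (cbox a b) x \<partial>lborel)"
proof -
  have I: "set_integrable lborel (cbox a b) g"
    unfolding set_integrable_def
    by (rule borel_integrable_compact) (auto intro: continuous_on_subset[OF assms])
  have "integral (cbox a b) g = (\<integral>x. indicator (cbox a b) x *\<^sub>R g x \<partial>lborel)"
    using set_borel_integral_eq_integral(2)[OF I] by (simp add: set_lebesgue_integral_def)
  also have "ennreal \<bar>\<dots>\<bar> \<le> (\<integral>\<^sup>+x. ennreal (norm (indicator (cbox a b) x *\<^sub>R g x)) \<partial>lborel)"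
    using integral_norm_bound_ennreal[of lborel "\<lambda>x. indicator (cbox a b) x *\<^sub>R g x"] I
    by (simp add: set_integrable_def)
  also have "\<dots> = (\<integral>\<^sup>+x. ennreal \<bar>g x\<bar> * indicator (cbox a b) x \<partial>lborel)"
    by (intro nn_integral_cong) (auto simp: indicator_def)
  finally show ?thesis .
qed

section \<open>A family of cut-off functions\<close>

lemma has_real_derivative_max_power:
  assumes "n \<ge> 1"
  shows "((\<lambda>t. max 0 t ^ Suc n) has_real_derivative real (Suc n) * max 0 t ^ n) (at (t::real))"
proof -
  consider "t > 0" | "t < 0" | "t = 0" by linarith
  then show ?thesis
  proof cases
    case 1
    have "((\<lambda>t. t ^ Suc n) has_real_derivative real (Suc n) * max 0 t ^ n) (at t)"
      using 1 DERIV_pow[of "Suc n" t UNIV] by (simp add: max_def)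
    then show ?thesis
      by (rule has_field_derivative_transform_within_open[of _ _ _ "{0<..}"]) (use 1 in auto)
  next
    case 2
    have "((\<lambda>t. 0) has_real_derivative real (Suc n) * max 0 t ^ n) (at t)"
      using 2 assms by (simp add: max_def zero_power)
    then show ?thesis
      by (rule has_field_derivative_transform_within_open[of _ _ _ "{..<0}"]) (use 2 in auto)
  next
    case 3
    have "((\<lambda>h::real. max 0 h ^ Suc n / h) \<longlongrightarrow> 0) (at 0)"
    proof (rule Lim_null_comparison)
      show "eventually (\<lambda>h::real. norm (max 0 h ^ Suc n / h) \<le> \<bar>h\<bar> ^ n) (at 0)"
        unfolding eventually_at by (intro exI[of _ 1]) (auto simp: max_def)
      have "((\<lambda>h::real. \<bar>h\<bar> ^ n) \<longlongrightarrow> \<bar>0\<bar> ^ n) (at 0)"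
        by (intro tendsto_intros)
      then show "((\<lambda>h::real. \<bar>h\<bar> ^ n) \<longlongrightarrow> 0) (at 0)" using assms by (simp add: zero_power)
    qed
    moreover have "real (Suc n) * max 0 t ^ n = 0" using 3 assms by (simp add: zero_power)
    ultimately show ?thesis using 3 assms unfolding has_field_derivative_iff by (auto simp: power_0_left)
  qed
qed

text \<open>The exponent counts derivatives: \<open>bump n r\<close> is \<open>n - 1\<close> times continuously differentiable, and
  differentiating lowers \<open>n\<close> by one. In place of a plateau there is the lower bound \<open>bump_inside\<close> on smaller
  balls, which costs only a power of the distance of the radii.\<close>

definition bump :: "nat \<Rightarrow> real \<Rightarrow> real^'n::finite \<Rightarrow> real" where
  "bump n r x = max 0 (1 - (norm x)\<^sup>2 / r\<^sup>2) ^ n"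

lemma has_derivative_bump:
  fixes x :: "real^'n::finite"
  assumes "n \<ge> 1"
  shows "(bump (Suc n) r has_derivative
    (\<lambda>h. real (Suc n) * bump n r x * (- (2 * (x \<bullet> h) / r\<^sup>2)))) (at x)"
proof -
  let ?s = "\<lambda>x::real^'n. 1 - (x \<bullet> x) / r\<^sup>2"
  have 1: "(?s has_derivative (\<lambda>h. - (2 * (x \<bullet> h) / r\<^sup>2))) (at x)"
  proof -
    have "((\<lambda>x. 1 - inverse (r\<^sup>2) * (x \<bullet> x)) has_derivative (\<lambda>h. - (inverse (r\<^sup>2) * (x \<bullet> h + h \<bullet> x)))) (at x)"
      by (auto intro!: derivative_eq_intros)
    then show ?thesis by (simp add: divide_inverse inner_commute mult.commute)
  qed
  have 2: "((\<lambda>t. max 0 t ^ Suc n) has_derivative (\<lambda>h. real (Suc n) * max 0 (?s x) ^ n * h)) (at (?s x))"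
    using has_real_derivative_max_power[OF assms] by (simp add: has_field_derivative_def)
  show ?thesis
    using has_derivative_compose[OF 1 2] by (simp add: bump_def[abs_def] power2_norm_eq_inner)
qed

lemma partial_deriv_bump:
  assumes "n \<ge> 1"
  shows "D j (bump (Suc n) r) = (\<lambda>x. (- (2 * real (Suc n) / r\<^sup>2)) * (x $ j * bump n r x))"
  by (rule ext, subst partial_deriv_eqI[OF has_derivative_bump[OF assms]]) (simp add: inner_axis inner_real_def divide_inverse)

lemma has_derivative_coordinate: "((\<lambda>x::real^'n::finite. x $ i) has_derivative (\<lambda>h. h $ i)) (at x)"
  by (rule bounded_linear_imp_has_derivative[OF bounded_linear_vec_nth])

lemma differentiable_coordinate: "(\<lambda>x::real^'n::finite. x $ i) differentiable (at x)"
  using has_derivative_coordinate unfolding differentiable_def by blast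

lemma partial_deriv_coordinate: "D j (\<lambda>x::real^'n::finite. x $ i) = (\<lambda>x. if i = j then 1 else 0)"
  by (rule ext, subst partial_deriv_eqI[OF has_derivative_coordinate]) (simp add: axis_def)

lemma C_k_coordinate: "C_k k (\<lambda>x::real^'n::finite. x $ i)"
proof (cases k)
  case 0
  then show ?thesis by (auto intro!: continuous_intros)
next
  case (Suc m)
  then show ?thesis
    by (simp add: partial_deriv_coordinate C_k_const differentiable_on_def differentiable_coordinate)
qed

lemma C_k_bump: "k < n \<Longrightarrow> C_k k (bump n r)"
proof (induction k arbitrary: n)
  case 0
  then show ?case by (auto simp: bump_def[abs_def] divide_inverse intro!: continuous_intros)
next
  case (Suc k)
  then obtain m where n: "n = Suc m" and m: "m \<ge> 1" "k < m" by (cases n) auto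
  have "bump n r differentiable_on UNIV"
    using has_derivative_bump[OF m(1)] unfolding n differentiable_on_def differentiable_def by blast
  then show ?case
    using Suc.IH[OF m(2)] by (simp only: C_k.simps n partial_deriv_bump[OF m(1)]) (intro conjI allI C_k_cmult C_k_mult C_k_coordinate; assumption)
qed

lemma bump_nonneg: "bump n r x \<ge> 0"
  and bump_le_1: "bump n r x \<le> 1"
  by (auto simp: bump_def intro!: power_le_one)

lemma bump_outside: "n \<ge> 1 \<Longrightarrow> norm x \<ge> r \<Longrightarrow> r > 0 \<Longrightarrow> bump n r x = 0"
  using power_mono[of r "norm x" 2] by (simp add: bump_def max_def divide_simps not_le)

lemma bump_inside:
  assumes "norm x \<le> s" "s < r"
  shows "bump n r x \<ge> ((r - s) / r) ^ n"
proof -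
  have s: "0 \<le> s" using assms(1) norm_ge_zero order_trans by blast
  have "(norm x)\<^sup>2 \<le> s * r"
    using assms s mult_mono[of "norm x" s "norm x" r] by (simp add: power2_eq_square)
  then have "(norm x)\<^sup>2 / r\<^sup>2 \<le> s / r" using assms s by (simp add: divide_simps power2_eq_square)
  then have "(r - s) / r \<le> 1 - (norm x)\<^sup>2 / r\<^sup>2" using assms s by (simp add: diff_divide_distrib)
  then show ?thesis unfolding bump_def using assms s by (intro power_mono) auto
qed

section \<open>Averaged translations\<close>

text \<open>Two parameter spaces occur: \<open>z = y\<close> with shift \<open>h y\<close> for the mollifier, and \<open>z = (t, y)\<close> with shift
  \<open>t h y\<close> for averages along segments. Only the translate of \<open>f\<close> depends on \<open>x\<close>, so averaging commutes with
  partial derivatives.\<close>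

definition avg :: "('z::euclidean_space \<Rightarrow> real) \<Rightarrow> ('z \<Rightarrow> real^'n::finite) \<Rightarrow> 'z \<Rightarrow> 'z \<Rightarrow>
    (real^'n \<Rightarrow> real) \<Rightarrow> real^'n \<Rightarrow> real" where
  "avg m \<zeta> a b f x = integral (cbox a b) (\<lambda>z. m z * f (x - \<zeta> z))"

lemma continuous_on_avg_integrand:
  fixes m :: "'z::topological_space \<Rightarrow> real" and f :: "'a::real_normed_vector \<Rightarrow> real"
  assumes "continuous_on UNIV m" "continuous_on UNIV \<zeta>" "continuous_on UNIV f"
  shows "continuous_on S (\<lambda>z. m z * f (x - \<zeta> z))"
proof -
  have "continuous_on UNIV (\<lambda>z. m z * f (x - \<zeta> z))"
    by (intro continuous_on_mult assms(1,2) continuous_on_compose2[OF assms(3)]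
        continuous_on_diff continuous_on_const) auto
  then show ?thesis by (rule continuous_on_subset) simp
qed

lemma continuous_on_avg:
  assumes m: "continuous_on UNIV m" and \<zeta>: "continuous_on UNIV \<zeta>" and f: "continuous_on UNIV f"
  shows "continuous_on UNIV (avg m \<zeta> a b f)"
proof -
  have "continuous_on (UNIV \<times> cbox a b) (\<lambda>(x, z). m z * f (x - \<zeta> z))"
    unfolding split_beta
    by (intro continuous_intros continuous_on_compose2[OF f]
        continuous_on_compose2[OF m] continuous_on_compose2[OF \<zeta>]) auto
  then show ?thesis
    unfolding avg_def[abs_def] by (rule integral_continuous_on_param)
qed

lemma has_derivative_avg:
  assumes m: "continuous_on UNIV m" and \<zeta>: "continuous_on UNIV \<zeta>" and f: "C_k (Suc 0) f"
  shows "(avg m \<zeta> a b f has_derivative (\<lambda>h. \<Sum>j\<in>UNIV. h $ j * avg m \<zeta> a b (D j f) x)) (at x)"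
proof -
  define B where "B = (\<lambda>j::'b. Blinfun (\<lambda>h::real^'b. h $ j))"
  have B: "blinfun_apply (B j) h = h $ j" for j h
    unfolding B_def by (simp add: bounded_linear_Blinfun_apply bounded_linear_vec_nth)
  have cf: "continuous_on UNIV f" and cD: "continuous_on UNIV (D j f)" for j
    using C_k_continuous[OF f] C_k_continuous[OF C_k_SucD[OF f]] by auto
  define F where "F = (\<lambda>x z. \<Sum>j\<in>UNIV. (m z * D j f (x - \<zeta> z)) *\<^sub>R B j)"
  have F: "blinfun_apply (F x z) h = (\<Sum>j\<in>UNIV. m z * D j f (x - \<zeta> z) * h $ j)" for x z h
    by (simp add: F_def blinfun.sum_left blinfun.scaleR_left B)
  have F_int: "F x integrable_on cbox a b" for x
    unfolding F_def
    by (intro integrable_sum integrable_continuous continuous_intros continuous_on_avg_integrand m \<zeta> cD) auto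
  have "((\<lambda>x. integral (cbox a b) (\<lambda>z. m z * f (x - \<zeta> z))) has_derivative integral (cbox a b) (F x)) (at x within UNIV)"
  proof (rule leibniz_rule)
    show "((\<lambda>x. m z * f (x - \<zeta> z)) has_derivative blinfun_apply (F x z)) (at x within UNIV)" for x z
    proof -
      have 1: "((\<lambda>x. x - \<zeta> z) has_derivative (\<lambda>h. h)) (at x)"
        by (auto intro!: derivative_eq_intros)
      have "((\<lambda>x. f (x - \<zeta> z)) has_derivative (\<lambda>h. \<Sum>j\<in>UNIV. h $ j * D j f (x - \<zeta> z))) (at x)"
        using has_derivative_compose[OF 1 has_derivative_partial[OF C_k_Suc_differentiable[OF f]]] by simp
      from has_derivative_mult_right[OF this, of "m z"] show ?thesis
        by (rule has_derivative_eq_rhs) (auto simp: F sum_distrib_left ac_simps fun_eq_iff)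
    qed
    show "(\<lambda>z. m z * f (x - \<zeta> z)) integrable_on cbox a b" for x
      by (intro integrable_continuous continuous_on_avg_integrand m \<zeta> cf)
    show "continuous_on (UNIV \<times> cbox a b) (\<lambda>(x, z). F x z)"
      unfolding F_def split_beta
      by (intro continuous_intros continuous_on_compose2[OF cD]
          continuous_on_compose2[OF m] continuous_on_compose2[OF \<zeta>]) auto
  qed auto
  then have 1: "(avg m \<zeta> a b f has_derivative integral (cbox a b) (F x)) (at x)"
    by (simp add: avg_def[abs_def])
  have "blinfun_apply (integral (cbox a b) (F x)) h = (\<Sum>j\<in>UNIV. h $ j * avg m \<zeta> a b (D j f) x)" for h
  proof -
    have "blinfun_apply (integral (cbox a b) (F x)) h = integral (cbox a b) (\<lambda>z. blinfun_apply (F x z) h)"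
      using integral_linear[OF F_int blinfun.bounded_linear_left[of h], symmetric] by (simp add: o_def)
    also have "\<dots> = (\<Sum>j\<in>UNIV. integral (cbox a b) (\<lambda>z. m z * D j f (x - \<zeta> z) * h $ j))"
      unfolding F
      by (intro integral_sum integrable_continuous continuous_on_mult_right continuous_on_avg_integrand m \<zeta> cD) auto
    also have "\<dots> = (\<Sum>j\<in>UNIV. h $ j * avg m \<zeta> a b (D j f) x)"
      by (simp add: avg_def mult.commute)
    finally show ?thesis .
  qed
  then have "blinfun_apply (integral (cbox a b) (F x)) = (\<lambda>h. \<Sum>j\<in>UNIV. h $ j * avg m \<zeta> a b (D j f) x)"
    by (rule ext)
  with 1 show ?thesis by (rule has_derivative_eq_rhs)
qed

lemma partial_deriv_avg:
  assumes "continuous_on UNIV m" "continuous_on UNIV \<zeta>" "C_k (Suc k) f"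
  shows "D j (avg m \<zeta> a b f) = avg m \<zeta> a b (D j f)"
proof
  fix x
  have "C_k (Suc 0) f" by (rule C_k_mono[OF assms(3)]) simp
  then have "D j (avg m \<zeta> a b f) x = (\<Sum>l\<in>UNIV. axis j 1 $ l * avg m \<zeta> a b (D l f) x)"
    by (intro partial_deriv_eqI has_derivative_avg assms)
  also have "\<dots> = avg m \<zeta> a b (D j f) x"
    by (simp add: axis_def if_distrib[of "\<lambda>c. c * _"] cong: if_cong)
  finally show "D j (avg m \<zeta> a b f) x = avg m \<zeta> a b (D j f) x" .
qed

lemma C_k_avg:
  assumes m: "continuous_on UNIV m" and \<zeta>: "continuous_on UNIV \<zeta>"
  shows "C_k k f \<Longrightarrow> C_k k (avg m \<zeta> a b f)"
proof (induction k arbitrary: f)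
  case 0
  then show ?case using continuous_on_avg[OF assms] by simp
next
  case (Suc k)
  have "C_k (Suc 0) f" by (rule C_k_mono[OF Suc.prems]) simp
  then have "avg m \<zeta> a b f differentiable_on UNIV"
    unfolding differentiable_on_def differentiable_def using has_derivative_avg[OF assms] by blast
  then show ?case
    using Suc partial_deriv_avg[OF assms Suc.prems] by simp
qed

section \<open>The mollifier and its vector potential\<close>

lemma integral_cbox_eq_lborel:
  fixes g :: "real^'n::finite \<Rightarrow> real"
  assumes "continuous_on UNIV g" "\<And>x. norm x \<ge> 1 \<Longrightarrow> g x = 0"
  shows "integral (cbox (-One) One) g = (\<integral>x. g x \<partial>lborel)"
proof -
  have I: "set_integrable lborel (cbox (-One) One) g"
    unfolding set_integrable_def
    by (rule borel_integrable_compact) (auto intro: continuous_on_subset[OF assms(1)])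
  have "norm x \<ge> 1" if "x \<notin> cbox (-One) One" for x :: "real^'n"
    using that Basis_le_norm[of _ x] by (force simp: mem_box)
  then have "(\<lambda>x. indicator (cbox (-One) One) x *\<^sub>R g x) = g"
    using assms(2) by (auto simp: indicator_def fun_eq_iff)
  then show ?thesis
    using set_borel_integral_eq_integral(2)[OF I] by (simp only: set_lebesgue_integral_def)
qed

definition kern :: "real^'n::finite \<Rightarrow> real" where
  "kern y = bump 4 1 y / integral (cbox (-One) One) (bump 4 1 :: real^'n \<Rightarrow> real)"

lemma bump_integral_pos: "integral (cbox (-One) One) (bump 4 1 :: real^'n::finite \<Rightarrow> real) > 0"
proof -
  have c: "continuous_on UNIV (bump 4 1 :: real^'n \<Rightarrow> real)"
    by (rule C_k_continuous[OF C_k_bump[of 0]]) simp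
  have I: "integrable lborel (bump 4 1 :: real^'n \<Rightarrow> real)"
    by (rule integrable_continuous_cball[OF c, of 1]) (simp add: bump_outside)
  have "0 < (1/2)^4 * measure lborel (ball 0 (1/2) :: (real^'n) set)"
    using content_ball_pos[of "1/2" "0::real^'n"] by (simp add: measure_def)
  also have "\<dots> = (\<integral>x. (1/2)^4 * indicator (ball 0 (1/2) :: (real^'n) set) x \<partial>lborel)"
    by simp
  also have "\<dots> \<le> (\<integral>x. bump 4 1 (x::real^'n) \<partial>lborel)"
  proof (rule integral_mono[OF _ I])
    show "integrable lborel (\<lambda>x. (1/2)^4 * indicator (ball 0 (1/2) :: (real^'n) set) x :: real)"
      using emeasure_lborel_ball_finite[of "0::real^'n" "1/2"] by simp
    show "(1/2)^4 * indicator (ball 0 (1/2)) x \<le> bump 4 1 x" for x :: "real^'n"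
      using bump_inside[of x "1/2" 1 4] bump_nonneg[of 4 1 x] by (auto simp: indicator_def)
  qed
  also have "\<dots> = integral (cbox (-One) One) (bump 4 1 :: real^'n \<Rightarrow> real)"
    by (rule integral_cbox_eq_lborel[symmetric, OF c]) (simp add: bump_outside)
  finally show ?thesis .
qed

lemma kern_eq_cmult: "(kern :: real^'n::finite \<Rightarrow> real) = (\<lambda>y. inverse (integral (cbox (-One) One) (bump 4 1 :: real^'n \<Rightarrow> real)) * bump 4 1 y)"
  by (simp add: kern_def[abs_def] divide_inverse mult.commute)

lemma C_k_kern: "C_k 1 kern"
  unfolding kern_eq_cmult by (intro C_k_cmult C_k_bump) simp

lemma continuous_on_kern: "continuous_on S kern"
  by (rule C_k_continuous[OF C_k_kern])

lemma kern_outside: "norm y \<ge> 1 \<Longrightarrow> kern y = 0"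
  by (simp add: kern_def bump_outside)

lemma integral_kern: "integral (cbox (-One) One) (kern :: real^'n::finite \<Rightarrow> real) = 1"
  using bump_integral_pos[where 'n='n] by (simp add: kern_eq_cmult)

definition mollify :: "real \<Rightarrow> (real^'n::finite \<Rightarrow> real) \<Rightarrow> real^'n \<Rightarrow> real" where
  "mollify h = avg kern (\<lambda>y. h *\<^sub>R y) (-One) One"

text \<open>Averages, over \<open>y\<close>, of \<open>y\<^sub>k f\<close> along the segment from \<open>x\<close> to \<open>x - h y\<close>: the building
  blocks of the vector potential.\<close>

definition pot :: "real \<Rightarrow> 'n::finite \<Rightarrow> (real^'n \<Rightarrow> real) \<Rightarrow> real^'n \<Rightarrow> real" where
  "pot h k = avg (\<lambda>(t, y). kern y * y $ k) (\<lambda>(t, y). (t * h) *\<^sub>R y) (0, -One) (1, One)"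

lemma continuous_on_kern_coordinate: "continuous_on S (\<lambda>(t::real, y). kern y * y $ k)"
  unfolding split_beta
  by (intro continuous_intros continuous_on_compose2[OF continuous_on_kern[of UNIV]]) auto

lemma continuous_on_dilation: "continuous_on S (\<lambda>(t, y::'a::real_normed_vector). (t * h) *\<^sub>R y)"
  unfolding split_beta by (intro continuous_intros)

lemma C_k_mollify: "C_k k f \<Longrightarrow> C_k k (mollify h f)"
  unfolding mollify_def by (intro C_k_avg continuous_on_kern continuous_intros)

lemma C_k_pot: "C_k k f \<Longrightarrow> C_k k (pot h i f)"
  unfolding pot_def by (intro C_k_avg continuous_on_kern_coordinate continuous_on_dilation)

lemma partial_deriv_pot: "C_k (Suc k) f \<Longrightarrow> D j (pot h i f) = pot h i (D j f)"
  unfolding pot_def by (intro partial_deriv_avg continuous_on_kern_coordinate continuous_on_dilation)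

lemma partial_deriv_mollify: "C_k (Suc k) f \<Longrightarrow> D j (mollify h f) = mollify h (D j f)"
  unfolding mollify_def by (intro partial_deriv_avg continuous_on_kern continuous_intros)

text \<open>The fundamental theorem of calculus on the segment from \<open>x\<close> to \<open>x - h y\<close>, averaged over \<open>y\<close>. The
  left-hand side exhibits \<open>f - mollify h f\<close> as a quantity of size \<open>h \<nabla>f\<close>.\<close>

lemma sum_pot_partial_deriv:
  fixes f :: "real^'n::finite \<Rightarrow> real"
  assumes f: "C_k 1 f"
  shows "h * (\<Sum>k\<in>UNIV. pot h k (D k f) x) = f x - mollify h f x"
proof -
  have C1: "C_k (Suc 0) f" using f by simp
  have d: "f differentiable at y" for y by (rule C_k_Suc_differentiable[OF C1])
  have cf: "continuous_on UNIV f" and cD: "\<And>j. continuous_on UNIV (D j f)"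
    using C_k_continuous[OF C1] C_k_continuous[OF C_k_SucD[OF C1]] by auto
  let ?g = "\<lambda>t y. \<Sum>k\<in>UNIV. kern y * y $ k * D k f (x - (t * h) *\<^sub>R y)"
  have cg: "continuous_on S (\<lambda>(t, y). ?g t y)" for S
    unfolding split_beta
    by (intro continuous_intros continuous_on_compose2[OF continuous_on_kern[of UNIV]] continuous_on_compose2[OF cD]) auto
  have inner: "h * integral (cbox 0 1) (\<lambda>t. ?g t y) = kern y * (f x - f (x - h *\<^sub>R y))" for y
  proof -
    have "((\<lambda>t. - kern y * f (x + t *\<^sub>R (- h *\<^sub>R y))) has_vector_derivative h * ?g t y) (at t within {0..1})" for t
    proof -
      have "((\<lambda>t. - kern y * f (x + t *\<^sub>R (- h *\<^sub>R y))) has_vector_derivative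
          - kern y * (\<Sum>j\<in>UNIV. (- h *\<^sub>R y) $ j *\<^sub>R D j f (x + t *\<^sub>R (- h *\<^sub>R y)))) (at t within {0..1})"
        by (intro has_vector_derivative_mult_right partial_deriv_line d)
      also have "- kern y * (\<Sum>j\<in>UNIV. (- h *\<^sub>R y) $ j *\<^sub>R D j f (x + t *\<^sub>R (- h *\<^sub>R y))) = h * ?g t y"
        by (simp add: sum_distrib_left sum_negf ac_simps)
      finally show ?thesis .
    qed
    then have "((\<lambda>t. h * ?g t y) has_integral
        (- kern y * f (x + 1 *\<^sub>R (- h *\<^sub>R y)) - - kern y * f (x + 0 *\<^sub>R (- h *\<^sub>R y)))) {0..1}"
      by (intro fundamental_theorem_of_calculus) auto
    then have "integral {0..1} (\<lambda>t. h * ?g t y) = kern y * (f x - f (x - h *\<^sub>R y))"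
      by (intro integral_unique) (simp add: algebra_simps)
    then show ?thesis by (simp add: cbox_interval)
  qed
  have "(\<Sum>k\<in>UNIV. pot h k (D k f) x) = integral (cbox (0, -One) (1, One)) (\<lambda>(t, y). ?g t y)"
  proof -
    have "integral (cbox (0, -One) (1, One)) (\<lambda>z. \<Sum>k\<in>UNIV. (case z of (t, y) \<Rightarrow> kern y * y $ k) *
          D k f (x - (case z of (t, y) \<Rightarrow> (t * h) *\<^sub>R y)))
        = (\<Sum>k\<in>UNIV. pot h k (D k f) x)"
      unfolding pot_def avg_def
      by (intro integral_sum integrable_continuous continuous_on_avg_integrand
          continuous_on_kern_coordinate continuous_on_dilation cD) auto
    then show ?thesis by (simp add: case_prod_unfold)
  qed
  also have "\<dots> = integral (cbox (-One) One) (\<lambda>y. integral (cbox 0 1) (\<lambda>t. ?g t y))"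
    using integral_prod_continuous[OF cg] integral_swap_continuous[OF cg] by simp
  finally have "h * (\<Sum>k\<in>UNIV. pot h k (D k f) x)
      = integral (cbox (-One) One) (\<lambda>y. h * integral (cbox 0 1) (\<lambda>t. ?g t y))"
    by simp
  also have "\<dots> = integral (cbox (-One) One) (\<lambda>y. kern y * (f x - f (x - h *\<^sub>R y)))"
    by (simp only: inner)
  also have "\<dots> = integral (cbox (-One) One) (\<lambda>y::real^'n. kern y * f x) - integral (cbox (-One) One) (\<lambda>y. kern y * f (x - h *\<^sub>R y))"
    unfolding right_diff_distrib
  proof (rule Henstock_Kurzweil_Integration.integral_diff)
    show "(\<lambda>y::real^'n. kern y * f x) integrable_on cbox (-One) One"
      by (intro integrable_continuous continuous_on_mult continuous_on_kern continuous_on_const)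
    show "(\<lambda>y. kern y * f (x - h *\<^sub>R y)) integrable_on cbox (-One) One"
      by (intro integrable_continuous continuous_on_avg_integrand continuous_on_kern cf
          continuous_on_scaleR continuous_on_const continuous_on_id)
  qed
  also have "\<dots> = f x - mollify h f x"
    by (simp add: mollify_def avg_def integral_kern)
  finally show ?thesis .
qed

text \<open>Mollification trades a derivative for a factor \<open>1 / h\<close>: integration by parts in \<open>y\<close> moves the derivative
  onto the kernel.\<close>

lemma partial_deriv_mollify_kern:
  fixes f :: "real^'n::finite \<Rightarrow> real"
  assumes f: "C_k 1 f"
  shows "h * D j (mollify h f) x = avg (D j kern) (\<lambda>y. h *\<^sub>R y) (-One) One f x"
proof -
  have C1: "C_k (Suc 0) f" using f by simp
  have cf: "continuous_on UNIV f" and cD: "\<And>j. continuous_on UNIV (D j f)"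
    using C_k_continuous[OF C1] C_k_continuous[OF C_k_SucD[OF C1]] by auto
  have k1: "C_k (Suc 0) (kern :: real^'n \<Rightarrow> real)" using C_k_kern by simp
  have ck: "continuous_on UNIV (D j kern :: real^'n \<Rightarrow> real)" 
    using C_k_continuous[OF C_k_SucD[OF k1]] by auto
  let ?F = "\<lambda>y. kern y * f (x + (-h) *\<^sub>R y)"
  have CF: "C_k 1 ?F" by (intro C_k_mult C_k_kern C_k_affine f)
  have DF: "D j ?F y = D j kern y * f (x - h *\<^sub>R y) - h * (kern y * D j f (x - h *\<^sub>R y))" for y
  proof -
    have "C_k (Suc 0) (\<lambda>y. f (x + (-h) *\<^sub>R y))" by (rule C_k_affine[OF C1])
    then have d: "(\<lambda>y. f (x + (-h) *\<^sub>R y)) differentiable at y"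
      by (rule C_k_Suc_differentiable)
    show ?thesis
      unfolding partial_deriv_mult[OF C_k_Suc_differentiable[OF k1] d]
        partial_deriv_affine[OF C_k_Suc_differentiable[OF C1]] by simp
  qed
  have "0 = (\<integral>y. D j ?F y \<partial>lborel)"
    by (rule integral_partial_deriv_eq_0[symmetric, OF CF, of 1]) (simp add: kern_outside)
  also have "\<dots> = integral (cbox (-One) One) (D j ?F)"
  proof (rule integral_cbox_eq_lborel[symmetric])
    show "continuous_on UNIV (D j ?F)" using CF C_k_continuous[of 0] by simp
    show "D j ?F y = 0" if "norm y \<ge> 1" for y
    proof -
      have "bump 3 1 y = 0" using that by (simp add: bump_outside)
      then have "D j kern y = 0"
        unfolding kern_eq_cmult
        by (subst partial_deriv_cmult[OF C_k_Suc_differentiable[OF C_k_bump[of "Suc 0"]]])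
          (simp_all add: partial_deriv_bump[of 3, simplified])
      then show ?thesis unfolding DF using that by (simp add: kern_outside)
    qed
  qed
  also have "\<dots> = integral (cbox (-One) One) (\<lambda>y. D j kern y * f (x - h *\<^sub>R y))
      - integral (cbox (-One) One) (\<lambda>y. h * (kern y * D j f (x - h *\<^sub>R y)))"
    unfolding DF
    by (intro Henstock_Kurzweil_Integration.integral_diff integrable_continuous continuous_on_mult_left
        continuous_on_avg_integrand continuous_on_kern continuous_intros cf cD ck)
  also have "\<dots> = avg (D j kern) (\<lambda>y. h *\<^sub>R y) (-One) One f x - h * D j (mollify h f) x"
    by (subst partial_deriv_mollify[OF C1]) (simp add: avg_def mollify_def)
  finally show ?thesis by simp
qed

section \<open>Weighted estimates for the averages\<close>

lemma ball_in_borel [measurable]: "ball (c::'a::metric_space) r \<in> sets borel"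
  by simp

definition unit_vol :: "'n::finite itself \<Rightarrow> real" where
  "unit_vol _ = measure lborel (ball (0::real^'n) 1)"

lemma nn_integral_indicator_unit_ball:
  "(\<integral>\<^sup>+y. indicator (ball (0::real^'n::finite) 1) y \<partial>lborel) = ennreal (unit_vol TYPE('n))"
  using emeasure_lborel_ball_finite[of "0::real^'n" 1]
  by (simp add: unit_vol_def measure_def)

lemma unit_vol_pos: "unit_vol TYPE('n::finite) > 0"
  using content_ball_pos[of 1 "0::real^'n"] by (simp add: unit_vol_def measure_def)

lemma Cauchy_Schwarz_unit_ball:
  fixes g :: "real^'n::finite \<Rightarrow> real"
  assumes [measurable]: "g \<in> borel_measurable borel"
  shows "(\<integral>\<^sup>+y. ennreal \<bar>g y\<bar> * indicator (ball 0 1) y \<partial>lborel)\<^sup>2 \<le>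
    ennreal (unit_vol TYPE('n)) * ball_int (\<lambda>y. (g y)\<^sup>2) 1"
proof -
  have "(\<integral>\<^sup>+y. indicator (ball 0 1) y * (ennreal \<bar>g y\<bar> * indicator (ball 0 1) y) \<partial>lborel)\<^sup>2 \<le>
    (\<integral>\<^sup>+y. (indicator (ball (0::real^'n) 1) y)\<^sup>2 \<partial>lborel) * (\<integral>\<^sup>+y. (ennreal \<bar>g y\<bar> * indicator (ball 0 1) y)\<^sup>2 \<partial>lborel)"
    by (intro Cauchy_Schwarz_nn_integral) auto
  also have "(\<lambda>y. indicator (ball 0 1) y * (ennreal \<bar>g y\<bar> * indicator (ball 0 1) y)) = (\<lambda>y. ennreal \<bar>g y\<bar> * indicator (ball 0 1) y)"
    by (auto simp: indicator_def)
  also have "(\<lambda>y. (indicator (ball (0::real^'n) 1) y)\<^sup>2 :: ennreal) = indicator (ball 0 1)"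
    by (auto simp: indicator_def)
  also have "(\<lambda>y. (ennreal \<bar>g y\<bar> * indicator (ball 0 1) y)\<^sup>2) = (\<lambda>y. ennreal ((g y)\<^sup>2) * indicator (ball 0 1) y)"
    by (auto simp: indicator_def ennreal_power)
  finally show ?thesis by (simp add: nn_integral_indicator_unit_ball del: nn_integral_indicator)
qed

lemma avg_le_unit_ball:
  fixes f :: "real^'n::finite \<Rightarrow> real"
  assumes m: "continuous_on UNIV m" "\<And>y. norm y \<ge> 1 \<Longrightarrow> m y = 0" "\<And>y. \<bar>m y\<bar> \<le> C" and f: "continuous_on UNIV f"
  shows "ennreal \<bar>avg m (\<lambda>y. h *\<^sub>R y) (-One) One f x\<bar> \<le> ennreal C * (\<integral>\<^sup>+y. ennreal \<bar>f (x - h *\<^sub>R y)\<bar> * indicator (ball 0 1) y \<partial>lborel)"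
proof -
  have [measurable]: "f \<in> borel_measurable borel" using f by (rule borel_measurable_continuous_onI)
  have C: "C \<ge> 0" using m(3)[of 0] by (meson abs_ge_zero order_trans)
  have "ennreal \<bar>avg m (\<lambda>y. h *\<^sub>R y) (-One) One f x\<bar> \<le>
      (\<integral>\<^sup>+y. ennreal \<bar>m y * f (x - h *\<^sub>R y)\<bar> * indicator (cbox (-One) One) y \<partial>lborel)"
    unfolding avg_def
    by (intro integral_cbox_le_nn_integral continuous_on_avg_integrand m f continuous_intros)
  also have "\<dots> \<le> (\<integral>\<^sup>+y. ennreal C * (ennreal \<bar>f (x - h *\<^sub>R y)\<bar> * indicator (ball 0 1) y) \<partial>lborel)"
  proof (rule nn_integral_mono)
    fix y :: "real^'n"
    show "ennreal \<bar>m y * f (x - h *\<^sub>R y)\<bar> * indicator (cbox (-One) One) y \<le> ennreal C * (ennreal \<bar>f (x - h *\<^sub>R y)\<bar> * indicator (ball 0 1) y)"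
    proof (cases "norm y < 1")
      case True
      then show ?thesis using m(3)[of y] C
        by (auto simp: indicator_def ennreal_mult[symmetric] abs_mult intro!: ennreal_leI mult_right_mono)
    next
      case False
      then show ?thesis using m(2)[of y] by simp
    qed
  qed
  also have "\<dots> = ennreal C * (\<integral>\<^sup>+y. ennreal \<bar>f (x - h *\<^sub>R y)\<bar> * indicator (ball 0 1) y \<partial>lborel)"
    by (rule nn_integral_cmult) simp
  finally show ?thesis .
qed

lemma avg_square_le:
  fixes f :: "real^'n::finite \<Rightarrow> real"
  assumes m: "continuous_on UNIV m" "\<And>y. norm y \<ge> 1 \<Longrightarrow> m y = 0" "\<And>y. \<bar>m y\<bar> \<le> C" and f: "continuous_on UNIV f"
  shows "ennreal ((avg m (\<lambda>y. h *\<^sub>R y) (-One) One f x)\<^sup>2) \<le>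
    ennreal (C\<^sup>2 * unit_vol TYPE('n)) * ball_int (\<lambda>y. (f (x - h *\<^sub>R y))\<^sup>2) 1"
proof -
  have [measurable]: "f \<in> borel_measurable borel" using f by (rule borel_measurable_continuous_onI)
  have C: "C \<ge> 0" using m(3)[of 0] by (meson abs_ge_zero order_trans)
  have "ennreal ((avg m (\<lambda>y. h *\<^sub>R y) (-One) One f x)\<^sup>2) = (ennreal \<bar>avg m (\<lambda>y. h *\<^sub>R y) (-One) One f x\<bar>)\<^sup>2"
    by (simp add: ennreal_power)
  also have "\<dots> \<le> (ennreal C * (\<integral>\<^sup>+y. ennreal \<bar>f (x - h *\<^sub>R y)\<bar> * indicator (ball 0 1) y \<partial>lborel))\<^sup>2"
    by (intro power_mono avg_le_unit_ball assms) auto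
  also have "\<dots> \<le> (ennreal C)\<^sup>2 * (ennreal (unit_vol TYPE('n)) * ball_int (\<lambda>y. (f (x - h *\<^sub>R y))\<^sup>2) 1)"
    unfolding power_mult_distrib by (intro mult_left_mono Cauchy_Schwarz_unit_ball) auto
  finally show ?thesis
    using C unit_vol_pos[where 'n='n] by (simp add: ennreal_power ennreal_mult mult.assoc)
qed

lemma nn_integral_powr_unit:
  assumes "a < 1"
  shows "(\<integral>\<^sup>+t. ennreal (t powr (-a)) * indicator {0<..1} t \<partial>lborel) = ennreal (1 / (1 - a))"
proof -
  have "((\<lambda>t::real. t powr (-a)) has_integral (1 powr (-a + 1) / (-a + 1))) {0..1}"
    using assms by (intro has_integral_powr_from_0) auto
  then have "((\<lambda>t. if t \<in> {0..1} then t powr (-a) else 0) has_integral (1 / (1 - a))) UNIV"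
    unfolding has_integral_restrict_UNIV by simp
  then have "(\<integral>\<^sup>+t. ennreal (if t \<in> {0..1} then t powr (-a) else 0) \<partial>lborel) = ennreal (1 / (1 - a))"
    by (rule nn_integral_has_integral_lborel[rotated 2]) auto
  moreover have "(\<integral>\<^sup>+t. ennreal (t powr (-a)) * indicator {0<..1} t \<partial>lborel) =
     (\<integral>\<^sup>+t. ennreal (if t \<in> {0..1} then t powr (-a) else 0) \<partial>lborel)"
    by (intro nn_integral_cong) (auto simp: indicator_def)
  ultimately show ?thesis by simp
qed

text \<open>The Cauchy-Schwarz inequality in \<open>t\<close>, after inserting \<open>t\<^sup>-\<^sup>a\<^sup>/\<^sup>2 t\<^sup>a\<^sup>/\<^sup>2\<close>. Since \<open>a < 1\<close> the first
  factor is square integrable near \<open>0\<close>; the factor \<open>t\<^sup>a\<close> left on the other side is what compensates, in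
  \<open>morrey_pot\<close>, the growth of the means of the weight over small balls.\<close>

lemma pot_square_le:
  fixes f :: "real^'n::finite \<Rightarrow> real"
  assumes C: "\<And>y::real^'n. \<bar>kern y\<bar> \<le> C" and f: "continuous_on UNIV f" and a: "0 \<le> a" "a < 1"
  shows "ennreal ((pot h k f x)\<^sup>2) \<le> ennreal (C\<^sup>2 * unit_vol TYPE('n) / (1 - a)) *
    (\<integral>\<^sup>+t. ennreal (t powr a) * indicator {0<..1} t *
      (ball_int (\<lambda>y. (f (x - (t * h) *\<^sub>R y))\<^sup>2) 1) \<partial>lborel)"
proof -
  have [measurable]: "f \<in> borel_measurable borel" using f by (rule borel_measurable_continuous_onI)
  have C0: "C \<ge> 0" using C[of 0] by (meson abs_ge_zero order_trans)
  define G where "G = (\<lambda>t. \<integral>\<^sup>+y. ennreal \<bar>f (x - (t * h) *\<^sub>R y)\<bar> * indicator (ball 0 1) y \<partial>lborel)"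
  define Q where "Q = (\<lambda>t. \<integral>\<^sup>+y. ennreal ((f (x - (t * h) *\<^sub>R y))\<^sup>2) * indicator (ball 0 1) y \<partial>lborel)"
  have [measurable]: "G \<in> borel_measurable borel" "Q \<in> borel_measurable borel"
    unfolding G_def Q_def by measurable
  have GQ: "(G t)\<^sup>2 \<le> ennreal (unit_vol TYPE('n)) * Q t" for t
    unfolding G_def Q_def by (rule Cauchy_Schwarz_unit_ball) simp
  have "ennreal \<bar>pot h k f x\<bar> \<le>
      (\<integral>\<^sup>+z. ennreal \<bar>(case z of (t, y) \<Rightarrow> kern y * y $ k) * f (x - (case z of (t, y) \<Rightarrow> (t * h) *\<^sub>R y))\<bar> * indicator (cbox (0, -One) (1, One)) z \<partial>lborel)"
    unfolding pot_def avg_def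
    by (intro integral_cbox_le_nn_integral continuous_on_avg_integrand continuous_on_kern_coordinate continuous_on_dilation f)
  also have "\<dots> \<le> (\<integral>\<^sup>+z. (case z of (t, y) \<Rightarrow> ennreal C * (indicator {0..1} t * (ennreal \<bar>f (x - (t * h) *\<^sub>R y)\<bar> * indicator (ball 0 1) y))) \<partial>lborel)"
  proof (rule nn_integral_mono)
    fix z :: "real \<times> (real^'n)"
    obtain t y where z: "z = (t, y)" by (cases z)
    show "ennreal \<bar>(case z of (t, y) \<Rightarrow> kern y * y $ k) * f (x - (case z of (t, y) \<Rightarrow> (t * h) *\<^sub>R y))\<bar> * indicator (cbox (0, -One) (1, One)) z
       \<le> (case z of (t, y) \<Rightarrow> ennreal C * (indicator {0..1} t * (ennreal \<bar>f (x - (t * h) *\<^sub>R y)\<bar> * indicator (ball 0 1) y)))"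
    proof (cases "norm y < 1 \<and> t \<in> {0..1}")
      case True
      have "\<bar>y $ k\<bar> \<le> 1" using component_le_norm_cart[of y k] True by linarith
      then have "\<bar>kern y * y $ k\<bar> \<le> C"
        using C[of y] mult_mono[of "\<bar>kern y\<bar>" C "\<bar>y $ k\<bar>" 1] C0 by (simp add: abs_mult)
      then have "\<bar>kern y * y $ k * f (x - (t * h) *\<^sub>R y)\<bar> \<le> C * \<bar>f (x - (t * h) *\<^sub>R y)\<bar>"
        unfolding abs_mult[of "_ * _"] by (rule mult_right_mono) simp
      then show ?thesis using True C0
        by (auto simp: z indicator_def ennreal_mult[symmetric] intro!: ennreal_leI)
    next
      case False
      then have "norm y \<ge> 1 \<or> t \<notin> {0..1}" by auto
      then show ?thesis by (auto simp: z kern_outside indicator_def)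
    qed
  qed
  also have "\<dots> = (\<integral>\<^sup>+t. \<integral>\<^sup>+y. ennreal C * (indicator {0..1} t * (ennreal \<bar>f (x - (t * h) *\<^sub>R y)\<bar> * indicator (ball 0 1) y)) \<partial>lborel \<partial>lborel)"
    unfolding lborel_prod[symmetric] by (subst lborel.nn_integral_fst[symmetric]) auto
  also have "\<dots> = ennreal C * (\<integral>\<^sup>+t. indicator {0..1} t * G t \<partial>lborel)"
    by (simp add: nn_integral_cmult G_def)
  also have "(\<integral>\<^sup>+t. indicator {0..1} t * G t \<partial>lborel) =
    (\<integral>\<^sup>+t. (ennreal (t powr (- a / 2)) * indicator {0<..1} t) * (ennreal (t powr (a / 2)) * indicator {0<..1} t * G t) \<partial>lborel)"
  proof (rule nn_integral_cong_AE)
    \<comment> \<open>The factors cancel only for \<open>t > 0\<close>, since \<open>0 powr b = 0\<close>.\<close>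
    show "AE t in lborel. indicator {0..1} t * G t =
      (ennreal (t powr (- a / 2)) * indicator {0<..1} t) * (ennreal (t powr (a / 2)) * indicator {0<..1} t * G t)"
      using AE_lborel_singleton[of "0::real"]
    proof eventually_elim
      case (elim t)
      have "ennreal (t powr (- a / 2)) * ennreal (t powr (a / 2)) = 1" if "t > 0"
        using that by (simp add: ennreal_mult[symmetric] powr_add[symmetric])
      then show ?case using elim by (auto simp: indicator_def mult.assoc[symmetric])
    qed
  qed
  finally have le: "ennreal \<bar>pot h k f x\<bar> \<le> ennreal C *
    (\<integral>\<^sup>+t. (ennreal (t powr (- a / 2)) * indicator {0<..1} t) * (ennreal (t powr (a / 2)) * indicator {0<..1} t * G t) \<partial>lborel)" .
  have "ennreal ((pot h k f x)\<^sup>2) = (ennreal \<bar>pot h k f x\<bar>)\<^sup>2"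
    by (simp add: ennreal_power)
  also have "\<dots> \<le> (ennreal C * 
    (\<integral>\<^sup>+t. (ennreal (t powr (- a / 2)) * indicator {0<..1} t) * (ennreal (t powr (a / 2)) * indicator {0<..1} t * G t) \<partial>lborel))\<^sup>2"
    by (rule power_mono[OF le]) simp
  also have "\<dots> \<le> (ennreal C)\<^sup>2 * ((\<integral>\<^sup>+t. (ennreal (t powr (- a / 2)) * indicator {0<..1} t)\<^sup>2 \<partial>lborel) *
     (\<integral>\<^sup>+t. (ennreal (t powr (a / 2)) * indicator {0<..1} t * G t)\<^sup>2 \<partial>lborel))"
    unfolding power_mult_distrib[of "ennreal C"] by (intro mult_left_mono Cauchy_Schwarz_nn_integral) auto
  also have "(\<integral>\<^sup>+t. (ennreal (t powr (- a / 2)) * indicator {0<..1} t)\<^sup>2 \<partial>lborel) = ennreal (1 / (1 - a))"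
  proof -
    have "(ennreal (t powr (- a / 2)) * indicator {0<..1} t)\<^sup>2 = ennreal (t powr (-a)) * indicator {0<..1} t" for t :: real
      by (auto simp: indicator_def ennreal_power power2_eq_square powr_add[symmetric] ennreal_mult[symmetric])
    then show ?thesis using nn_integral_powr_unit[OF a(2)] by simp
  qed
  also have "(\<integral>\<^sup>+t. (ennreal (t powr (a / 2)) * indicator {0<..1} t * G t)\<^sup>2 \<partial>lborel) \<le>
    (\<integral>\<^sup>+t. ennreal (unit_vol TYPE('n)) * (ennreal (t powr a) * indicator {0<..1} t * Q t) \<partial>lborel)"
  proof (rule nn_integral_mono)
    fix t :: real
    have "(ennreal (t powr (a / 2)) * indicator {0<..1} t * G t)\<^sup>2 = ennreal (t powr a) * indicator {0<..1} t * (G t)\<^sup>2"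
      by (auto simp: indicator_def power_mult_distrib ennreal_power power2_eq_square[of "_ powr _"] powr_add[symmetric] ennreal_mult[symmetric])
    also have "\<dots> \<le> ennreal (t powr a) * indicator {0<..1} t * (ennreal (unit_vol TYPE('n)) * Q t)"
      by (intro mult_left_mono GQ) simp
    finally show "(ennreal (t powr (a / 2)) * indicator {0<..1} t * G t)\<^sup>2 \<le> ennreal (unit_vol TYPE('n)) * (ennreal (t powr a) * indicator {0<..1} t * Q t)"
      by (simp add: ac_simps)
  qed
  also have "\<dots> = ennreal (unit_vol TYPE('n)) * (\<integral>\<^sup>+t. ennreal (t powr a) * indicator {0<..1} t * Q t \<partial>lborel)"
    by (rule nn_integral_cmult) simp
  finally have "ennreal ((pot h k f x)\<^sup>2) \<le> (ennreal C)\<^sup>2 * (ennreal (1 / (1 - a)) *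
      (ennreal (unit_vol TYPE('n)) * (\<integral>\<^sup>+t. ennreal (t powr a) * indicator {0<..1} t * Q t \<partial>lborel)))"
    by (simp add: mult_left_mono)
  also have "\<dots> = ennreal (C\<^sup>2 * (1 / (1 - a)) * unit_vol TYPE('n)) * (\<integral>\<^sup>+t. ennreal (t powr a) * indicator {0<..1} t * Q t \<partial>lborel)"
  proof -
    have "(ennreal C)\<^sup>2 = ennreal (C\<^sup>2)" using C0 by (simp add: ennreal_power)
    moreover have "ennreal (C\<^sup>2 * (1 / (1 - a)) * unit_vol TYPE('n)) =
        ennreal (C\<^sup>2) * ennreal (1 / (1 - a)) * ennreal (unit_vol TYPE('n))"
    proof -
      have "0 \<le> C\<^sup>2" "0 \<le> 1 / (1 - a)" "0 \<le> C\<^sup>2 * (1 / (1 - a))" "0 \<le> unit_vol TYPE('n)"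
        using a unit_vol_pos[where 'n='n] by auto
      then show ?thesis by (simp only: ennreal_mult)
    qed
    ultimately show ?thesis by (simp only: mult.assoc)
  qed
  finally show ?thesis by (simp add: Q_def mult.commute mult.left_commute)
qed

text \<open>Up to the volume of the unit ball, the integral is the mean of \<open>U\<close> over the ball of radius \<open>s\<close> about
  \<open>z\<close>.\<close>

definition morrey :: "(real^'n::finite \<Rightarrow> ennreal) \<Rightarrow> real \<Rightarrow> real \<Rightarrow> bool" where
  "morrey U K l \<longleftrightarrow> U \<in> borel_measurable borel \<and>
    (\<forall>z s. 0 < s \<and> s \<le> 1 \<longrightarrow> (\<integral>\<^sup>+y. U (z + s *\<^sub>R y) * indicator (ball 0 1) y \<partial>lborel) \<le> ennreal (K * s powr (-l)))"

text \<open>Tonelli's theorem and translation invariance move the average from \<open>G\<close> to the weight.\<close>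

lemma nn_integral_weight_average:
  fixes U G :: "real^'n::finite \<Rightarrow> ennreal"
  assumes [measurable]: "U \<in> borel_measurable borel" "G \<in> borel_measurable borel"
    and K: "\<And>z. (\<integral>\<^sup>+y. U (z + s *\<^sub>R y) * indicator (ball 0 1) y \<partial>lborel) \<le> K"
  shows "(\<integral>\<^sup>+x. U x * (\<integral>\<^sup>+y. G (x - s *\<^sub>R y) * indicator (ball 0 1) y \<partial>lborel) \<partial>lborel) \<le> K * (\<integral>\<^sup>+x. G x \<partial>lborel)"
proof -
  have "(\<integral>\<^sup>+x. U x * (\<integral>\<^sup>+y. G (x - s *\<^sub>R y) * indicator (ball 0 1) y \<partial>lborel) \<partial>lborel) =
      (\<integral>\<^sup>+x. (\<integral>\<^sup>+y. U x * (G (x - s *\<^sub>R y) * indicator (ball 0 1) y) \<partial>lborel) \<partial>lborel)"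
    by (intro nn_integral_cong nn_integral_cmult[symmetric]) simp
  also have "\<dots> = (\<integral>\<^sup>+y. (\<integral>\<^sup>+x. U x * (G (x - s *\<^sub>R y) * indicator (ball 0 1) y) \<partial>lborel) \<partial>lborel)"
    by (rule lborel_pair.Fubini') simp
  also have "\<dots> = (\<integral>\<^sup>+y. (\<integral>\<^sup>+z. U (z + s *\<^sub>R y) * (G z * indicator (ball 0 1) y) \<partial>lborel) \<partial>lborel)"
  proof (rule nn_integral_cong)
    fix y :: "real^'n"
    show "(\<integral>\<^sup>+x. U x * (G (x - s *\<^sub>R y) * indicator (ball 0 1) y) \<partial>lborel) = (\<integral>\<^sup>+z. U (z + s *\<^sub>R y) * (G z * indicator (ball 0 1) y) \<partial>lborel)"
      using nn_integral_lborel_shift[of "\<lambda>x. U x * (G (x - s *\<^sub>R y) * indicator (ball 0 1) y)" "s *\<^sub>R y"]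
      by (simp add: add.commute)
  qed
  also have "\<dots> = (\<integral>\<^sup>+z. (\<integral>\<^sup>+y. U (z + s *\<^sub>R y) * (G z * indicator (ball 0 1) y) \<partial>lborel) \<partial>lborel)"
    by (rule lborel_pair.Fubini') simp
  also have "\<dots> = (\<integral>\<^sup>+z. G z * (\<integral>\<^sup>+y. U (z + s *\<^sub>R y) * indicator (ball 0 1) y \<partial>lborel) \<partial>lborel)"
    by (intro nn_integral_cong) (simp add: nn_integral_cmult[symmetric] ac_simps)
  also have "\<dots> \<le> (\<integral>\<^sup>+z. G z * K \<partial>lborel)"
    by (intro nn_integral_mono mult_left_mono K) simp
  also have "\<dots> = K * (\<integral>\<^sup>+x. G x \<partial>lborel)"
    by (subst nn_integral_multc) (auto simp: mult.commute)
  finally show ?thesis .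
qed

text \<open>For a weight living in a ball only the values of \<open>f\<close> in a slightly larger ball matter.\<close>

lemma morrey_average:
  fixes f :: "real^'n::finite \<Rightarrow> real"
  assumes U: "morrey U K l" "\<And>x. norm x \<ge> r \<Longrightarrow> U x = 0" and f: "continuous_on UNIV f"
    and s: "0 < s" "s \<le> 1" "s \<le> h"
  shows "(\<integral>\<^sup>+x. U x * ball_int (\<lambda>y. (f (x - s *\<^sub>R y))\<^sup>2) 1 \<partial>lborel) \<le>
     ennreal (K * s powr (-l)) * ball_int (\<lambda>x. (f x)\<^sup>2) ((r + h))"
proof -
  have [measurable]: "f \<in> borel_measurable borel" using f by (rule borel_measurable_continuous_onI)
  have [measurable]: "U \<in> borel_measurable borel" using U(1) by (simp add: morrey_def)
  let ?G = "\<lambda>x. ennreal ((f x)\<^sup>2) * indicator (ball 0 (r + h)) x"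
  have "(\<integral>\<^sup>+x. U x * ball_int (\<lambda>y. (f (x - s *\<^sub>R y))\<^sup>2) 1 \<partial>lborel) \<le>
        (\<integral>\<^sup>+x. U x * (\<integral>\<^sup>+y. ?G (x - s *\<^sub>R y) * indicator (ball 0 1) y \<partial>lborel) \<partial>lborel)"
  proof (rule nn_integral_mono)
    fix x
    show "U x * ball_int (\<lambda>y. (f (x - s *\<^sub>R y))\<^sup>2) 1 \<le>
        U x * (\<integral>\<^sup>+y. ?G (x - s *\<^sub>R y) * indicator (ball 0 1) y \<partial>lborel)"
    proof (cases "norm x < r")
      case True
      show ?thesis
      proof (intro mult_left_mono nn_integral_mono)
        fix y :: "real^'n"
        have "norm (x - s *\<^sub>R y) < r + h" if "norm y < 1"
        proof -
          have "norm (x - s *\<^sub>R y) \<le> norm x + s * norm y"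
            using norm_triangle_ineq4[of x "s *\<^sub>R y"] s by simp
          also have "s * norm y \<le> s" using that s by (intro mult_left_le) auto
          finally show ?thesis using True s by linarith
        qed
        then show "ennreal ((f (x - s *\<^sub>R y))\<^sup>2) * indicator (ball 0 1) y \<le> ?G (x - s *\<^sub>R y) * indicator (ball 0 1) y"
          by (auto simp: indicator_def)
      qed simp
    qed (use U(2) in auto)
  qed
  also have "\<dots> \<le> ennreal (K * s powr (-l)) * (\<integral>\<^sup>+x. ?G x \<partial>lborel)"
    using U(1) s by (intro nn_integral_weight_average) (auto simp: morrey_def)
  finally show ?thesis .
qed

lemma morrey_avg:
  fixes f :: "real^'n::finite \<Rightarrow> real"
  assumes U: "morrey U K l" "\<And>x. norm x \<ge> r \<Longrightarrow> U x = 0" and f: "continuous_on UNIV f"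
    and h: "0 < h" "h \<le> 1" and K: "K \<ge> 0"
    and m: "continuous_on UNIV m" "\<And>y. norm y \<ge> 1 \<Longrightarrow> m y = 0" "\<And>y. \<bar>m y\<bar> \<le> C"
  shows "weighted_int U (\<lambda>x. (avg m (\<lambda>y. h *\<^sub>R y) (-One) One f x)\<^sup>2) \<le>
     ennreal (C\<^sup>2 * unit_vol TYPE('n) * K * h powr (-l)) * ball_int (\<lambda>x. (f x)\<^sup>2) ((r + h))"
proof -
  have [measurable]: "f \<in> borel_measurable borel" using f by (rule borel_measurable_continuous_onI)
  have [measurable]: "U \<in> borel_measurable borel" using U(1) by (simp add: morrey_def)
  let ?Q = "\<lambda>x. \<integral>\<^sup>+y. ennreal ((f (x - h *\<^sub>R y))\<^sup>2) * indicator (ball 0 1) y \<partial>lborel"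
  have "weighted_int U (\<lambda>x. (avg m (\<lambda>y. h *\<^sub>R y) (-One) One f x)\<^sup>2) \<le>
     (\<integral>\<^sup>+x. U x * (ennreal (C\<^sup>2 * unit_vol TYPE('n)) * ?Q x) \<partial>lborel)"
    by (intro nn_integral_mono mult_left_mono avg_square_le m f) auto
  also have "\<dots> = ennreal (C\<^sup>2 * unit_vol TYPE('n)) * (\<integral>\<^sup>+x. U x * ?Q x \<partial>lborel)"
    by (subst nn_integral_cmult[symmetric]) (simp_all add: ac_simps)
  also have "\<dots> \<le> ennreal (C\<^sup>2 * unit_vol TYPE('n)) * (ennreal (K * h powr (-l)) * ball_int (\<lambda>x. (f x)\<^sup>2) ((r + h)))"
    using h by (intro mult_left_mono morrey_average[OF U f]) auto
  finally show ?thesis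
    using K unit_vol_pos[where 'n='n] by (simp add: ennreal_mult mult.assoc)
qed

text \<open>The factor \<open>t\<^sup>a\<close> from \<open>pot_square_le\<close> and the Morrey growth \<open>t\<^sup>-\<^sup>2\<^sup>a\<close> combine to \<open>t\<^sup>-\<^sup>a\<close>, which is
  integrable on the unit interval. This takes the place of a Sobolev inequality with weight \<open>U\<close>.\<close>

lemma morrey_pot:
  fixes f :: "real^'n::finite \<Rightarrow> real"
  assumes U: "morrey U K (2 * a)" "\<And>x. norm x \<ge> r \<Longrightarrow> U x = 0" and f: "continuous_on UNIV f"
    and h: "0 < h" "h \<le> 1" and K: "K \<ge> 0" and a: "0 \<le> a" "a < 1"
    and C: "\<And>y::real^'n. \<bar>kern y\<bar> \<le> C"
  shows "weighted_int U (\<lambda>x. (pot h k f x)\<^sup>2) \<le>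
     ennreal (C\<^sup>2 * unit_vol TYPE('n) / (1 - a)\<^sup>2 * K * h powr (- (2 * a))) *
       (ball_int (\<lambda>x. (f x)\<^sup>2) ((r + h)))"
proof -
  have [measurable]: "f \<in> borel_measurable borel" using f by (rule borel_measurable_continuous_onI)
  have [measurable]: "U \<in> borel_measurable borel" using U(1) by (simp add: morrey_def)
  let ?I = "\<integral>\<^sup>+x. ennreal ((f x)\<^sup>2) * indicator (ball 0 (r + h)) x \<partial>lborel"
  let ?c = "C\<^sup>2 * unit_vol TYPE('n) / (1 - a)"
  define Q where "Q = (\<lambda>x t. \<integral>\<^sup>+y. ennreal ((f (x - (t * h) *\<^sub>R y))\<^sup>2) * indicator (ball 0 1) y \<partial>lborel)"
  have [measurable]: "(\<lambda>(x, t). Q x t) \<in> borel_measurable (borel \<Otimes>\<^sub>M borel)"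
    unfolding Q_def by measurable
  have "weighted_int U (\<lambda>x. (pot h k f x)\<^sup>2) \<le>
     (\<integral>\<^sup>+x. U x * (ennreal ?c * (\<integral>\<^sup>+t. ennreal (t powr a) * indicator {0<..1} t * Q x t \<partial>lborel)) \<partial>lborel)"
    unfolding Q_def by (intro nn_integral_mono mult_left_mono pot_square_le f a C) auto
  also have "\<dots> = ennreal ?c * (\<integral>\<^sup>+x. U x * (\<integral>\<^sup>+t. ennreal (t powr a) * indicator {0<..1} t * Q x t \<partial>lborel) \<partial>lborel)"
    by (subst nn_integral_cmult[symmetric]) (auto simp: ac_simps)
  also have "(\<integral>\<^sup>+x. U x * (\<integral>\<^sup>+t. ennreal (t powr a) * indicator {0<..1} t * Q x t \<partial>lborel) \<partial>lborel)
     = (\<integral>\<^sup>+x. (\<integral>\<^sup>+t. U x * (ennreal (t powr a) * indicator {0<..1} t * Q x t) \<partial>lborel) \<partial>lborel)"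
    by (intro nn_integral_cong nn_integral_cmult[symmetric]) auto
  also have "(\<integral>\<^sup>+x. (\<integral>\<^sup>+t. U x * (ennreal (t powr a) * indicator {0<..1} t * Q x t) \<partial>lborel) \<partial>lborel) =
     (\<integral>\<^sup>+t. (\<integral>\<^sup>+x. U x * (ennreal (t powr a) * indicator {0<..1} t * Q x t) \<partial>lborel) \<partial>lborel)"
    by (rule lborel_pair.Fubini') simp
  also have "\<dots> = (\<integral>\<^sup>+t. ennreal (t powr a) * indicator {0<..1} t * (\<integral>\<^sup>+x. U x * Q x t \<partial>lborel) \<partial>lborel)"
    by (intro nn_integral_cong, subst nn_integral_cmult[symmetric]) (auto simp: ac_simps)
  also have "\<dots> \<le> (\<integral>\<^sup>+t. ennreal (t powr (-a)) * indicator {0<..1} t * (ennreal (K * h powr (- (2 * a))) * ?I) \<partial>lborel)"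
  proof (rule nn_integral_mono)
    fix t :: real
    show "ennreal (t powr a) * indicator {0<..1} t * (\<integral>\<^sup>+x. U x * Q x t \<partial>lborel) \<le>
       ennreal (t powr (-a)) * indicator {0<..1} t * (ennreal (K * h powr (- (2 * a))) * ?I)"
    proof (cases "t \<in> {0<..1}")
      case True
      then have t: "0 < t" "t \<le> 1" by auto
      have "(\<integral>\<^sup>+x. U x * Q x t \<partial>lborel) \<le> ennreal (K * (t * h) powr (- (2 * a))) * ?I"
        unfolding Q_def using t h mult_le_one[of t h]
        by (intro morrey_average[OF U f]) (auto intro: mult_left_le_one_le)
      then have "ennreal (t powr a) * (\<integral>\<^sup>+x. U x * Q x t \<partial>lborel) \<le> ennreal (t powr a) * (ennreal (K * (t * h) powr (- (2 * a))) * ?I)"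
        by (rule mult_left_mono) simp
      also have "\<dots> = ennreal (t powr a * (K * (t * h) powr (- (2 * a)))) * ?I"
        using K by (simp add: ennreal_mult mult.assoc)
      also have "t powr a * (K * (t * h) powr (- (2 * a))) = t powr (-a) * (K * h powr (- (2 * a)))"
      proof -
        have "(t * h) powr (- (2 * a)) = t powr (-(2 * a)) * h powr (- (2 * a))"
          by (rule powr_mult)
        moreover have "t powr a * t powr (-(2 * a)) = t powr (-a)" by (simp add: powr_add[symmetric])
        ultimately show ?thesis by (metis mult.assoc mult.left_commute)
      qed
      also have "ennreal \<dots> * ?I = ennreal (t powr (-a)) * (ennreal (K * h powr (- (2 * a))) * ?I)"
        using K by (simp add: ennreal_mult mult.assoc)
      finally show ?thesis using True by simp
    qed simp
  qed
  also have "\<dots> = ennreal (1 / (1 - a)) * (ennreal (K * h powr (- (2 * a))) * ?I)"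
    by (subst nn_integral_multc) (simp_all add: nn_integral_powr_unit[OF a(2)])
  finally have "weighted_int U (\<lambda>x. (pot h k f x)\<^sup>2) \<le>
      ennreal ?c * (ennreal (1 / (1 - a)) * (ennreal (K * h powr (- (2 * a))) * ?I))"
    by (simp add: mult_left_mono)
  also have "\<dots> = ennreal (?c * (1 / (1 - a)) * (K * h powr (- (2 * a)))) * ?I"
  proof -
    have "0 \<le> ?c" "0 \<le> 1 / (1 - a)" "0 \<le> ?c * (1 / (1 - a))" "0 \<le> K * h powr (- (2 * a))"
      using a K unit_vol_pos[where 'n='n] by auto
    then have "ennreal (?c * (1 / (1 - a)) * (K * h powr (- (2 * a)))) =
        ennreal ?c * ennreal (1 / (1 - a)) * ennreal (K * h powr (- (2 * a)))"
      by (simp only: ennreal_mult)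
    then show ?thesis by (simp only: mult.assoc)
  qed
  also have "?c * (1 / (1 - a)) * (K * h powr (- (2 * a))) = C\<^sup>2 * unit_vol TYPE('n) / (1 - a)\<^sup>2 * K * h powr (- (2 * a))"
    by (simp add: power2_eq_square)
  finally show ?thesis .
qed

lemma kern_bounds:
  "\<exists>C>0. \<forall>y::real^'n::finite. \<bar>kern y\<bar> \<le> C \<and> (\<forall>j. \<bar>D j kern y\<bar> \<le> C)"
proof -
  have k1: "C_k (Suc 0) (kern :: real^'n \<Rightarrow> real)" using C_k_kern by simp
  have o: "D j kern y = 0" if "norm y > 1" for j and y :: "real^'n"
    using _ that by (rule partial_deriv_zero_outside) (simp add: kern_outside)
  have "\<exists>B>0. \<forall>y::real^'n. \<bar>kern y\<bar> \<le> B"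
    by (rule bounded_continuous_cball[where r=1]) (auto intro: continuous_on_kern simp: kern_outside)
  then obtain B where B: "B > 0" "\<And>y::real^'n. \<bar>kern y\<bar> \<le> B" by auto
  have "\<exists>B>0. \<forall>y::real^'n. \<bar>D j kern y\<bar> \<le> B" for j
    by (rule bounded_continuous_cball[where r=1]) (use o C_k_continuous[OF C_k_SucD[OF k1]] in auto)
  then obtain B' where B': "\<And>j. B' j > 0" "\<And>j y::real^'n. \<bar>D j kern y\<bar> \<le> B' j" by metis
  have "B' j \<le> B + (\<Sum>j\<in>UNIV. B' j)" for j
    using member_le_sum[of j UNIV B'] B' B(1) by (simp add: less_imp_le add_increasing)
  moreover have "B \<le> B + (\<Sum>j\<in>UNIV. B' j)"
    using B'(1) by (simp add: sum_nonneg less_imp_le)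
  ultimately show ?thesis
    using B B'(2) by (intro exI[of _ "B + (\<Sum>j\<in>UNIV. B' j)"]) (meson order_trans less_le_trans)
qed

section \<open>The local energy inequality\<close>

text \<open>Differentiability and the value of the derivative in one statement, so that the derivative of a long
  expression can be computed by introduction rules.\<close>

definition has_partial :: "(real^'n::finite \<Rightarrow> real) \<Rightarrow> 'n \<Rightarrow> real \<Rightarrow> real^'n \<Rightarrow> bool" where
  "has_partial f j d x \<longleftrightarrow> f differentiable (at x) \<and> D j f x = d"

lemma has_partial_add: "has_partial f j a x \<Longrightarrow> has_partial g j b x \<Longrightarrow> has_partial (\<lambda>x. f x + g x) j (a + b) x"
  by (auto simp: has_partial_def partial_deriv_add)

lemma has_partial_diff: "has_partial f j a x \<Longrightarrow> has_partial g j b x \<Longrightarrow> has_partial (\<lambda>x. f x - g x) j (a - b) x"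
  by (auto simp: has_partial_def partial_deriv_diff)

lemma has_partial_mult: "has_partial f j a x \<Longrightarrow> has_partial g j b x \<Longrightarrow> has_partial (\<lambda>x. f x * g x) j (a * g x + f x * b) x"
  by (auto simp: has_partial_def partial_deriv_mult)

lemma has_partial_cmult: "has_partial f j a x \<Longrightarrow> has_partial (\<lambda>x. c * f x) j (c * a) x"
  by (auto simp: has_partial_def partial_deriv_cmult)

lemma has_partial_sum: "finite I \<Longrightarrow> (\<And>i. i \<in> I \<Longrightarrow> has_partial (f i) j (a i) x) \<Longrightarrow> has_partial (\<lambda>x. \<Sum>i\<in>I. f i x) j (\<Sum>i\<in>I. a i) x"
  by (auto simp: has_partial_def partial_deriv_sum)

lemma has_partial_C_k: "C_k (Suc k) f \<Longrightarrow> has_partial f j (D j f x) x"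
  by (simp only: has_partial_def C_k_Suc_differentiable)

lemma has_partialD: "has_partial f j d x \<Longrightarrow> D j f x = d"
  by (simp add: has_partial_def)

text \<open>The pointwise algebra behind the energy identity; \<open>dv j i\<close>, \<open>ddv j i\<close>, \<open>dw j i\<close> stand for the derivatives
  \<open>\<partial>\<^sub>j v\<^sub>i\<close>, \<open>\<partial>\<^sub>j\<^sup>2 v\<^sub>i\<close>, \<open>\<partial>\<^sub>j w\<^sub>i\<close>, and so on. The pressure disappears because the symmetric array
  \<open>dF\<close> is contracted with the antisymmetric \<open>A\<close>.\<close>

lemma energy_algebra:
  fixes v w du u \<psi>' F :: "'n::finite \<Rightarrow> real" and dv ddv dw E A dF :: "'n \<Rightarrow> 'n \<Rightarrow> real"
    and dA :: "'n \<Rightarrow> 'n \<Rightarrow> real" and \<psi> :: real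
  assumes du: "(\<Sum>j\<in>UNIV. du j) = 0"
    and F: "\<And>i. F i = (\<Sum>j\<in>UNIV. u j * dv j i) - (\<Sum>j\<in>UNIV. ddv j i)"
    and curl: "\<And>i j. dF j i = dF i j" and anti: "\<And>i j. A i j = - A j i"
    and w: "\<And>i. w i = (\<Sum>j\<in>UNIV. \<psi>' j * A i j + \<psi> * dA j i)"
    and E: "\<And>i j. dw j i = E i j - \<psi> * dv j i"
  shows "(\<Sum>j\<in>UNIV. (\<Sum>i\<in>UNIV. (ddv j i * w i + dv j i * dw j i) - ((du j * v i + u j * dv j i) * w i + u j * v i * dw j i))
     + (\<Sum>i\<in>UNIV. dF j i * (\<psi> * A i j) + F i * (\<psi>' j * A i j + \<psi> * dA j i))
     - 1 / 2 * ((du j * \<psi> + u j * \<psi>' j) * (\<Sum>i\<in>UNIV. v i * v i) + u j * \<psi> * (\<Sum>i\<in>UNIV. dv j i * v i + v i * dv j i)))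
   = (\<Sum>i\<in>UNIV. \<Sum>j\<in>UNIV. (dv j i - u j * v i) * E i j) - \<psi> * (\<Sum>i\<in>UNIV. \<Sum>j\<in>UNIV. dv j i * dv j i)
      - 1 / 2 * (\<Sum>j\<in>UNIV. u j * \<psi>' j) * (\<Sum>i\<in>UNIV. v i * v i)"
proof -
  have 1: "(\<Sum>j\<in>UNIV. \<Sum>i\<in>UNIV. ddv j i * w i) - (\<Sum>j\<in>UNIV. \<Sum>i\<in>UNIV. u j * dv j i * w i) = - (\<Sum>i\<in>UNIV. F i * w i)"
  proof -
    have "(\<Sum>j\<in>UNIV. \<Sum>i\<in>UNIV. ddv j i * w i) = (\<Sum>i\<in>UNIV. (\<Sum>j\<in>UNIV. ddv j i) * w i)"
      by (subst sum.swap) (simp add: sum_distrib_right)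
    moreover have "(\<Sum>j\<in>UNIV. \<Sum>i\<in>UNIV. u j * dv j i * w i) = (\<Sum>i\<in>UNIV. (\<Sum>j\<in>UNIV. u j * dv j i) * w i)"
      by (subst sum.swap) (simp add: sum_distrib_right)
    ultimately show ?thesis by (simp add: F left_diff_distrib sum_subtractf)
  qed
  have 2: "(\<Sum>j\<in>UNIV. \<Sum>i\<in>UNIV. du j * v i * w i) = 0"
  proof -
    have "(\<Sum>j\<in>UNIV. \<Sum>i\<in>UNIV. du j * v i * w i) = (\<Sum>j\<in>UNIV. du j) * (\<Sum>i\<in>UNIV. v i * w i)"
      by (simp add: sum_product mult.assoc)
    then show ?thesis by (simp add: du)
  qed
  have 3: "(\<Sum>j\<in>UNIV. \<Sum>i\<in>UNIV. dF j i * (\<psi> * A i j)) = 0"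
  proof -
    have "(\<Sum>j\<in>UNIV. \<Sum>i\<in>UNIV. dF j i * (\<psi> * A i j)) = (\<Sum>i\<in>UNIV. \<Sum>j\<in>UNIV. dF j i * (\<psi> * A i j))"
      by (rule sum.swap)
    also have "\<dots> = (\<Sum>i\<in>UNIV. \<Sum>j\<in>UNIV. - (dF i j * (\<psi> * A j i)))"
      by (intro sum.cong refl) (metis anti curl mult_minus_right)
    also have "\<dots> = - (\<Sum>j\<in>UNIV. \<Sum>i\<in>UNIV. dF j i * (\<psi> * A i j))"
      by (simp add: sum_negf)
    finally show ?thesis by simp
  qed
  have 4: "(\<Sum>j\<in>UNIV. \<Sum>i\<in>UNIV. F i * (\<psi>' j * A i j + \<psi> * dA j i)) = (\<Sum>i\<in>UNIV. F i * w i)"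
    by (subst sum.swap) (simp add: w sum_distrib_left)
  have 5: "(\<Sum>j\<in>UNIV. (du j * \<psi> + u j * \<psi>' j) * (\<Sum>i\<in>UNIV. v i * v i)) = (\<Sum>j\<in>UNIV. u j * \<psi>' j) * (\<Sum>i\<in>UNIV. v i * v i)"
  proof -
    have "(\<Sum>j\<in>UNIV. (du j * \<psi> + u j * \<psi>' j) * (\<Sum>i\<in>UNIV. v i * v i)) = ((\<Sum>j\<in>UNIV. du j) * \<psi> + (\<Sum>j\<in>UNIV. u j * \<psi>' j)) * (\<Sum>i\<in>UNIV. v i * v i)"
      by (simp only: sum_distrib_right[symmetric] sum.distrib)
    then show ?thesis by (simp add: du)
  qed
  have 6: "(\<Sum>j\<in>UNIV. u j * \<psi> * (\<Sum>i\<in>UNIV. dv j i * v i + v i * dv j i)) = 2 * (\<Sum>j\<in>UNIV. \<Sum>i\<in>UNIV. \<psi> * (u j * v i * dv j i))"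
    by (simp add: sum_distrib_left algebra_simps)
  have 7: "(\<Sum>j\<in>UNIV. \<Sum>i\<in>UNIV. dv j i * dw j i - u j * v i * dw j i) =
     (\<Sum>j\<in>UNIV. \<Sum>i\<in>UNIV. (dv j i - u j * v i) * E i j) - (\<Sum>j\<in>UNIV. \<Sum>i\<in>UNIV. \<psi> * (dv j i * dv j i)) + (\<Sum>j\<in>UNIV. \<Sum>i\<in>UNIV. \<psi> * (u j * v i * dv j i))"
    by (simp add: E sum.distrib[symmetric] sum_subtractf[symmetric] algebra_simps)
  have "(\<Sum>j\<in>UNIV. (\<Sum>i\<in>UNIV. (ddv j i * w i + dv j i * dw j i) - ((du j * v i + u j * dv j i) * w i + u j * v i * dw j i))
     + (\<Sum>i\<in>UNIV. dF j i * (\<psi> * A i j) + F i * (\<psi>' j * A i j + \<psi> * dA j i))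
     - 1 / 2 * ((du j * \<psi> + u j * \<psi>' j) * (\<Sum>i\<in>UNIV. v i * v i) + u j * \<psi> * (\<Sum>i\<in>UNIV. dv j i * v i + v i * dv j i)))
    = ((\<Sum>j\<in>UNIV. \<Sum>i\<in>UNIV. ddv j i * w i) - (\<Sum>j\<in>UNIV. \<Sum>i\<in>UNIV. u j * dv j i * w i))
     - (\<Sum>j\<in>UNIV. \<Sum>i\<in>UNIV. du j * v i * w i) + (\<Sum>j\<in>UNIV. \<Sum>i\<in>UNIV. dv j i * dw j i - u j * v i * dw j i)
     + (\<Sum>j\<in>UNIV. \<Sum>i\<in>UNIV. dF j i * (\<psi> * A i j)) + (\<Sum>j\<in>UNIV. \<Sum>i\<in>UNIV. F i * (\<psi>' j * A i j + \<psi> * dA j i))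
     - 1 / 2 * ((\<Sum>j\<in>UNIV. (du j * \<psi> + u j * \<psi>' j) * (\<Sum>i\<in>UNIV. v i * v i)) + (\<Sum>j\<in>UNIV. u j * \<psi> * (\<Sum>i\<in>UNIV. dv j i * v i + v i * dv j i)))"
    by (simp only: sum.distrib sum_subtractf distrib_right sum_distrib_left[symmetric])
  also have "\<dots> = (\<Sum>j\<in>UNIV. \<Sum>i\<in>UNIV. (dv j i - u j * v i) * E i j) - (\<Sum>j\<in>UNIV. \<Sum>i\<in>UNIV. \<psi> * (dv j i * dv j i))
      - 1 / 2 * ((\<Sum>j\<in>UNIV. u j * \<psi>' j) * (\<Sum>i\<in>UNIV. v i * v i))"
    unfolding 1 2 3 4 5 6 7 by (simp add: add_divide_distrib)
  also have "(\<Sum>j\<in>UNIV. \<Sum>i\<in>UNIV. (dv j i - u j * v i) * E i j) = (\<Sum>i\<in>UNIV. \<Sum>j\<in>UNIV. (dv j i - u j * v i) * E i j)"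
    by (rule sum.swap)
  also have "(\<Sum>j\<in>UNIV. \<Sum>i\<in>UNIV. \<psi> * (dv j i * dv j i)) = \<psi> * (\<Sum>i\<in>UNIV. \<Sum>j\<in>UNIV. dv j i * dv j i)"
    by (subst sum.swap) (simp add: sum_distrib_left)
  finally show ?thesis by simp
qed

text \<open>The constant is \<open>8 \<cdot> (1 + 6)\<close>, from differentiating the fourth and then the third power.\<close>

lemma partial_deriv_bump4_bounds:
  fixes x :: "real^'n::finite"
  assumes r: "r \<ge> 1"
  shows "\<bar>D j (bump 4 r) x\<bar> \<le> 56"
    "\<bar>D k (D j (bump 4 r)) x\<bar> \<le> 56"
    "norm x \<ge> r \<Longrightarrow> D j (bump 4 r) x = 0"
    "norm x \<ge> r \<Longrightarrow> D k (D j (bump 4 r)) x = 0"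
proof -
  have D1: "D j (bump 4 r) = (\<lambda>x. (- (8 / r\<^sup>2)) * (x $ j * bump 3 r x))" for j :: 'n
    using partial_deriv_bump[of 3 j r] by simp
  have "C_k 1 (bump 3 r :: real^'n \<Rightarrow> real)" by (rule C_k_bump) simp
  then have b3: "C_k (Suc 0) (bump 3 r :: real^'n \<Rightarrow> real)" by simp
  have D3: "D k (bump 3 r) x = (- (6 / r\<^sup>2)) * (x $ k * bump 2 r x)" for k :: 'n
    using partial_deriv_bump[of 2 k r] by simp
  have "has_partial (\<lambda>x::real^'n. x $ j) k (if j = k then 1 else 0) x"
    by (simp add: has_partial_def differentiable_coordinate partial_deriv_coordinate)
  then have "has_partial (\<lambda>x. (- (8 / r\<^sup>2)) * (x $ j * bump 3 r x)) k ((- (8 / r\<^sup>2)) * ((if j = k then 1 else 0) * bump 3 r x + x $ j * D k (bump 3 r) x)) x"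
    by (intro has_partial_cmult has_partial_mult has_partial_C_k[OF b3])
  then have D2: "D k (D j (bump 4 r)) x =
      (- (8 / r\<^sup>2)) * ((if j = k then 1 else 0) * bump 3 r x + x $ j * ((- (6 / r\<^sup>2)) * (x $ k * bump 2 r x)))"
    unfolding D1 D3[symmetric] by (rule has_partialD)
  show z1: "D j (bump 4 r) x = 0" if "norm x \<ge> r"
    using that r by (simp add: D1 bump_outside)
  show z2: "D k (D j (bump 4 r)) x = 0" if "norm x \<ge> r"
    using that r by (simp add: D2 bump_outside)
  have in1: "\<bar>D j (bump 4 r) x\<bar> \<le> 56" and in2: "\<bar>D k (D j (bump 4 r)) x\<bar> \<le> 56" if "norm x < r"
  proof -
    have xj: "\<bar>x $ j\<bar> \<le> r" "\<bar>x $ k\<bar> \<le> r"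
      using component_le_norm_cart[of x j] component_le_norm_cart[of x k] that by auto
    have b: "\<bar>bump n r x\<bar> \<le> 1" "0 \<le> \<bar>bump n r x\<bar>" for n using bump_nonneg[of n r x] bump_le_1[of n r x] by auto
    have r2: "r \<le> r\<^sup>2" "1 \<le> r\<^sup>2" using r by (auto simp: power2_eq_square intro: mult_left_mono[of 1 r r, simplified] order_trans[OF r])
    have "\<bar>x $ j * bump 3 r x\<bar> \<le> r * 1" unfolding abs_mult using xj b by (intro mult_mono) auto
    then have "\<bar>D j (bump 4 r) x\<bar> \<le> (8 / r\<^sup>2) * r"
      unfolding D1 abs_mult using r by (intro mult_mono) auto
    also have "\<dots> \<le> 8" using r r2 by (simp add: divide_simps)
    finally show "\<bar>D j (bump 4 r) x\<bar> \<le> 56" by simp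
    have "\<bar>x $ k * bump 2 r x\<bar> \<le> r * 1" unfolding abs_mult using xj b by (intro mult_mono) auto
    then have "\<bar>(- (6 / r\<^sup>2)) * (x $ k * bump 2 r x)\<bar> \<le> (6 / r\<^sup>2) * r"
      unfolding abs_mult using r by (intro mult_mono) auto
    then have "\<bar>x $ j * ((- (6 / r\<^sup>2)) * (x $ k * bump 2 r x))\<bar> \<le> r * ((6 / r\<^sup>2) * r)"
      unfolding abs_mult[of "x $ j"] using xj r by (intro mult_mono) auto
    also have "r * ((6 / r\<^sup>2) * r) = 6" using r by (simp add: power2_eq_square)
    finally have t: "\<bar>x $ j * ((- (6 / r\<^sup>2)) * (x $ k * bump 2 r x))\<bar> \<le> 6" .
    have "\<bar>(if j = k then 1 else 0) * bump 3 r x\<bar> \<le> 1" using b[of 3] by auto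
    with t have "\<bar>(if j = k then 1 else 0) * bump 3 r x + x $ j * ((- (6 / r\<^sup>2)) * (x $ k * bump 2 r x))\<bar> \<le> 7"
      by linarith
    then have "\<bar>D k (D j (bump 4 r)) x\<bar> \<le> (8 / r\<^sup>2) * 7"
      unfolding D2 abs_mult[of "- (8 / r\<^sup>2)"] using r by (intro mult_mono) auto
    also have "\<dots> \<le> 56" using r r2 by (simp add: divide_simps)
    finally show "\<bar>D k (D j (bump 4 r)) x\<bar> \<le> 56" .
  qed
  show "\<bar>D j (bump 4 r) x\<bar> \<le> 56" using in1 z1 by (cases "norm x < r") auto
  show "\<bar>D k (D j (bump 4 r)) x\<bar> \<le> 56" using in2 z2 by (cases "norm x < r") auto
qed

definition vsq :: "('n::finite \<Rightarrow> real^'n \<Rightarrow> real) \<Rightarrow> real^'n \<Rightarrow> real" where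
  "vsq v x = (\<Sum>i\<in>UNIV. (v i x)\<^sup>2)"

definition gradsq :: "('n::finite \<Rightarrow> real^'n \<Rightarrow> real) \<Rightarrow> real^'n \<Rightarrow> real" where
  "gradsq v x = (\<Sum>i\<in>UNIV. \<Sum>j\<in>UNIV. (D j (v i) x)\<^sup>2)"

text \<open>Constants of the energy inequality: \<open>err_const\<close> bounds the error term by the square root of the sum of squares
  \<open>errsq\<close>, and \<open>energy_const\<close> collects the resulting quadratic terms.\<close>

definition err_const :: "'n::finite itself \<Rightarrow> real" where "err_const _ = 56 * (2 + 2 * real CARD('n))"

definition energy_const :: "'n::finite itself \<Rightarrow> real" where
  "energy_const _ = (real CARD('n))\<^sup>2 * ((err_const TYPE('n))\<^sup>2 + 2 * err_const TYPE('n) + 112)"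

text \<open>The pressure enters only through the fact that the force \<open>u \<cdot> \<nabla>v - \<Delta>v\<close> is curl free.\<close>

locale drift_system =
  fixes u v :: "'n::finite \<Rightarrow> real^'n \<Rightarrow> real"
  assumes u: "\<And>i k. C_k k (u i)" and v: "\<And>i k. C_k k (v i)"
    and div_u: "\<And>x. (\<Sum>j\<in>UNIV. D j (u j) x) = 0"
    and div_v: "\<And>x. (\<Sum>j\<in>UNIV. D j (v j) x) = 0"
    and curl: "\<And>i k x.
      D k (\<lambda>x. (\<Sum>j\<in>UNIV. u j x * D j (v i) x) - (\<Sum>j\<in>UNIV. D j (D j (v i)) x)) x
    = D i (\<lambda>x. (\<Sum>j\<in>UNIV. u j x * D j (v k) x) - (\<Sum>j\<in>UNIV. D j (D j (v k)) x)) x"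
begin

definition force :: "'n \<Rightarrow> real^'n \<Rightarrow> real" where
  "force i x = (\<Sum>j\<in>UNIV. u j x * D j (v i) x) - (\<Sum>j\<in>UNIV. D j (D j (v i)) x)"

lemma C_k_partial_deriv_v: "C_k k (D j (v i))"
  by (rule C_k_SucD[OF v])

lemma C_k_force: "C_k k (force i)"
  unfolding force_def
  by (intro C_k_diff C_k_sum C_k_mult u C_k_partial_deriv_v C_k_SucD[OF C_k_partial_deriv_v]) auto

lemma curl_force: "D k (force i) x = D i (force k) x"
  using curl unfolding force_def[abs_def] .

text \<open>The vector potential, written as an antisymmetric tensor.\<close>

definition vpot :: "real \<Rightarrow> 'n \<Rightarrow> 'n \<Rightarrow> real^'n \<Rightarrow> real" where
  "vpot h i k x = h * (pot h i (v k) x - pot h k (v i) x)"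

lemma C_k_vpot: "C_k k (vpot h i l)"
  unfolding vpot_def by (intro C_k_cmult C_k_diff C_k_pot v)

lemma partial_deriv_vpot:
  "D j (vpot h i k) x = h * (pot h i (D j (v k)) x - pot h k (D j (v i)) x)"
proof -
  have p: "has_partial (pot h i (v k)) j (pot h i (D j (v k)) x) x" for i k
    unfolding partial_deriv_pot[OF v, symmetric] by (rule has_partial_C_k[OF C_k_pot[OF v]])
  show ?thesis
    unfolding vpot_def[abs_def] by (intro has_partialD has_partial_cmult has_partial_diff p)
qed

lemma sum_pot_div: "(\<Sum>k\<in>UNIV. pot h i (D k (v k)) x) = 0"
proof -
  have "(\<Sum>k\<in>UNIV. pot h i (D k (v k)) x) =
    integral (cbox (0, -One) (1, One)) (\<lambda>z. \<Sum>k\<in>UNIV. (case z of (t, y) \<Rightarrow> kern y * y $ i) *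
          D k (v k) (x - (case z of (t, y) \<Rightarrow> (t * h) *\<^sub>R y)))"
    unfolding pot_def avg_def
    by (intro integral_sum[symmetric] integrable_continuous continuous_on_avg_integrand
          continuous_on_kern_coordinate continuous_on_dilation C_k_continuous[OF C_k_partial_deriv_v]) auto
  also have "\<dots> = 0"
    by (simp add: sum_distrib_left[symmetric] div_v)
  finally show ?thesis .
qed

text \<open>The row of \<open>vpot\<close> with the divergence of \<open>v\<close> vanishes; the other one is \<open>sum_pot_partial_deriv\<close>.\<close>

lemma div_vpot: "(\<Sum>k\<in>UNIV. D k (vpot h i k) x) = mollify h (v i) x - v i x"
proof -
  have "(\<Sum>k\<in>UNIV. D k (vpot h i k) x) =
      h * (\<Sum>k\<in>UNIV. pot h i (D k (v k)) x) - h * (\<Sum>k\<in>UNIV. pot h k (D k (v i)) x)"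
    by (simp add: partial_deriv_vpot sum_distrib_left sum_subtractf right_diff_distrib)
  then show ?thesis
    using sum_pot_partial_deriv[OF v, of h i x] by (simp add: sum_pot_div)
qed

text \<open>With \<open>w\<^sub>i = \<Sum>\<^sub>k \<partial>\<^sub>k (\<psi> A\<^sub>i\<^sub>k)\<close> this is \<open>\<partial>\<^sub>j w\<^sub>i + \<psi> \<partial>\<^sub>j v\<^sub>i\<close>: what remains of \<open>\<nabla>w\<close> beside the
  leading part \<open>- \<psi> \<nabla>v\<close>.\<close>

definition errterm :: "real \<Rightarrow> real \<Rightarrow> 'n \<Rightarrow> 'n \<Rightarrow> real^'n \<Rightarrow> real" where
  "errterm h r i j x = bump 4 r x * D j (mollify h (v i)) x
     + D j (bump 4 r) x * (mollify h (v i) x - v i x)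
     + (\<Sum>k\<in>UNIV. D j (D k (bump 4 r)) x * vpot h i k x + D k (bump 4 r) x * D j (vpot h i k) x)"

text \<open>The field whose divergence collects all integrations by parts at once: the viscous and the convective flux
  tested with \<open>w\<close>, the force against \<open>\<psi> A\<close>, and the transport of the energy density \<open>\<bar>v\<bar>\<^sup>2 / 2\<close>.\<close>

definition flux :: "real \<Rightarrow> real \<Rightarrow> 'n \<Rightarrow> real^'n \<Rightarrow> real" where
  "flux h r j x = (let \<psi> = bump 4 r;
      w = \<lambda>i x. \<psi> x * (mollify h (v i) x - v i x) + (\<Sum>k\<in>UNIV. D k \<psi> x * vpot h i k x) in
    (\<Sum>i\<in>UNIV. D j (v i) x * w i x - (u j x * v i x) * w i x)
    + (\<Sum>i\<in>UNIV. force i x * (\<psi> x * vpot h i j x)) - 1 / 2 * ((u j x * \<psi> x) * (\<Sum>i\<in>UNIV. v i x * v i x)))"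

lemma C_k_flux: "C_k 1 (flux h r j)"
proof -
  have "C_k 3 (bump 4 r :: real^'n \<Rightarrow> real)" by (rule C_k_bump) simp
  then have b: "C_k (Suc 1) (bump 4 r :: real^'n \<Rightarrow> real)" by (rule C_k_mono) simp
  show ?thesis
    unfolding flux_def Let_def
    by (intro C_k_diff C_k_add C_k_sum C_k_cmult[of _ _ "1/2"] C_k_mult C_k_mollify C_k_vpot u v C_k_force C_k_partial_deriv_v
        C_k_SucD[OF b] C_k_down[OF b] finite)
qed

lemma flux_outside:
  assumes "norm x > r" "r > 0"
  shows "flux h r j x = 0"
proof -
  have "D k (bump 4 r) x = 0" for k
    using _ assms(1) by (rule partial_deriv_zero_outside) (use assms(2) in \<open>simp add: bump_outside\<close>)
  then show ?thesis using assms by (simp add: flux_def bump_outside)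
qed

lemma energy_identity:
  "bump 4 r x * (\<Sum>i\<in>UNIV. \<Sum>j\<in>UNIV. D j (v i) x * D j (v i) x) =
    (\<Sum>i\<in>UNIV. \<Sum>j\<in>UNIV. (D j (v i) x - u j x * v i x) * errterm h r i j x)
    - 1 / 2 * (\<Sum>j\<in>UNIV. u j x * D j (bump 4 r) x) * (\<Sum>i\<in>UNIV. v i x * v i x)
    - (\<Sum>j\<in>UNIV. D j (flux h r j) x)"
proof -
  have b3: "C_k 3 (bump 4 r :: real^'n \<Rightarrow> real)" by (rule C_k_bump) simp
  then have b: "C_k (Suc (Suc 0)) (bump 4 r :: real^'n \<Rightarrow> real)" by (rule C_k_mono) simp
  define \<psi> :: "real^'n \<Rightarrow> real" where "\<psi> = bump 4 r"
  have \<psi>: "has_partial \<psi> j (D j \<psi> x) x" "has_partial (D k \<psi>) j (D j (D k \<psi>) x) x" for j k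
    unfolding \<psi>_def using has_partial_C_k[OF b] has_partial_C_k[OF C_k_SucD[OF b]] by auto
  define w where "w = (\<lambda>i x. \<psi> x * (mollify h (v i) x - v i x) + (\<Sum>k\<in>UNIV. D k \<psi> x * vpot h i k x))"
  have pv: "has_partial (v i) j (D j (v i) x) x" for i j by (rule has_partial_C_k[OF v])
  have pdv: "has_partial (D k (v i)) j (D j (D k (v i)) x) x" for i j k by (rule has_partial_C_k[OF C_k_partial_deriv_v])
  have pu: "has_partial (u i) j (D j (u i) x) x" for i j by (rule has_partial_C_k[OF u])
  have pF: "has_partial (force i) j (D j (force i) x) x" for i j by (rule has_partial_C_k[OF C_k_force])
  have pA: "has_partial (vpot h i k) j (D j (vpot h i k) x) x" for i j k by (rule has_partial_C_k[OF C_k_vpot])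
  have pS: "has_partial (mollify h (v i)) j (D j (mollify h (v i)) x) x" for i j by (rule has_partial_C_k[OF C_k_mollify[OF v]])
  have pw: "has_partial (w i) j (errterm h r i j x - \<psi> x * D j (v i) x) x" for i j
  proof -
    have "has_partial (w i) j (D j \<psi> x * (mollify h (v i) x - v i x) + \<psi> x * (D j (mollify h (v i)) x - D j (v i) x)
       + (\<Sum>k\<in>UNIV. D j (D k \<psi>) x * vpot h i k x + D k \<psi> x * D j (vpot h i k) x)) x"
      unfolding w_def by (intro has_partial_add has_partial_mult has_partial_sum has_partial_diff \<psi> pS pv pA finite)
    then show ?thesis by (simp add: errterm_def \<psi>_def algebra_simps)
  qed
  have pf: "has_partial (flux h r j) j ((\<Sum>i\<in>UNIV. (D j (D j (v i)) x * w i x + D j (v i) x * (errterm h r i j x - \<psi> x * D j (v i) x))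
       - ((D j (u j) x * v i x + u j x * D j (v i) x) * w i x + u j x * v i x * (errterm h r i j x - \<psi> x * D j (v i) x)))
     + (\<Sum>i\<in>UNIV. D j (force i) x * (\<psi> x * vpot h i j x) + force i x * (D j \<psi> x * vpot h i j x + \<psi> x * D j (vpot h i j) x))
     - 1 / 2 * ((D j (u j) x * \<psi> x + u j x * D j \<psi> x) * (\<Sum>i\<in>UNIV. v i x * v i x)
       + u j x * \<psi> x * (\<Sum>i\<in>UNIV. D j (v i) x * v i x + v i x * D j (v i) x))) x" for j
  proof -
    have "flux h r j = (\<lambda>x. (\<Sum>i\<in>UNIV. D j (v i) x * w i x - (u j x * v i x) * w i x)
      + (\<Sum>i\<in>UNIV. force i x * (\<psi> x * vpot h i j x)) - 1 / 2 * ((u j x * \<psi> x) * (\<Sum>i\<in>UNIV. v i x * v i x)))"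
      by (simp add: flux_def[abs_def] Let_def w_def \<psi>_def)
    then show ?thesis
      by (simp only:) (intro has_partial_diff has_partial_add has_partial_sum finite has_partial_cmult[of _ _ _ _ "1/2"] has_partial_mult pv pdv pu pF pA pw \<psi>)
  qed
  have "(\<Sum>j\<in>UNIV. D j (flux h r j) x) = (\<Sum>i\<in>UNIV. \<Sum>j\<in>UNIV. (D j (v i) x - u j x * v i x) * errterm h r i j x)
     - \<psi> x * (\<Sum>i\<in>UNIV. \<Sum>j\<in>UNIV. D j (v i) x * D j (v i) x)
     - 1 / 2 * (\<Sum>j\<in>UNIV. u j x * D j \<psi> x) * (\<Sum>i\<in>UNIV. v i x * v i x)"
    unfolding has_partialD[OF pf]
  proof (rule energy_algebra)
    show "(\<Sum>j\<in>UNIV. D j (u j) x) = 0" by (rule div_u)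
    show "force i x = (\<Sum>j\<in>UNIV. u j x * D j (v i) x) - (\<Sum>j\<in>UNIV. D j (D j (v i)) x)" for i
      by (rule force_def)
    show "D j (force i) x = D i (force j) x" for i j by (rule curl_force)
    show "vpot h i j x = - vpot h j i x" for i j by (simp add: vpot_def algebra_simps)
    show "w i x = (\<Sum>j\<in>UNIV. D j \<psi> x * vpot h i j x + \<psi> x * D j (vpot h i j) x)" for i
      unfolding sum.distrib sum_distrib_left[symmetric] div_vpot by (simp add: w_def)
  qed simp
  then show ?thesis unfolding \<psi>_def by simp
qed

text \<open>All quantities through which the error term is estimated. Their common feature is that they are averages
  over the scale \<open>h\<close>, hence under control with any weight of Morrey exponent below two.\<close>

definition errsq :: "real \<Rightarrow> real^'n \<Rightarrow> real" where
  "errsq h x = (\<Sum>i\<in>UNIV. (mollify h (v i) x)\<^sup>2) + (\<Sum>i\<in>UNIV. \<Sum>j\<in>UNIV. (D j (mollify h (v i)) x)\<^sup>2)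
    + (\<Sum>i\<in>UNIV. (mollify h (v i) x - v i x)\<^sup>2) + (\<Sum>i\<in>UNIV. \<Sum>k\<in>UNIV. (vpot h i k x)\<^sup>2)
    + (\<Sum>i\<in>UNIV. \<Sum>k\<in>UNIV. \<Sum>j\<in>UNIV. (D j (vpot h i k) x)\<^sup>2)"

lemma errsq_bounds:
  "\<bar>mollify h (v i) x\<bar> \<le> sqrt (errsq h x)"
  "\<bar>D j (mollify h (v i)) x\<bar> \<le> sqrt (errsq h x)"
  "\<bar>mollify h (v i) x - v i x\<bar> \<le> sqrt (errsq h x)"
  "\<bar>vpot h i k x\<bar> \<le> sqrt (errsq h x)"
  "\<bar>D j (vpot h i k) x\<bar> \<le> sqrt (errsq h x)"
  "errsq h x \<ge> 0"
proof -
  have s1: "a i \<le> (\<Sum>i\<in>UNIV. a i)" if "\<And>i. a i \<ge> 0" for a :: "'n \<Rightarrow> real" and i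
    using that by (intro member_le_sum) auto
  have s2: "a i j \<le> (\<Sum>i\<in>UNIV. \<Sum>j\<in>UNIV. a i j)" if "\<And>i j. a i j \<ge> 0" for a :: "'n \<Rightarrow> 'n \<Rightarrow> real" and i j
    using s1[of "a i" j] s1[of "\<lambda>i. \<Sum>j\<in>UNIV. a i j" i] that by (meson order_trans sum_nonneg)
  have s3: "a i k j \<le> (\<Sum>i\<in>UNIV. \<Sum>k\<in>UNIV. \<Sum>j\<in>UNIV. a i k j)" if "\<And>i k j. a i k j \<ge> 0" for a :: "'n \<Rightarrow> 'n \<Rightarrow> 'n \<Rightarrow> real" and i j k
    using s1[of "a i k" j] s2[of "\<lambda>i k. \<Sum>j\<in>UNIV. a i k j" i k] that by (meson order_trans sum_nonneg)
  have n: "0 \<le> (\<Sum>i\<in>UNIV. (mollify h (v i) x)\<^sup>2)" "0 \<le> (\<Sum>i\<in>UNIV. \<Sum>j\<in>UNIV. (D j (mollify h (v i)) x)\<^sup>2)"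
    "0 \<le> (\<Sum>i\<in>UNIV. (mollify h (v i) x - v i x)\<^sup>2)" "0 \<le> (\<Sum>i\<in>UNIV. \<Sum>k\<in>UNIV. (vpot h i k x)\<^sup>2)"
    "0 \<le> (\<Sum>i\<in>UNIV. \<Sum>k\<in>UNIV. \<Sum>j\<in>UNIV. (D j (vpot h i k) x)\<^sup>2)"
    by (intro sum_nonneg zero_le_power2)+
  show "errsq h x \<ge> 0" unfolding errsq_def using n by linarith
  have sq: "\<bar>t\<bar> \<le> sqrt (errsq h x)" if "t\<^sup>2 \<le> errsq h x" for t
    using that real_sqrt_le_mono[OF that] by simp
  show "\<bar>mollify h (v i) x\<bar> \<le> sqrt (errsq h x)"
    using s1[of "\<lambda>i. (mollify h (v i) x)\<^sup>2" i] n by (intro sq) (simp add: errsq_def)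
  show "\<bar>D j (mollify h (v i)) x\<bar> \<le> sqrt (errsq h x)"
    using s2[of "\<lambda>i j. (D j (mollify h (v i)) x)\<^sup>2" i j] n by (intro sq) (simp add: errsq_def)
  show "\<bar>mollify h (v i) x - v i x\<bar> \<le> sqrt (errsq h x)"
    using s1[of "\<lambda>i. (mollify h (v i) x - v i x)\<^sup>2" i] n by (intro sq) (simp add: errsq_def)
  show "\<bar>vpot h i k x\<bar> \<le> sqrt (errsq h x)"
    using s2[of "\<lambda>i k. (vpot h i k x)\<^sup>2" i k] n by (intro sq) (simp add: errsq_def)
  show "\<bar>D j (vpot h i k) x\<bar> \<le> sqrt (errsq h x)"
    using s3[of "\<lambda>i k j. (D j (vpot h i k) x)\<^sup>2" i k j] n by (intro sq) (simp add: errsq_def)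
qed

lemma errterm_bound:
  assumes "r \<ge> 1"
  shows "\<bar>errterm h r i j x\<bar> \<le> err_const TYPE('n) * sqrt (errsq h x)"
proof -
  let ?N = "sqrt (errsq h x)"
  have N: "?N \<ge> 0" using errsq_bounds(6) by simp
  note pd = partial_deriv_bump4_bounds[OF assms]
  have m: "\<bar>a * b\<bar> \<le> 56 * ?N" if "\<bar>a\<bar> \<le> 56" "\<bar>b\<bar> \<le> ?N" for a b
    unfolding abs_mult using that N by (intro mult_mono) auto
  have b: "\<bar>bump 4 r x\<bar> \<le> 56" using bump_nonneg[of 4 r x] bump_le_1[of 4 r x] by simp
  have "\<bar>\<Sum>k\<in>UNIV. D j (D k (bump 4 r)) x * vpot h i k x + D k (bump 4 r) x * D j (vpot h i k) x\<bar>
      \<le> (\<Sum>k\<in>(UNIV::'n set). 56 * ?N + 56 * ?N)"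
    by (intro order_trans[OF sum_abs] sum_mono order_trans[OF abs_triangle_ineq] add_mono m pd errsq_bounds)
  moreover have "\<bar>bump 4 r x * D j (mollify h (v i)) x\<bar> \<le> 56 * ?N"
    by (intro m b errsq_bounds)
  moreover have "\<bar>D j (bump 4 r) x * (mollify h (v i) x - v i x)\<bar> \<le> 56 * ?N"
    by (intro m pd errsq_bounds)
  ultimately show ?thesis unfolding errterm_def err_const_def by (simp add: algebra_simps)
qed

text \<open>Young's inequality with parameter \<open>h\<close> for the viscous term. For the drift terms a bound by \<open>errsq\<close> suffices,
  because \<open>v\<close> itself is at most \<open>2 \<surd>errsq\<close>, as \<open>v = S v - (S v - v)\<close>.\<close>

lemma energy_inequality:
  assumes r: "r \<ge> 1" and h: "h > 0" and W: "\<And>j. \<bar>u j x\<bar> \<le> W"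
  shows "bump 4 r x * gradsq v x \<le> (h * gradsq v x + energy_const TYPE('n) * (1 / h + W) * errsq h x) * indicator (ball 0 r) x
     + (\<Sum>j\<in>UNIV. D j (\<lambda>x. (-1) * flux h r j x) x)"
proof -
  note pd = partial_deriv_bump4_bounds[OF r]
  have fl: "(\<Sum>j\<in>UNIV. D j (\<lambda>x. (-1) * flux h r j x) x) = - (\<Sum>j\<in>UNIV. D j (flux h r j) x)"
  proof -
    have "C_k (Suc 0) (flux h r j)" for j using C_k_flux by simp
    then have "D j (\<lambda>x. (-1) * flux h r j x) x = (-1) * D j (flux h r j) x" for j
      by (intro partial_deriv_cmult C_k_Suc_differentiable)
    then show ?thesis by (simp add: sum_negf)
  qed
  have id: "bump 4 r x * gradsq v x =
    (\<Sum>i\<in>UNIV. \<Sum>j\<in>UNIV. (D j (v i) x - u j x * v i x) * errterm h r i j x)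
    - 1 / 2 * (\<Sum>j\<in>UNIV. u j x * D j (bump 4 r) x) * (\<Sum>i\<in>UNIV. v i x * v i x)
    + (\<Sum>j\<in>UNIV. D j (\<lambda>x. (-1) * flux h r j x) x)"
    using energy_identity[of r x h] unfolding fl by (simp add: gradsq_def power2_eq_square)
  show ?thesis
  proof (cases "norm x < r")
    case False
    then have "errterm h r i j x = 0" for i j
      using r by (simp add: errterm_def pd bump_outside)
    moreover have "D j (bump 4 r) x = 0" for j using False by (intro pd) simp
    ultimately show ?thesis using id False by simp
  next
    case True
    define N where "N = sqrt (errsq h x)"
    have N: "N \<ge> 0" "N * N = errsq h x" using errsq_bounds(6) by (auto simp: N_def)
    have c: "err_const TYPE('n) \<ge> 0" by (simp add: err_const_def)
    have W0: "W \<ge> 0" using W[of undefined] by linarith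
    have v2: "\<bar>v i x\<bar> \<le> 2 * N" for i
      using errsq_bounds(1)[of h i x] errsq_bounds(3)[of h i x] by (simp add: N_def)
    have E: "\<bar>errterm h r i j x\<bar> \<le> err_const TYPE('n) * N" for i j unfolding N_def by (rule errterm_bound[OF r])
    have t1: "(D j (v i) x - u j x * v i x) * errterm h r i j x \<le>
        h * (D j (v i) x)\<^sup>2 + ((err_const TYPE('n))\<^sup>2 / h + 2 * err_const TYPE('n) * W) * (N * N)" for i j
    proof -
      let ?d = "D j (v i) x" and ?E = "errterm h r i j x"
      have "0 \<le> (h * ?d - ?E)\<^sup>2 / (2 * h)" using h by simp
      then have "?d * ?E \<le> (h * ?d\<^sup>2 + ?E\<^sup>2 / h) / 2"
        using h by (simp add: field_simps power2_eq_square)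
      moreover have "0 \<le> h * ?d\<^sup>2" "0 \<le> ?E\<^sup>2 / h" using h by auto
      moreover have "?E\<^sup>2 / h \<le> (err_const TYPE('n) * N)\<^sup>2 / h"
        using E[of i j] h by (intro divide_right_mono) (auto simp: abs_le_square_iff[symmetric] abs_of_nonneg c N)
      moreover have "p \<le> A + D" if "p \<le> (A + B) / 2" "0 \<le> A" "0 \<le> B" "B \<le> D" for p A B D :: real
        using that by simp
      ultimately have 1: "?d * ?E \<le> h * ?d\<^sup>2 + (err_const TYPE('n) * N)\<^sup>2 / h" by blast
      have "\<bar>u j x * v i x * ?E\<bar> \<le> W * (2 * N) * (err_const TYPE('n) * N)"
        unfolding abs_mult using W v2 E N c W0 by (intro mult_mono) auto
      then have "- (u j x * v i x) * ?E \<le> W * (2 * N) * (err_const TYPE('n) * N)" unfolding abs_le_iff by simp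
      with 1 show ?thesis by (simp add: algebra_simps power2_eq_square)
    qed
    have "(\<Sum>i\<in>UNIV. \<Sum>j\<in>UNIV. (D j (v i) x - u j x * v i x) * errterm h r i j x)
      \<le> (\<Sum>i\<in>UNIV. \<Sum>j\<in>UNIV. h * (D j (v i) x)\<^sup>2 + ((err_const TYPE('n))\<^sup>2 / h + 2 * err_const TYPE('n) * W) * (N * N))"
      by (intro sum_mono t1)
    also have "\<dots> = h * gradsq v x + (real CARD('n))\<^sup>2 * (((err_const TYPE('n))\<^sup>2 / h + 2 * err_const TYPE('n) * W) * (N * N))"
      by (simp add: sum.distrib gradsq_def sum_distrib_left power2_eq_square)
    finally have 1: "(\<Sum>i\<in>UNIV. \<Sum>j\<in>UNIV. (D j (v i) x - u j x * v i x) * errterm h r i j x)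
      \<le> h * gradsq v x + (real CARD('n))\<^sup>2 * (((err_const TYPE('n))\<^sup>2 / h + 2 * err_const TYPE('n) * W) * (N * N))" .
    have "\<bar>\<Sum>j\<in>UNIV. u j x * D j (bump 4 r) x\<bar> \<le> (\<Sum>j\<in>(UNIV::'n set). W * 56)"
      unfolding abs_mult[symmetric] using W0 W pd
      by (intro order_trans[OF sum_abs] sum_mono) (auto simp: abs_mult intro!: mult_mono)
    moreover have "\<bar>\<Sum>i\<in>UNIV. v i x * v i x\<bar> \<le> (\<Sum>i\<in>(UNIV::'n set). (2 * N) * (2 * N))"
    proof (intro order_trans[OF sum_abs] sum_mono)
      show "\<bar>v i x * v i x\<bar> \<le> (2 * N) * (2 * N)" for i
        unfolding abs_mult using N(1) by (intro mult_mono v2) auto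
    qed
    ultimately have "\<bar>(\<Sum>j\<in>UNIV. u j x * D j (bump 4 r) x) * (\<Sum>i\<in>UNIV. v i x * v i x)\<bar>
      \<le> (\<Sum>j\<in>(UNIV::'n set). W * 56) * (\<Sum>i\<in>(UNIV::'n set). (2 * N) * (2 * N))"
      unfolding abs_mult using W0 by (intro mult_mono) auto
    then have 2: "- 1 / 2 * (\<Sum>j\<in>UNIV. u j x * D j (bump 4 r) x) * (\<Sum>i\<in>UNIV. v i x * v i x)
      \<le> (real CARD('n))\<^sup>2 * (112 * W * (N * N))"
      by (simp add: power2_eq_square algebra_simps)
    have 3: "(real CARD('n))\<^sup>2 * (((err_const TYPE('n))\<^sup>2 / h + 2 * err_const TYPE('n) * W) * (N * N)) + (real CARD('n))\<^sup>2 * (112 * W * (N * N)) \<le>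
       energy_const TYPE('n) * (1 / h + W) * (N * N)"
    proof -
      have "((err_const TYPE('n))\<^sup>2 / h + 2 * err_const TYPE('n) * W) + 112 * W \<le> ((err_const TYPE('n))\<^sup>2 + 2 * err_const TYPE('n) + 112) * (1 / h + W)"
        using h W0 c by (simp add: algebra_simps)
      then have "(real CARD('n))\<^sup>2 * (N * N) * (((err_const TYPE('n))\<^sup>2 / h + 2 * err_const TYPE('n) * W) + 112 * W) \<le>
         (real CARD('n))\<^sup>2 * (N * N) * (((err_const TYPE('n))\<^sup>2 + 2 * err_const TYPE('n) + 112) * (1 / h + W))"
        using N(1) by (intro mult_left_mono mult_nonneg_nonneg) auto
      then show ?thesis by (simp add: energy_const_def algebra_simps)
    qed
    show ?thesis using id 1 2 3 True unfolding N by simp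
  qed
qed

end

section \<open>The Caccioppoli inequality at unit scale\<close>

lemma weight_cmult:
  assumes "U \<in> borel_measurable lborel" "f \<in> borel_measurable lborel" "c \<ge> 0"
  shows "weighted_int U (\<lambda>x. c * f x) = ennreal c * weighted_int U f"
  using assms by (subst nn_integral_cmult[symmetric]) (auto simp: ennreal_mult' ac_simps)

lemma weight_add:
  assumes "U \<in> borel_measurable lborel" "f \<in> borel_measurable lborel" "g \<in> borel_measurable lborel"
    "\<And>x. f x \<ge> 0" "\<And>x. g x \<ge> 0"
  shows "weighted_int U (\<lambda>x. f x + g x) = weighted_int U f + weighted_int U g"
  using assms by (subst nn_integral_add[symmetric]) (auto simp: ennreal_plus distrib_left)

lemma weight_sum:
  assumes "U \<in> borel_measurable lborel" "finite I" "\<And>i. i \<in> I \<Longrightarrow> f i \<in> borel_measurable lborel"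
    "\<And>i x. i \<in> I \<Longrightarrow> f i x \<ge> 0"
  shows "weighted_int U (\<lambda>x. \<Sum>i\<in>I. f i x) = (\<Sum>i\<in>I. \<integral>\<^sup>+x. U x * ennreal (f i x) \<partial>lborel)"
proof -
  have "weighted_int U (\<lambda>x. \<Sum>i\<in>I. f i x) = (\<integral>\<^sup>+x. (\<Sum>i\<in>I. U x * ennreal (f i x)) \<partial>lborel)"
  proof (rule nn_integral_cong)
    fix x
    have "ennreal (\<Sum>i\<in>I. f i x) = (\<Sum>i\<in>I. ennreal (f i x))"
      by (rule sum_ennreal[symmetric]) (rule assms(4))
    then show "U x * ennreal (\<Sum>i\<in>I. f i x) = (\<Sum>i\<in>I. U x * ennreal (f i x))"
      by (simp only: sum_distrib_left)
  qed
  also have "\<dots> = (\<Sum>i\<in>I. \<integral>\<^sup>+x. U x * ennreal (f i x) \<partial>lborel)"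
  proof (rule nn_integral_sum)
    fix i assume i: "i \<in> I"
    note [measurable] = assms(1) assms(3)[OF i]
    show "(\<lambda>x. U x * ennreal (f i x)) \<in> borel_measurable lborel" by measurable
  qed
  finally show ?thesis .
qed

lemma weight_combination:
  assumes [measurable]: "U \<in> borel_measurable lborel" "f1 \<in> borel_measurable lborel" "f2 \<in> borel_measurable lborel"
      "f3 \<in> borel_measurable lborel" "f4 \<in> borel_measurable lborel"
    and nn: "\<And>x. f1 x \<ge> 0" "\<And>x. f2 x \<ge> 0" "\<And>x. f3 x \<ge> 0" "\<And>x. f4 x \<ge> 0"
    and c: "c2 \<ge> 0" "c3 \<ge> 0" "c4 \<ge> 0"
  shows "weighted_int U (\<lambda>x. f1 x + (c2 * f2 x + (c3 * f3 x + c4 * f4 x))) =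
    (weighted_int U f1) + (ennreal c2 * weighted_int U f2
    + (ennreal c3 * weighted_int U f3 + ennreal c4 * weighted_int U f4))"
proof -
  have 1: "weighted_int U (\<lambda>x. c3 * f3 x + c4 * f4 x) =
     ennreal c3 * weighted_int U f3 + ennreal c4 * weighted_int U f4"
    using nn c by (subst weight_add) (auto simp: weight_cmult)
  have 2: "weighted_int U (\<lambda>x. c2 * f2 x + (c3 * f3 x + c4 * f4 x)) =
     ennreal c2 * weighted_int U f2 + weighted_int U (\<lambda>x. c3 * f3 x + c4 * f4 x)"
    using nn c by (subst weight_add) (auto simp: weight_cmult)
  show ?thesis
    unfolding 1[symmetric] 2[symmetric] using nn c by (intro weight_add) auto
qed

lemma morrey_mono:
  assumes "morrey U K l" "\<And>x. U' x \<le> U x" "U' \<in> borel_measurable borel"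
  shows "morrey U' K l"
  unfolding morrey_def
proof (intro conjI allI impI assms(3))
  fix z :: "real^'a" and s :: real assume s: "0 < s \<and> s \<le> 1"
  have "(\<integral>\<^sup>+y. U' (z + s *\<^sub>R y) * indicator (ball 0 1) y \<partial>lborel) \<le> (\<integral>\<^sup>+y. U (z + s *\<^sub>R y) * indicator (ball 0 1) y \<partial>lborel)"
    by (intro nn_integral_mono mult_right_mono assms(2)) simp
  also have "\<dots> \<le> ennreal (K * s powr - l)" using assms(1) s by (simp add: morrey_def)
  finally show "(\<integral>\<^sup>+y. U' (z + s *\<^sub>R y) * indicator (ball 0 1) y \<partial>lborel) \<le> ennreal (K * s powr - l)" .
qed

lemma morrey_one: "morrey (\<lambda>x::real^'n::finite. 1) (unit_vol TYPE('n)) 0"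
  by (simp add: morrey_def nn_integral_indicator_unit_ball del: nn_integral_indicator)

text \<open>By \<open>partial_deriv_mollify_kern\<close> this is \<open>h\<close> times a derivative of the mollified function.\<close>

abbreviation kern_deriv_avg :: "real \<Rightarrow> 'n::finite \<Rightarrow> (real^'n \<Rightarrow> real) \<Rightarrow> real^'n \<Rightarrow> real" where
  "kern_deriv_avg h j \<equiv> avg (D j kern) (\<lambda>y. h *\<^sub>R y) (-One) One"

context drift_system
begin

lemma measurable_parts [measurable]:
  "v i \<in> borel_measurable borel" "u i \<in> borel_measurable borel" "D j (v i) \<in> borel_measurable borel"
  "mollify h (v i) \<in> borel_measurable borel" "avg (D j kern) (\<lambda>y. h *\<^sub>R y) (-One) One (v i) \<in> borel_measurable borel"
  "pot h k (v i) \<in> borel_measurable borel" "pot h k (D j (v i)) \<in> borel_measurable borel"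
  "vsq v \<in> borel_measurable borel" "gradsq v \<in> borel_measurable borel" "errsq h \<in> borel_measurable borel"
proof -
  have cv: "continuous_on UNIV (v i)" for i by (rule C_k_continuous[OF v])
  have cd: "continuous_on UNIV (D j (v i))" for i j by (rule C_k_continuous[OF C_k_partial_deriv_v])
  have k1: "C_k (Suc 0) (kern :: real^'n \<Rightarrow> real)" using C_k_kern by simp
  have ck: "continuous_on UNIV (avg (D j kern) (\<lambda>y. h *\<^sub>R y) (-One) One (v i))" for j i
    by (intro continuous_on_avg C_k_continuous[OF C_k_SucD[OF k1]] cv continuous_intros)
  have 1: "v i \<in> borel_measurable borel" "D j (v i) \<in> borel_measurable borel" 
    "mollify h (v i) \<in> borel_measurable borel" "D j (mollify h (v i)) \<in> borel_measurable borel" for i j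
    using cv cd C_k_continuous[OF C_k_mollify[OF v]] C_k_continuous[OF C_k_SucD[OF C_k_mollify[OF v]]] by (auto intro: borel_measurable_continuous_onI)
  have 2: "vpot h i k \<in> borel_measurable borel" "D j (vpot h i k) \<in> borel_measurable borel" for i k j
    using C_k_continuous[OF C_k_vpot] C_k_continuous[OF C_k_SucD[OF C_k_vpot]] by (auto intro: borel_measurable_continuous_onI)
  note [measurable] = 1 2
  show "v i \<in> borel_measurable borel" "D j (v i) \<in> borel_measurable borel" "mollify h (v i) \<in> borel_measurable borel"
    by measurable
  show "avg (D j kern) (\<lambda>y. h *\<^sub>R y) (-One) One (v i) \<in> borel_measurable borel"
    using ck by (rule borel_measurable_continuous_onI)
  show "u i \<in> borel_measurable borel" using C_k_continuous[OF u] by (rule borel_measurable_continuous_onI)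
  show "pot h k (v i) \<in> borel_measurable borel" "pot h k (D j (v i)) \<in> borel_measurable borel"
    using C_k_continuous[OF C_k_pot[OF v]] C_k_continuous[OF C_k_pot[OF C_k_partial_deriv_v]] by (auto intro: borel_measurable_continuous_onI)
  show "vsq v \<in> borel_measurable borel" "gradsq v \<in> borel_measurable borel" "errsq h \<in> borel_measurable borel"
    unfolding vsq_def[abs_def] gradsq_def[abs_def] errsq_def[abs_def] by measurable
qed

text \<open>Each square is bounded by squares of plain averages: two kernels applied to \<open>v\<close>, and \<open>pot\<close> applied to
  \<open>v\<close> and \<open>\<nabla>v\<close> with a factor \<open>h\<^sup>2\<close>.\<close>

lemma errsq_le:
  assumes h: "h > 0"
  shows "errsq h x \<le> (\<Sum>i\<in>UNIV. (mollify h (v i) x)\<^sup>2)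
    + ((1 / h\<^sup>2) * (\<Sum>i\<in>UNIV. \<Sum>j\<in>UNIV. (kern_deriv_avg h j (v i) x)\<^sup>2)
    + ((4 * h\<^sup>2) * (\<Sum>i\<in>UNIV. \<Sum>k\<in>UNIV. (pot h k (v i) x)\<^sup>2)
    + ((real CARD('n) + 4) * h\<^sup>2) * (\<Sum>i\<in>UNIV. \<Sum>k\<in>UNIV. \<Sum>j\<in>UNIV. (pot h k (D j (v i)) x)\<^sup>2)))"
proof -
  let ?n = "real CARD('n)"
  let ?P = "\<lambda>i k j. (pot h k (D j (v i)) x)\<^sup>2"
  have 1: "(D j (mollify h (v i)) x)\<^sup>2 = (1 / h\<^sup>2) * (kern_deriv_avg h j (v i) x)\<^sup>2" for i j
  proof -
    have "D j (mollify h (v i)) x = (1 / h) * avg (D j kern) (\<lambda>y. h *\<^sub>R y) (-One) One (v i) x"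
      using partial_deriv_mollify_kern[OF v, of h j i x] h by (simp add: field_simps)
    then show ?thesis by (simp add: power_mult_distrib power_divide)
  qed
  have 2: "(mollify h (v i) x - v i x)\<^sup>2 \<le> ?n * h\<^sup>2 * (\<Sum>k\<in>UNIV. \<Sum>j\<in>UNIV. ?P i k j)" for i
  proof -
    have "(mollify h (v i) x - v i x)\<^sup>2 = h\<^sup>2 * (\<Sum>k\<in>UNIV. pot h k (D k (v i)) x)\<^sup>2"
      using sum_pot_partial_deriv[OF v, of h i x] by (metis power2_commute power_mult_distrib)
    also have "\<dots> \<le> h\<^sup>2 * (?n * (\<Sum>k\<in>UNIV. ?P i k k))"
    proof -
      have "(\<Sum>k\<in>UNIV. pot h k (D k (v i)) x)\<^sup>2 \<le> (\<Sum>k\<in>UNIV. ?P i k k) * (\<Sum>k\<in>(UNIV::'n set). 1\<^sup>2)"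
        using Cauchy_Schwarz_ineq_sum[of "\<lambda>k. pot h k (D k (v i)) x" "\<lambda>k. 1" UNIV] by simp
      then show ?thesis by (intro mult_left_mono) (auto simp: mult.commute)
    qed
    also have "\<dots> \<le> h\<^sup>2 * (?n * (\<Sum>k\<in>UNIV. \<Sum>j\<in>UNIV. ?P i k j))"
      by (intro mult_left_mono sum_mono member_le_sum) auto
    finally show ?thesis by (simp add: ac_simps)
  qed
  have d: "(a - b)\<^sup>2 \<le> 2 * (a\<^sup>2 + b\<^sup>2)" for a b :: real
    using zero_le_power2[of "a + b"] by (simp add: power2_eq_square algebra_simps)
  have 3: "(\<Sum>i\<in>UNIV. \<Sum>k\<in>UNIV. (vpot h i k x)\<^sup>2) \<le> (4 * h\<^sup>2) * (\<Sum>i\<in>UNIV. \<Sum>k\<in>UNIV. (pot h k (v i) x)\<^sup>2)"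
  proof -
    have "(\<Sum>i\<in>UNIV. \<Sum>k\<in>UNIV. (vpot h i k x)\<^sup>2) \<le> (\<Sum>i\<in>UNIV. \<Sum>k\<in>UNIV. h\<^sup>2 * (2 * ((pot h i (v k) x)\<^sup>2 + (pot h k (v i) x)\<^sup>2)))"
      unfolding vpot_def power_mult_distrib by (intro sum_mono mult_left_mono d) auto
    also have "\<dots> = (2 * h\<^sup>2) * ((\<Sum>i\<in>UNIV. \<Sum>k\<in>UNIV. (pot h i (v k) x)\<^sup>2) + (\<Sum>i\<in>UNIV. \<Sum>k\<in>UNIV. (pot h k (v i) x)\<^sup>2))"
      by (simp add: sum.distrib sum_distrib_left distrib_left mult.assoc mult.left_commute)
    also have "(\<Sum>i\<in>UNIV. \<Sum>k\<in>UNIV. (pot h i (v k) x)\<^sup>2) = (\<Sum>i\<in>UNIV. \<Sum>k\<in>UNIV. (pot h k (v i) x)\<^sup>2)"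
      by (rule sum.swap)
    finally show ?thesis by simp
  qed
  have 4: "(\<Sum>i\<in>UNIV. \<Sum>k\<in>UNIV. \<Sum>j\<in>UNIV. (D j (vpot h i k) x)\<^sup>2) \<le> (4 * h\<^sup>2) * (\<Sum>i\<in>UNIV. \<Sum>k\<in>UNIV. \<Sum>j\<in>UNIV. ?P i k j)"
  proof -
    have "(\<Sum>i\<in>UNIV. \<Sum>k\<in>UNIV. \<Sum>j\<in>UNIV. (D j (vpot h i k) x)\<^sup>2) \<le> (\<Sum>i\<in>UNIV. \<Sum>k\<in>UNIV. \<Sum>j\<in>UNIV. h\<^sup>2 * (2 * (?P k i j + ?P i k j)))"
      unfolding partial_deriv_vpot power_mult_distrib by (intro sum_mono mult_left_mono d) auto
    also have "\<dots> = (2 * h\<^sup>2) * ((\<Sum>i\<in>UNIV. \<Sum>k\<in>UNIV. \<Sum>j\<in>UNIV. ?P k i j) + (\<Sum>i\<in>UNIV. \<Sum>k\<in>UNIV. \<Sum>j\<in>UNIV. ?P i k j))"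
      by (simp add: sum.distrib sum_distrib_left distrib_left mult.assoc mult.left_commute)
    also have "(\<Sum>i\<in>UNIV. \<Sum>k\<in>UNIV. \<Sum>j\<in>UNIV. ?P k i j) = (\<Sum>i\<in>UNIV. \<Sum>k\<in>UNIV. \<Sum>j\<in>UNIV. ?P i k j)"
      by (rule sum.swap)
    finally show ?thesis by simp
  qed
  have 5: "(\<Sum>i\<in>UNIV. (mollify h (v i) x - v i x)\<^sup>2) \<le> ?n * h\<^sup>2 * (\<Sum>i\<in>UNIV. \<Sum>k\<in>UNIV. \<Sum>j\<in>UNIV. ?P i k j)"
    unfolding sum_distrib_left[of "?n * h\<^sup>2"] using 2 by (intro sum_mono) (simp add: sum_distrib_left)
  have 6: "(\<Sum>i\<in>UNIV. \<Sum>j\<in>UNIV. (D j (mollify h (v i)) x)\<^sup>2) = (1 / h\<^sup>2) * (\<Sum>i\<in>UNIV. \<Sum>j\<in>UNIV. (kern_deriv_avg h j (v i) x)\<^sup>2)"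
    by (simp only: 1 sum_distrib_left)
  show ?thesis unfolding errsq_def 6 using 3 4 5 by (simp add: distrib_right)
qed

lemma errsq_weighted:
  assumes U: "morrey U K (2 * a)" "\<And>x. norm x \<ge> r \<Longrightarrow> U x = 0"
    and h: "0 < h" "h \<le> 1" and K: "K \<ge> 0" and a: "0 \<le> a" "a < 1"
    and C: "\<And>y::real^'n. \<bar>kern y\<bar> \<le> C" "\<And>j y::real^'n. \<bar>D j kern y\<bar> \<le> C"
  shows "weighted_int U (errsq h) \<le>
     ennreal (C\<^sup>2 * unit_vol TYPE('n) / (1 - a)\<^sup>2 * K * (8 * (real CARD('n))\<^sup>2)) *
      (ennreal (h powr (- 2 - 2 * a)) * ball_int (vsq v) ((r + h))
      + ennreal (h powr (2 - 2 * a)) * ball_int (gradsq v) ((r + h)))"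
proof -
  have mU [measurable]: "U \<in> borel_measurable borel" using U(1) by (simp add: morrey_def)
  let ?n = "real CARD('n)"
  have n: "?n \<ge> 1" by (simp add: Suc_leI)
  define B where "B = C\<^sup>2 * unit_vol TYPE('n) / (1 - a)\<^sup>2 * K * h powr (- (2 * a))"
  define I where "I = (\<lambda>f::real^'n \<Rightarrow> real. \<integral>\<^sup>+x. ennreal ((f x)\<^sup>2) * indicator (ball 0 (r + h)) x \<partial>lborel)"
  define X where "X = ball_int (vsq v) ((r + h))"
  define Y where "Y = ball_int (gradsq v) ((r + h))"
  have B0: "B \<ge> 0" unfolding B_def using K unit_vol_pos[where 'n='n] by simp
  have cv: "continuous_on UNIV (v i)" for i by (rule C_k_continuous[OF v])
  have cd: "continuous_on UNIV (D j (v i))" for i j by (rule C_k_continuous[OF C_k_partial_deriv_v])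
  have sumI: "(\<Sum>i\<in>UNIV. I (v i)) = X" "(\<Sum>i\<in>UNIV. \<Sum>j\<in>UNIV. I (D j (v i))) = Y"
  proof -
    let ?J = "\<lambda>x. indicator (ball 0 (r + h)) x :: ennreal"
    have "X = weighted_int ?J (\<lambda>x. \<Sum>i\<in>UNIV. (v i x)\<^sup>2)" by (simp add: X_def vsq_def mult.commute)
    also have "\<dots> = (\<Sum>i\<in>UNIV. I (v i))" by (subst weight_sum) (auto simp: I_def mult.commute)
    finally show "(\<Sum>i\<in>UNIV. I (v i)) = X" by simp
    have "Y = weighted_int ?J (\<lambda>x. \<Sum>i\<in>UNIV. \<Sum>j\<in>UNIV. (D j (v i) x)\<^sup>2)" by (simp add: Y_def gradsq_def mult.commute)
    also have "\<dots> = (\<Sum>i\<in>UNIV. \<integral>\<^sup>+x. ?J x * ennreal (\<Sum>j\<in>UNIV. (D j (v i) x)\<^sup>2) \<partial>lborel)"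
      by (rule weight_sum) (auto intro: sum_nonneg)
    also have "\<dots> = (\<Sum>i\<in>UNIV. \<Sum>j\<in>UNIV. I (D j (v i)))" by (subst weight_sum) (auto simp: I_def mult.commute)
    finally show "(\<Sum>i\<in>UNIV. \<Sum>j\<in>UNIV. I (D j (v i))) = Y" by simp
  qed
  have k1: "C_k (Suc 0) (kern :: real^'n \<Rightarrow> real)" using C_k_kern by simp
  have kz: "D j kern y = 0" if "norm y \<ge> 1" for j and y :: "real^'n"
  proof -
    have "C_k 1 (bump 4 1 :: real^'n \<Rightarrow> real)" by (rule C_k_bump) simp
    then have "C_k (Suc 0) (bump 4 1 :: real^'n \<Rightarrow> real)" by simp
    then show ?thesis
      unfolding kern_eq_cmult using partial_deriv_bump4_bounds(3)[of 1 y j] that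
      by (subst partial_deriv_cmult) (auto intro: C_k_Suc_differentiable simp del: C_k.simps)
  qed
  have a1: "1 \<le> 1 / (1 - a)\<^sup>2"
  proof -
    have "(1 - a)\<^sup>2 \<le> 1\<^sup>2" using a by (intro power_mono) auto
    then show ?thesis using a by simp
  qed
  have weak: "ennreal (C\<^sup>2 * unit_vol TYPE('n) * K * h powr (- (2 * a))) \<le> ennreal B"
  proof (rule ennreal_leI)
    have "(C\<^sup>2 * unit_vol TYPE('n) * K * h powr (- (2 * a))) * 1 \<le> (C\<^sup>2 * unit_vol TYPE('n) * K * h powr (- (2 * a))) * (1 / (1 - a)\<^sup>2)"
      using K unit_vol_pos[where 'n='n] by (intro mult_left_mono a1) simp
    then show "C\<^sup>2 * unit_vol TYPE('n) * K * h powr (- (2 * a)) \<le> B" by (simp add: B_def)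
  qed
  have S: "weighted_int U (\<lambda>x. (mollify h (v i) x)\<^sup>2) \<le> ennreal B * I (v i)" for i
    unfolding mollify_def I_def
    by (rule order_trans[OF morrey_avg[OF U cv h K continuous_on_kern kern_outside C(1)] mult_right_mono[OF weak]]) auto
  have D: "weighted_int U (\<lambda>x. (kern_deriv_avg h j (v i) x)\<^sup>2) \<le> ennreal B * I (v i)" for i j
    unfolding I_def
    by (rule order_trans[OF morrey_avg[OF U cv h K C_k_continuous[OF C_k_SucD[OF k1]] kz C(2)] mult_right_mono[OF weak]]) auto
  have P: "weighted_int U (\<lambda>x. (pot h k f x)\<^sup>2) \<le> ennreal B * I f" if "continuous_on UNIV f" for k f
    unfolding I_def B_def by (rule morrey_pot[OF U that h K a C(1)])
  have "weighted_int U (errsq h) \<le> weighted_int U (\<lambda>x. (\<Sum>i\<in>UNIV. (mollify h (v i) x)\<^sup>2)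
    + ((1 / h\<^sup>2) * (\<Sum>i\<in>UNIV. \<Sum>j\<in>UNIV. (kern_deriv_avg h j (v i) x)\<^sup>2)
    + ((4 * h\<^sup>2) * (\<Sum>i\<in>UNIV. \<Sum>k\<in>UNIV. (pot h k (v i) x)\<^sup>2)
    + ((?n + 4) * h\<^sup>2) * (\<Sum>i\<in>UNIV. \<Sum>k\<in>UNIV. \<Sum>j\<in>UNIV. (pot h k (D j (v i)) x)\<^sup>2))))"
    by (intro nn_integral_mono mult_left_mono ennreal_leI errsq_le h) simp
  also have "\<dots> = (\<Sum>i\<in>UNIV. \<integral>\<^sup>+x. U x * ennreal ((mollify h (v i) x)\<^sup>2) \<partial>lborel)
    + (ennreal (1 / h\<^sup>2) * (\<Sum>i\<in>UNIV. \<Sum>j\<in>UNIV. \<integral>\<^sup>+x. U x * ennreal ((kern_deriv_avg h j (v i) x)\<^sup>2) \<partial>lborel)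
    + (ennreal (4 * h\<^sup>2) * (\<Sum>i\<in>UNIV. \<Sum>k\<in>UNIV. \<integral>\<^sup>+x. U x * ennreal ((pot h k (v i) x)\<^sup>2) \<partial>lborel)
    + ennreal ((?n + 4) * h\<^sup>2) * (\<Sum>i\<in>UNIV. \<Sum>k\<in>UNIV. \<Sum>j\<in>UNIV. \<integral>\<^sup>+x. U x * ennreal ((pot h k (D j (v i)) x)\<^sup>2) \<partial>lborel)))"
  proof (subst weight_combination)
    have s2: "weighted_int U (\<lambda>x. \<Sum>i\<in>UNIV. \<Sum>j\<in>UNIV. f i j x) = (\<Sum>i\<in>UNIV. \<Sum>j\<in>UNIV. \<integral>\<^sup>+x. U x * ennreal (f i j x) \<partial>lborel)"
      if "\<And>i j. f i j \<in> borel_measurable borel" "\<And>i j x. f i j x \<ge> 0" for f :: "'n \<Rightarrow> 'n \<Rightarrow> real^'n \<Rightarrow> real"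
      using that by (subst weight_sum) (auto intro!: sum.cong weight_sum sum_nonneg)
    have s3: "weighted_int U (\<lambda>x. \<Sum>i\<in>UNIV. \<Sum>k\<in>UNIV. \<Sum>j\<in>UNIV. f i k j x) = (\<Sum>i\<in>UNIV. \<Sum>k\<in>UNIV. \<Sum>j\<in>UNIV. \<integral>\<^sup>+x. U x * ennreal (f i k j x) \<partial>lborel)"
      if "\<And>i k j. f i k j \<in> borel_measurable borel" "\<And>i k j x. f i k j x \<ge> 0" for f :: "'n \<Rightarrow> 'n \<Rightarrow> 'n \<Rightarrow> real^'n \<Rightarrow> real"
      using that by (subst weight_sum) (auto intro!: sum.cong s2 sum_nonneg)
    show "weighted_int U (\<lambda>x. \<Sum>i\<in>UNIV. (mollify h (v i) x)\<^sup>2)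
    + (ennreal (1 / h\<^sup>2) * weighted_int U (\<lambda>x. \<Sum>i\<in>UNIV. \<Sum>j\<in>UNIV. (kern_deriv_avg h j (v i) x)\<^sup>2)
    + (ennreal (4 * h\<^sup>2) * weighted_int U (\<lambda>x. \<Sum>i\<in>UNIV. \<Sum>k\<in>UNIV. (pot h k (v i) x)\<^sup>2)
    + ennreal ((?n + 4) * h\<^sup>2) * weighted_int U (\<lambda>x. \<Sum>i\<in>UNIV. \<Sum>k\<in>UNIV. \<Sum>j\<in>UNIV. (pot h k (D j (v i)) x)\<^sup>2)))
    = (\<Sum>i\<in>UNIV. \<integral>\<^sup>+x. U x * ennreal ((mollify h (v i) x)\<^sup>2) \<partial>lborel)
    + (ennreal (1 / h\<^sup>2) * (\<Sum>i\<in>UNIV. \<Sum>j\<in>UNIV. \<integral>\<^sup>+x. U x * ennreal ((kern_deriv_avg h j (v i) x)\<^sup>2) \<partial>lborel)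
    + (ennreal (4 * h\<^sup>2) * (\<Sum>i\<in>UNIV. \<Sum>k\<in>UNIV. \<integral>\<^sup>+x. U x * ennreal ((pot h k (v i) x)\<^sup>2) \<partial>lborel)
    + ennreal ((?n + 4) * h\<^sup>2) * (\<Sum>i\<in>UNIV. \<Sum>k\<in>UNIV. \<Sum>j\<in>UNIV. \<integral>\<^sup>+x. U x * ennreal ((pot h k (D j (v i)) x)\<^sup>2) \<partial>lborel)))"
      by (subst s3, (simp; fail), (simp; fail), subst s2, (simp; fail), (simp; fail), subst s2, (simp; fail), (simp; fail),
          subst weight_sum, simp_all)
  qed (use h in \<open>auto intro!: sum_nonneg\<close>)
  also have "\<dots> \<le> (\<Sum>i\<in>UNIV. ennreal B * I (v i))
    + (ennreal (1 / h\<^sup>2) * (\<Sum>i\<in>UNIV. \<Sum>j\<in>(UNIV::'n set). ennreal B * I (v i))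
    + (ennreal (4 * h\<^sup>2) * (\<Sum>i\<in>UNIV. \<Sum>k\<in>(UNIV::'n set). ennreal B * I (v i))
    + ennreal ((?n + 4) * h\<^sup>2) * (\<Sum>i\<in>UNIV. \<Sum>k\<in>(UNIV::'n set). \<Sum>j\<in>UNIV. ennreal B * I (D j (v i)))))"
    by (intro add_mono mult_left_mono sum_mono S D P cv cd) auto
  also have "\<dots> = ennreal B * X + (ennreal (1 / h\<^sup>2) * (ennreal ?n * (ennreal B * X)) + (ennreal (4 * h\<^sup>2) * (ennreal ?n * (ennreal B * X))
     + ennreal ((?n + 4) * h\<^sup>2) * (ennreal ?n * (ennreal B * Y))))"
  proof -
    have "(\<Sum>i\<in>UNIV. \<Sum>k\<in>(UNIV::'n set). \<Sum>j\<in>UNIV. ennreal B * I (D j (v i))) = of_nat CARD('n) * (ennreal B * Y)"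
      by (simp add: sum_distrib_left[symmetric] sumI)
    moreover have "(\<Sum>i\<in>UNIV. \<Sum>k\<in>(UNIV::'n set). ennreal B * I (v i)) = of_nat CARD('n) * (ennreal B * X)"
      by (simp add: sum_distrib_left[symmetric] sumI)
    moreover have "(\<Sum>i\<in>UNIV. ennreal B * I (v i)) = ennreal B * X"
      by (simp add: sum_distrib_left[symmetric] sumI)
    ultimately show ?thesis by (simp add: ennreal_of_nat_eq_real_of_nat)
  qed
  also have "\<dots> = ennreal (B * (1 + ?n / h\<^sup>2 + 4 * h\<^sup>2 * ?n)) * X + ennreal (B * ((?n + 4) * ?n * h\<^sup>2)) * Y"
    using B0 h by (simp add: ennreal_mult ennreal_plus distrib_right distrib_left ac_simps divide_inverse)
  also have "\<dots> \<le> ennreal (B * (8 * ?n\<^sup>2 / h\<^sup>2)) * X + ennreal (B * (8 * ?n\<^sup>2 * h\<^sup>2)) * Y"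
  proof (intro add_mono mult_right_mono ennreal_leI mult_left_mono B0)
    have h2: "h\<^sup>2 \<le> 1" "h\<^sup>2 > 0" using h by (auto simp: power_le_one)
    have n2: "?n \<le> ?n\<^sup>2" "1 \<le> ?n\<^sup>2" using n by (auto simp: power2_eq_square intro: mult_left_mono[of 1 ?n ?n, simplified] order_trans[OF n])
    have "1 \<le> ?n\<^sup>2 / h\<^sup>2" using h2 order_trans[OF h2(1) n2(2)] by (simp add: le_divide_eq)
    moreover have "?n / h\<^sup>2 \<le> ?n\<^sup>2 / h\<^sup>2" using n2 h2 by (intro divide_right_mono) auto
    moreover have "h\<^sup>2 * ?n \<le> ?n\<^sup>2 / h\<^sup>2"
    proof -
      have "h\<^sup>2 * ?n \<le> ?n\<^sup>2" using mult_mono[of "h\<^sup>2" 1 ?n "?n\<^sup>2"] h2 n2 n by simp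
      also have "\<dots> \<le> ?n\<^sup>2 / h\<^sup>2" using h2 n2 by (simp add: le_divide_eq mult_left_le)
      finally show ?thesis .
    qed
    moreover have "0 \<le> ?n\<^sup>2 / h\<^sup>2" by simp
    moreover have "8 * ?n\<^sup>2 / h\<^sup>2 = 8 * (?n\<^sup>2 / h\<^sup>2)" "4 * h\<^sup>2 * ?n = 4 * (h\<^sup>2 * ?n)" by auto
    ultimately show "1 + ?n / h\<^sup>2 + 4 * h\<^sup>2 * ?n \<le> 8 * ?n\<^sup>2 / h\<^sup>2" by linarith
    show "(?n + 4) * ?n \<le> 8 * ?n\<^sup>2"
    proof -
      have "(?n + 4) * ?n = ?n\<^sup>2 + 4 * ?n" by (simp add: distrib_right power2_eq_square)
      moreover have "0 \<le> ?n\<^sup>2" by simp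
      ultimately show ?thesis using n2(1) by linarith
    qed
  qed auto
  also have "B * (8 * ?n\<^sup>2 / h\<^sup>2) = (C\<^sup>2 * unit_vol TYPE('n) / (1 - a)\<^sup>2 * K * (8 * ?n\<^sup>2)) * h powr (- 2 - 2 * a)"
  proof -
    have "h powr (- 2 - 2 * a) = h powr (- (2 * a)) / h\<^sup>2"
      using h by (simp add: powr_diff powr_minus powr_numeral field_simps)
    then show ?thesis by (simp add: B_def)
  qed
  also have "B * (8 * ?n\<^sup>2 * h\<^sup>2) = (C\<^sup>2 * unit_vol TYPE('n) / (1 - a)\<^sup>2 * K * (8 * ?n\<^sup>2)) * h powr (2 - 2 * a)"
  proof -
    have "h powr (2 - 2 * a) = h powr (- (2 * a)) * h\<^sup>2"
      using h by (simp add: powr_diff powr_minus powr_numeral field_simps)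
    then show ?thesis by (simp add: B_def)
  qed
  finally have le: "weighted_int U (errsq h) \<le>
      ennreal ((C\<^sup>2 * unit_vol TYPE('n) / (1 - a)\<^sup>2 * K * (8 * ?n\<^sup>2)) * h powr (- 2 - 2 * a)) * X
      + ennreal ((C\<^sup>2 * unit_vol TYPE('n) / (1 - a)\<^sup>2 * K * (8 * ?n\<^sup>2)) * h powr (2 - 2 * a)) * Y" .
  have "0 \<le> C\<^sup>2 * unit_vol TYPE('n) / (1 - a)\<^sup>2 * K * (8 * ?n\<^sup>2)"
    using K unit_vol_pos[where 'n='n] by simp
  then have e: "ennreal ((C\<^sup>2 * unit_vol TYPE('n) / (1 - a)\<^sup>2 * K * (8 * ?n\<^sup>2)) * p) =
      ennreal (C\<^sup>2 * unit_vol TYPE('n) / (1 - a)\<^sup>2 * K * (8 * ?n\<^sup>2)) * ennreal p" for p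
    by (rule ennreal_mult')
  show ?thesis
    using le unfolding X_def[symmetric] Y_def[symmetric] e distrib_left mult.assoc[of "ennreal _"] .
qed

text \<open>\<open>errsq_weighted\<close> is used twice: with weight \<open>1\<close> and exponent \<open>0\<close> for the term \<open>errsq / h\<close>, and with the drift as
  weight. The condition \<open>a \<ge> 1/2\<close> makes \<open>2 - 2a \<le> 1\<close>, so that the factor \<open>h\<close> of the viscous terms is dominated
  by the factor \<open>h\<^sup>2\<^sup>-\<^sup>2\<^sup>a\<close> of the drift.\<close>

lemma energy_integrated:
  assumes W: "morrey (\<lambda>x. ennreal (W x) * indicator (ball 0 r0) x) K (2 * a)" "\<And>x j. \<bar>u j x\<bar> \<le> W x" "W \<in> borel_measurable borel"
    and K: "K \<ge> 0" and a: "1 / 2 \<le> a" "a < 1" and h: "0 < h" "h \<le> 1" and r: "1 \<le> r" "r \<le> r0"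
    and C: "\<And>y::real^'n. \<bar>kern y\<bar> \<le> C" "\<And>j y::real^'n. \<bar>D j kern y\<bar> \<le> C"
  shows "(\<integral>\<^sup>+x. ennreal (bump 4 r x * gradsq v x) \<partial>lborel) \<le>
    ennreal (1 + energy_const TYPE('n) * (C\<^sup>2 * unit_vol TYPE('n) * (8 * (real CARD('n))\<^sup>2) / (1 - a)\<^sup>2 * (unit_vol TYPE('n) + K))) *
     (ennreal (h powr (2 - 2 * a)) * ball_int (gradsq v) ((r + h))
      + ennreal (h powr (-4)) * ball_int (vsq v) ((r + h)))"
proof -
  note [measurable] = W(3)
  let ?n = "real CARD('n)" and ?V = "unit_vol TYPE('n)"
  define X where "X = ball_int (vsq v) ((r + h))"
  define Y where "Y = ball_int (gradsq v) ((r + h))"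
  define Z where "Z = ennreal (h powr (2 - 2 * a)) * Y + ennreal (h powr (-4)) * X"
  define B where "B = C\<^sup>2 * ?V * (8 * ?n\<^sup>2)"
  have V: "?V > 0" by (rule unit_vol_pos)
  have B: "B \<ge> 0" using V by (simp add: B_def)
  have energy_const_nonneg: "energy_const TYPE('n) \<ge> 0" by (simp add: energy_const_def err_const_def)
  let ?J = "\<lambda>x::real^'n. indicator (ball 0 r) x :: ennreal"
  have W0: "W x \<ge> 0" for x using W(2)[of undefined x] by linarith
  have ge0: "gradsq v x \<ge> 0" "vsq v x \<ge> 0" for x by (auto simp: gradsq_def vsq_def intro!: sum_nonneg)
  have mono: "h powr p \<le> h powr q" if "q \<le> p" for p q using that h by (intro powr_mono') auto
  have "(\<integral>\<^sup>+x. ennreal (bump 4 r x * gradsq v x) \<partial>lborel) \<le>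
     (\<integral>\<^sup>+x. ennreal ((h * gradsq v x + energy_const TYPE('n) * (1 / h + W x) * errsq h x) * indicator (ball 0 r) x) \<partial>lborel)"
  proof (rule nn_integral_le_divergence[where P="\<lambda>j x. (-1) * flux h r j x" and r = r])
    show "C_k 1 (\<lambda>x. (-1) * flux h r j x)" for j by (rule C_k_cmult[OF C_k_flux])
    show "(-1) * flux h r j x = 0" if "norm x > r" for j x using flux_outside[OF that] r by simp
    show "continuous_on UNIV (\<lambda>x. bump 4 r x * gradsq v x)"
      unfolding gradsq_def
      by (intro continuous_intros C_k_continuous[OF C_k_partial_deriv_v] C_k_continuous[OF C_k_bump[of 0]]) simp
    show "bump 4 r x * gradsq v x = 0" if "norm x > r" for x using that r by (simp add: bump_outside)
    show "bump 4 r x * gradsq v x \<ge> 0" for x by (simp add: bump_nonneg ge0)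
    show "bump 4 r x * gradsq v x \<le> (h * gradsq v x + energy_const TYPE('n) * (1 / h + W x) * errsq h x) * indicator (ball 0 r) x
        + (\<Sum>j\<in>UNIV. D j (\<lambda>x. (-1) * flux h r j x) x)" for x
      by (rule energy_inequality[OF r(1) h(1) W(2)])
  qed
  also have "\<dots> = (\<integral>\<^sup>+x. ennreal h * (?J x * ennreal (gradsq v x)) + (ennreal (energy_const TYPE('n) / h) * (?J x * ennreal (errsq h x))
      + ennreal (energy_const TYPE('n)) * ((ennreal (W x) * ?J x) * ennreal (errsq h x))) \<partial>lborel)"
  proof (rule nn_integral_cong)
    fix x
    show "ennreal ((h * gradsq v x + energy_const TYPE('n) * (1 / h + W x) * errsq h x) * indicator (ball 0 r) x) =
      ennreal h * (?J x * ennreal (gradsq v x)) + (ennreal (energy_const TYPE('n) / h) * (?J x * ennreal (errsq h x))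
      + ennreal (energy_const TYPE('n)) * ((ennreal (W x) * ?J x) * ennreal (errsq h x)))"
    proof (cases "x \<in> ball 0 r")
      case True
      have "(h * gradsq v x + energy_const TYPE('n) * (1 / h + W x) * errsq h x) = h * gradsq v x + (energy_const TYPE('n) / h * errsq h x + energy_const TYPE('n) * (W x * errsq h x))"
        by (simp add: algebra_simps)
      then show ?thesis using True energy_const_nonneg h W0 ge0 errsq_bounds(6)
        by (simp add: ennreal_plus ennreal_mult del: times_divide_eq_left times_divide_eq_right)
    next
      case False
      then show ?thesis by simp
    qed
  qed
  also have "\<dots> = ennreal h * weighted_int ?J (gradsq v) + (ennreal (energy_const TYPE('n) / h) * weighted_int ?J (errsq h)
      + ennreal (energy_const TYPE('n)) * weighted_int (\<lambda>x. ennreal (W x) * ?J x) (errsq h))"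
    by (simp add: nn_integral_add nn_integral_cmult)
  also have "\<dots> \<le> Z + (ennreal (energy_const TYPE('n) * (B / (1 - a)\<^sup>2 * ?V)) * Z + ennreal (energy_const TYPE('n) * (B / (1 - a)\<^sup>2 * K)) * Z)"
  proof (intro add_mono)
    have "ennreal h * weighted_int ?J (gradsq v) \<le> ennreal (h powr (2 - 2 * a)) * Y"
    proof (rule mult_mono)
      show "ennreal h \<le> ennreal (h powr (2 - 2 * a))" using mono[of "2 - 2 * a" 1] a h by (intro ennreal_leI) simp
      show "weighted_int ?J (gradsq v) \<le> Y"
        unfolding Y_def using h by (intro nn_integral_mono) (auto simp: indicator_def)
    qed auto
    also have "\<dots> \<le> Z" by (simp add: Z_def)
    finally show "ennreal h * weighted_int ?J (gradsq v) \<le> Z" .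
    have "morrey ?J ?V (2 * 0)"
      unfolding mult_zero_right by (rule morrey_mono[OF morrey_one]) (auto split: split_indicator)
    then have "weighted_int ?J (errsq h) \<le>
      ennreal (C\<^sup>2 * ?V / (1 - 0)\<^sup>2 * ?V * (8 * ?n\<^sup>2)) * (ennreal (h powr (- 2 - 2 * 0)) * X + ennreal (h powr (2 - 2 * 0)) * Y)"
      unfolding X_def Y_def using V h C by (intro errsq_weighted) auto
    also have "C\<^sup>2 * ?V / (1 - 0)\<^sup>2 * ?V * (8 * ?n\<^sup>2) = B * ?V" by (simp add: B_def)
    finally have 1: "weighted_int ?J (errsq h) \<le> ennreal (B * ?V) * (ennreal (h powr (-2)) * X + ennreal (h powr 2) * Y)" by simp
    have "ennreal (energy_const TYPE('n) / h) * weighted_int ?J (errsq h) \<le>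
       ennreal (energy_const TYPE('n) / h) * (ennreal (B * ?V) * (ennreal (h powr (-2)) * X + ennreal (h powr 2) * Y))"
      by (rule mult_left_mono[OF 1]) simp
    also have "\<dots> = ennreal (energy_const TYPE('n) * (B * ?V)) * (ennreal (1 / h * h powr (-2)) * X + ennreal (1 / h * h powr 2) * Y)"
    proof -
      have "ennreal (energy_const TYPE('n) / h) = ennreal (energy_const TYPE('n)) * ennreal (1 / h)"
        using energy_const_nonneg h by (simp add: ennreal_mult'[symmetric])
      then show ?thesis using energy_const_nonneg h B V by (simp only: ennreal_mult' zero_le_divide_1_iff less_imp_le distrib_left ac_simps)
    qed
    also have "\<dots> \<le> ennreal (energy_const TYPE('n) * (B / (1 - a)\<^sup>2 * ?V)) * (ennreal (h powr (-4)) * X + ennreal (h powr (2 - 2 * a)) * Y)"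
    proof (rule mult_mono)
      have "B \<le> B / (1 - a)\<^sup>2"
      proof -
        have "(1 - a)\<^sup>2 \<le> 1\<^sup>2" using a by (intro power_mono) auto
        then show ?thesis using a B by (simp add: le_divide_eq mult_left_le)
      qed
      then show "ennreal (energy_const TYPE('n) * (B * ?V)) \<le> ennreal (energy_const TYPE('n) * (B / (1 - a)\<^sup>2 * ?V))"
        using energy_const_nonneg V by (intro ennreal_leI mult_left_mono mult_right_mono) auto
      have "1 / h * h powr (-2) = h powr (-3)" using h by (simp add: powr_minus powr_numeral divide_simps power_numeral_reduce)
      then have 1: "1 / h * h powr (-2) \<le> h powr (-4)" using mono[of "-4" "-3"] by simp
      have "1 / h * h powr 2 = h powr 1" using h by (simp add: powr_numeral power2_eq_square)
      then have 2: "1 / h * h powr 2 \<le> h powr (2 - 2 * a)" using mono[of "2 - 2 * a" 1] a by simp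
      show "ennreal (1 / h * h powr (-2)) * X + ennreal (1 / h * h powr 2) * Y \<le> ennreal (h powr (-4)) * X + ennreal (h powr (2 - 2 * a)) * Y"
        using 1 2 by (intro add_mono mult_right_mono ennreal_leI) auto
    qed auto
    also have "\<dots> = ennreal (energy_const TYPE('n) * (B / (1 - a)\<^sup>2 * ?V)) * Z" by (simp add: Z_def add.commute)
    finally show "ennreal (energy_const TYPE('n) / h) * weighted_int ?J (errsq h) \<le> ennreal (energy_const TYPE('n) * (B / (1 - a)\<^sup>2 * ?V)) * Z" .
    have "morrey (\<lambda>x. ennreal (W x) * ?J x) K (2 * a)"
      by (rule morrey_mono[OF W(1)]) (use r in \<open>auto simp: indicator_def\<close>)
    then have "weighted_int (\<lambda>x. ennreal (W x) * ?J x) (errsq h) \<le>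
      ennreal (C\<^sup>2 * ?V / (1 - a)\<^sup>2 * K * (8 * ?n\<^sup>2)) * (ennreal (h powr (- 2 - 2 * a)) * X + ennreal (h powr (2 - 2 * a)) * Y)"
      unfolding X_def Y_def using K h C a by (intro errsq_weighted) auto
    also have "C\<^sup>2 * ?V / (1 - a)\<^sup>2 * K * (8 * ?n\<^sup>2) = B / (1 - a)\<^sup>2 * K" by (simp add: B_def)
    also have "ennreal (B / (1 - a)\<^sup>2 * K) * (ennreal (h powr (- 2 - 2 * a)) * X + ennreal (h powr (2 - 2 * a)) * Y) \<le>
       ennreal (B / (1 - a)\<^sup>2 * K) * (ennreal (h powr (-4)) * X + ennreal (h powr (2 - 2 * a)) * Y)"
      using a by (intro mult_left_mono add_mono mult_right_mono ennreal_leI mono) auto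
    also have "\<dots> = ennreal (B / (1 - a)\<^sup>2 * K) * Z" by (simp add: Z_def add.commute)
    finally have 2: "weighted_int (\<lambda>x. ennreal (W x) * ?J x) (errsq h) \<le> ennreal (B / (1 - a)\<^sup>2 * K) * Z" .
    have "ennreal (energy_const TYPE('n)) * weighted_int (\<lambda>x. ennreal (W x) * ?J x) (errsq h) \<le> ennreal (energy_const TYPE('n)) * (ennreal (B / (1 - a)\<^sup>2 * K) * Z)"
      by (rule mult_left_mono[OF 2]) simp
    also have "\<dots> = ennreal (energy_const TYPE('n) * (B / (1 - a)\<^sup>2 * K)) * Z" 
      using energy_const_nonneg B K by (simp only: ennreal_mult' mult.assoc)
    finally show "ennreal (energy_const TYPE('n)) * weighted_int (\<lambda>x. ennreal (W x) * ?J x) (errsq h) \<le> ennreal (energy_const TYPE('n) * (B / (1 - a)\<^sup>2 * K)) * Z" .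
  qed
  also have "\<dots> = ennreal (1 + (energy_const TYPE('n) * (B / (1 - a)\<^sup>2 * ?V) + energy_const TYPE('n) * (B / (1 - a)\<^sup>2 * K))) * Z"
  proof -
    have "0 \<le> energy_const TYPE('n) * (B / (1 - a)\<^sup>2 * ?V)" "0 \<le> energy_const TYPE('n) * (B / (1 - a)\<^sup>2 * K)" using energy_const_nonneg B V K by auto
    then show ?thesis by (simp add: ennreal_plus distrib_right)
  qed
  also have "1 + (energy_const TYPE('n) * (B / (1 - a)\<^sup>2 * ?V) + energy_const TYPE('n) * (B / (1 - a)\<^sup>2 * K)) = 1 + energy_const TYPE('n) * (C\<^sup>2 * ?V * (8 * ?n\<^sup>2) / (1 - a)\<^sup>2 * (?V + K))"
    by (simp add: B_def distrib_left)
  finally show ?thesis unfolding Z_def X_def Y_def .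
qed

end

text \<open>Take the supremum of \<open>(2 - r)\<^sup>N f r\<close> and choose \<open>s\<close> halfway between \<open>r\<close> and \<open>2\<close>: the weight
  changes by \<open>2\<^sup>N\<close>, so the factor \<open>1 / 2\<^sup>N\<^sup>+\<^sup>1\<close> leaves half of the supremum, which is absorbed.\<close>

lemma hole_filling_iteration:
  fixes f :: "real \<Rightarrow> real" and N :: nat
  assumes nn: "\<And>r. 1 \<le> r \<Longrightarrow> r < 2 \<Longrightarrow> 0 \<le> f r" and bd: "\<And>r. 1 \<le> r \<Longrightarrow> r < 2 \<Longrightarrow> f r \<le> F"
    and step: "\<And>r s. 1 \<le> r \<Longrightarrow> r < s \<Longrightarrow> s < 2 \<Longrightarrow> f r \<le> 1 / 2 ^ (N + 1) * f s + X / (s - r) ^ N"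
  shows "f 1 \<le> 2 ^ (N + 1) * X"
proof -
  define g where "g = (\<lambda>r. (2 - r) ^ N * f r)"
  have "g r \<le> F" if "1 \<le> r" "r < 2" for r
  proof -
    have "(2 - r) ^ N * f r \<le> 1 * f r" using that nn by (intro mult_right_mono power_le_one) auto
    then show ?thesis using bd[OF that] by (simp add: g_def)
  qed
  then have bdd: "bdd_above (g ` {1..<2})" by (intro bdd_aboveI[of _ F]) auto
  define S where "S = Sup (g ` {1..<2})"
  have le: "g r \<le> S" if "1 \<le> r" "r < 2" for r
    unfolding S_def using that by (intro cSup_upper bdd) auto
  have "S \<le> S / 2 + 2 ^ N * X"
    unfolding S_def
  proof (rule cSup_least, simp)
    fix y assume "y \<in> g ` {1..<2}"
    then obtain r where r: "1 \<le> r" "r < 2" "y = g r" by auto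
    define s where "s = (r + 2) / 2"
    have s: "r < s" "s < 2" "1 \<le> s" using r by (auto simp: s_def field_simps)
    have e: "2 - r = 2 * (2 - s)" "2 - r = 2 * (s - r)" by (simp_all add: s_def field_simps)
    have "g r \<le> (2 - r) ^ N * (1 / 2 ^ (N + 1) * f s + X / (s - r) ^ N)"
      unfolding g_def using r s by (intro mult_left_mono step) auto
    also have "\<dots> = ((2 - r) ^ N / 2 ^ (N + 1)) * f s + ((2 - r) ^ N / (s - r) ^ N) * X"
      by (simp add: algebra_simps)
    also have "(2 - r) ^ N / 2 ^ (N + 1) = (2 - s) ^ N / 2"
      by (simp only: e(1) power_mult_distrib) simp
    also have "(2 - r) ^ N / (s - r) ^ N = 2 ^ N"
      using s by (simp only: e(2) power_mult_distrib) simp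
    also have "(2 - s) ^ N / 2 * f s + 2 ^ N * X = g s / 2 + 2 ^ N * X" by (simp add: g_def)
    also have "\<dots> \<le> S / 2 + 2 ^ N * X" using le[OF s(3,2)] by simp
    finally show "y \<le> Sup (g ` {1..<2}) / 2 + 2 ^ N * X" unfolding S_def r(3) .
  qed
  then have "S \<le> 2 ^ (N + 1) * X" by simp
  moreover have "f 1 \<le> S" using le[of 1] by (simp add: g_def)
  ultimately show ?thesis by simp
qed

lemma continuous_on_vsq: "(\<And>i. C_k 0 (v i)) \<Longrightarrow> continuous_on UNIV (vsq v)"
  unfolding vsq_def[abs_def] by (auto intro!: continuous_intros)

lemma continuous_on_gradsq: "(\<And>i. C_k 1 (v i)) \<Longrightarrow> continuous_on UNIV (gradsq v)"
  unfolding gradsq_def[abs_def] by (auto intro!: continuous_intros)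

lemma vsq_nonneg: "vsq v x \<ge> 0" and gradsq_nonneg: "gradsq v x \<ge> 0"
  by (auto simp: vsq_def gradsq_def intro!: sum_nonneg)

lemma nn_integral_ball_finite:
  fixes f :: "real^'n::finite \<Rightarrow> real"
  assumes "continuous_on UNIV f"
  shows "ball_int f r < \<infinity>"
proof -
  have "compact (f ` cball 0 r)"
    by (intro compact_continuous_image continuous_on_subset[OF assms]) auto
  then obtain B where B: "\<And>y. y \<in> f ` cball 0 r \<Longrightarrow> norm y \<le> B"
    using compact_imp_bounded bounded_iff by metis
  have "ball_int f r \<le> (\<integral>\<^sup>+x. ennreal B * indicator (ball (0::real^'n) r) x \<partial>lborel)"
  proof (rule nn_integral_mono)
    fix x :: "real^'n"
    show "ennreal (f x) * indicator (ball 0 r) x \<le> ennreal B * indicator (ball 0 r) x"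
    proof (cases "x \<in> ball 0 r")
      case True
      then have "norm (f x) \<le> B" by (intro B) auto
      then show ?thesis using True by (auto intro: ennreal_leI)
    qed simp
  qed
  also have "\<dots> = ennreal B * emeasure lborel (ball (0::real^'n) r)"
    by (simp add: nn_integral_cmult)
  also have "\<dots> < \<infinity>"
    using emeasure_lborel_ball_finite[of "0::real^'n" r] by (simp add: ennreal_mult_less_top)
  finally show ?thesis .
qed

text \<open>For radii at distance \<open>d\<close> the cut-off function is at least \<open>(d / 4)\<^sup>4\<close> on the smaller ball. Choosing \<open>h\<close> as a
  sufficiently high power of a small multiple of \<open>d\<close> beats this loss and produces the small factor required by
  \<open>hole_filling_iteration\<close>, at the price of a high negative power of \<open>d\<close> in front of \<open>\<integral>\<bar>v\<bar>\<^sup>2\<close>. The constant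
  must not depend on \<open>u\<close> and \<open>v\<close>, since the lemma is applied to every rescaling of one solution.\<close>

lemma caccioppoli_unit:
  assumes K: "K \<ge> 0" and a: "1 / 2 \<le> a" "a < 1"
  shows "\<exists>C>0. \<forall>u v W. drift_system u v \<longrightarrow> morrey (\<lambda>x::real^'n::finite. ennreal (W x) * indicator (ball 0 2) x) K (2 * a) \<longrightarrow>
     (\<forall>x j. \<bar>u j x\<bar> \<le> W x) \<longrightarrow> W \<in> borel_measurable borel \<longrightarrow>
     (ball_int (gradsq v) 1) \<le> ennreal C * ball_int (vsq v) 2"
proof -
  obtain c where c: "\<And>y::real^'n. \<bar>kern y\<bar> \<le> c" "\<And>j y::real^'n. \<bar>D j kern y\<bar> \<le> c"
    using kern_bounds[where 'n='n] by metis
  define M where "M = 1 + energy_const TYPE('n) * (c\<^sup>2 * unit_vol TYPE('n) * (8 * (real CARD('n))\<^sup>2) / (1 - a)\<^sup>2 * (unit_vol TYPE('n) + K))"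
  have M: "M \<ge> 1"
    using K unit_vol_pos[where 'n='n] by (simp add: M_def energy_const_def err_const_def)
  define b where "b = 2 - 2 * a"
  have b: "b > 0" using a by (simp add: b_def)
  \<comment> \<open>\<open>h = (k d)\<^sup>m\<close> will satisfy \<open>h\<^sup>b \<le> (k d)\<^sup>4\<close>.\<close>
  define m where "m = nat \<lceil>4 / b\<rceil>"
  have mb: "real m * b \<ge> 4"
  proof -
    have "4 / b \<le> real m" unfolding m_def by linarith
    then show ?thesis using b by (simp add: field_simps)
  qed
  have m1: "m \<ge> 1" using mb by (cases m) auto
  define N where "N = 4 * m + 4"
  \<comment> \<open>The factor \<open>256 k\<^sup>4\<close> below comes from \<open>(4 / d)\<^sup>4 (k d)\<^sup>4\<close>.\<close>
  define k where "k = min (1 / 2) (1 / (256 * M * 2 ^ (N + 1)))"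
  have k: "0 < k" "k \<le> 1 / 2" "k \<le> 1 / (256 * M * 2 ^ (N + 1))" using M by (auto simp: k_def)
  have k4: "256 * M * k ^ 4 \<le> 1 / 2 ^ (N + 1)"
  proof -
    have "k ^ 4 \<le> k ^ 1" using k by (intro power_decreasing) auto
    then have "k ^ 4 \<le> 1 / (256 * M * 2 ^ (N + 1))" using k by simp
    then show ?thesis using M by (simp add: field_simps)
  qed
  define C where "C = 2 ^ (N + 1) * (256 * M / k ^ (4 * m))"
  have C: "C > 0" using M k by (simp add: C_def)
  show ?thesis
  proof (intro exI[of _ C] conjI C allI impI)
    fix u v :: "'n \<Rightarrow> real^'n \<Rightarrow> real" and W
    assume ds: "drift_system u v" and W: "morrey (\<lambda>x. ennreal (W x) * indicator (ball 0 2) x) K (2 * a)"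
      "\<forall>x j. \<bar>u j x\<bar> \<le> W x" "W \<in> borel_measurable borel"
    interpret drift_system u v by (rule ds)
    define Y where "Y = (\<lambda>r. \<integral>\<^sup>+x. ennreal (gradsq v x) * indicator (ball 0 r) x \<partial>lborel)"
    define X where "X = (\<lambda>r. \<integral>\<^sup>+x. ennreal (vsq v x) * indicator (ball 0 r) x \<partial>lborel)"
    have Yfin: "Y r < \<infinity>" for r unfolding Y_def by (intro nn_integral_ball_finite continuous_on_gradsq v)
    have Xfin: "X r < \<infinity>" for r unfolding X_def by (intro nn_integral_ball_finite continuous_on_vsq v)
    have Ymono: "Y r \<le> Y s" if "r \<le> s" for r s
      unfolding Y_def using that by (intro nn_integral_mono) (auto simp: indicator_def)
    have Xmono: "X r \<le> X s" if "r \<le> s" for r s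
      unfolding X_def using that by (intro nn_integral_mono) (auto simp: indicator_def)
    define f where "f = (\<lambda>r. enn2real (Y r))"
    define x where "x = enn2real (X 2)"
    have Yf: "Y r = ennreal (f r)" for r using Yfin[of r] by (simp add: f_def less_top)
    have Xx: "X 2 = ennreal x" using Xfin[of 2] by (simp add: x_def less_top)
    have f0: "f r \<ge> 0" for r by (simp add: f_def)
    have x0: "x \<ge> 0" by (simp add: x_def)
    have "f 1 \<le> 2 ^ (N + 1) * (256 * M / k ^ (4 * m) * x)"
    proof (rule hole_filling_iteration)
      show "f r \<le> f 2" if "r < 2" for r
        using Ymono[of r 2] that by (simp add: Yf f0)
      show "0 \<le> f r" for r by (rule f0)
      fix r s :: real assume r: "1 \<le> r" "r < s" "s < 2"
      define d where "d = s - r"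
      have d: "0 < d" "d \<le> 1" using r by (auto simp: d_def)
      define h where "h = (k * d) ^ m"
      have kd: "0 < k * d" "k * d \<le> 1" "k * d \<le> d / 2" using k d by (auto intro: mult_le_one)
      have h0: "h > 0" using kd by (simp add: h_def)
      have "h \<le> (k * d) ^ 1" unfolding h_def using kd m1 by (intro power_decreasing) auto
      then have h: "0 < h" "h \<le> 1" "h \<le> d / 2" using kd h0 by auto
      define r' where "r' = r + d / 2"
      have r': "1 \<le> r'" "r' \<le> 2" "r' + h \<le> s" using r d h by (auto simp: r'_def d_def field_simps)
      have hb: "h powr b \<le> (k * d) ^ 4"
      proof -
        have "h powr b = (k * d) powr (real m * b)" unfolding h_def using kd by (simp add: powr_realpow[symmetric] powr_powr)
        also have "\<dots> \<le> (k * d) powr 4" using kd mb by (intro powr_mono') auto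
        finally show ?thesis using kd by (simp add: powr_numeral)
      qed
      have h4: "h powr (-4) = 1 / (k ^ (4 * m) * d ^ (4 * m))"
      proof -
        have "h ^ 4 = (k * d) ^ (4 * m)" unfolding h_def by (simp only: power_mult[symmetric] mult.commute[of m])
        moreover have "h powr (-4) = inverse (h powr 4)" by (rule powr_minus)
        moreover have "h powr 4 = h ^ 4" using powr_realpow[OF h0, of 4] by simp
        ultimately show ?thesis by (simp only: power_mult_distrib inverse_eq_divide)
      qed
      have "ennreal ((d / 4) ^ 4) * Y r \<le> (\<integral>\<^sup>+x. ennreal (bump 4 r' x * gradsq v x) \<partial>lborel)"
      proof -
        have "ennreal ((d / 4) ^ 4) * Y r = (\<integral>\<^sup>+x. ennreal ((d / 4) ^ 4) * (ennreal (gradsq v x) * indicator (ball 0 r) x) \<partial>lborel)"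
          unfolding Y_def by (rule nn_integral_cmult[symmetric]) measurable
        also have "\<dots> \<le> (\<integral>\<^sup>+x. ennreal (bump 4 r' x * gradsq v x) \<partial>lborel)"
        proof (rule nn_integral_mono)
          fix x :: "real^'n"
          show "ennreal ((d / 4) ^ 4) * (ennreal (gradsq v x) * indicator (ball 0 r) x) \<le> ennreal (bump 4 r' x * gradsq v x)"
          proof (cases "norm x < r")
            case True
            have "d / 4 \<le> (r' - r) / r'"
            proof -
              have "(d / 2) / 2 \<le> (d / 2) / r'" using r' d by (intro divide_left_mono) auto
              then show ?thesis by (simp add: r'_def)
            qed
            then have "(d / 4) ^ 4 \<le> ((r' - r) / r') ^ 4" using d by (intro power_mono) auto
            also have "\<dots> \<le> bump 4 r' x" using True d by (intro bump_inside) (auto simp: r'_def)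
            finally have "(d / 4) ^ 4 * gradsq v x \<le> bump 4 r' x * gradsq v x"
              by (rule mult_right_mono) (rule gradsq_nonneg)
            moreover have "0 \<le> (d / 4) ^ 4" using d by simp
            ultimately show ?thesis using True by (simp add: ennreal_mult'[symmetric] ennreal_leI)
          qed simp
        qed
        finally show ?thesis .
      qed
      also have "\<dots> \<le> ennreal M * (ennreal (h powr b) * Y (r' + h) + ennreal (h powr (-4)) * X (r' + h))"
        unfolding M_def b_def X_def Y_def using W r'(2) by (intro energy_integrated K a h r'(1) c) auto
      also have "\<dots> \<le> ennreal M * (ennreal ((k * d) ^ 4) * Y s + ennreal (1 / (k ^ (4 * m) * d ^ (4 * m))) * X 2)"
        unfolding h4[symmetric] using r' r
        by (intro mult_left_mono add_mono mult_mono ennreal_leI hb Ymono Xmono) auto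
      also have "\<dots> = ennreal (M * ((k * d) ^ 4 * f s + 1 / (k ^ (4 * m) * d ^ (4 * m)) * x))"
      proof -
        have "0 \<le> (k * d) ^ 4" "0 \<le> 1 / (k ^ (4 * m) * d ^ (4 * m))" using kd k d by auto
        then show ?thesis using M f0 x0
          by (simp add: Yf Xx ennreal_mult[symmetric] ennreal_plus[symmetric] del: times_divide_eq_left times_divide_eq_right ennreal_plus)
      qed
      also have "ennreal ((d / 4) ^ 4) * Y r = ennreal ((d / 4) ^ 4 * f r)"
        using d f0 by (simp add: Yf ennreal_mult'[symmetric])
      finally have "(d / 4) ^ 4 * f r \<le> M * ((k * d) ^ 4 * f s + 1 / (k ^ (4 * m) * d ^ (4 * m)) * x)"
        using M f0 x0 k d by (subst (asm) ennreal_le_iff) auto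
      then have "(4 / d) ^ 4 * ((d / 4) ^ 4 * f r) \<le> (4 / d) ^ 4 * (M * ((k * d) ^ 4 * f s + 1 / (k ^ (4 * m) * d ^ (4 * m)) * x))"
        using d by (intro mult_left_mono) auto
      also have "(4 / d) ^ 4 * ((d / 4) ^ 4 * f r) = f r"
      proof -
        have "(4 / d) ^ 4 * (d / 4) ^ 4 = 1" using d by (simp add: power_mult_distrib[symmetric])
        then show ?thesis by (simp add: mult.assoc[symmetric])
      qed
      also have "(4 / d) ^ 4 * (M * ((k * d) ^ 4 * f s + 1 / (k ^ (4 * m) * d ^ (4 * m)) * x)) =
         (256 * M * k ^ 4) * f s + (256 * M / k ^ (4 * m) * x) / d ^ N"
        using d k by (simp add: N_def power_add power_divide power_mult_distrib field_simps)
      also have "\<dots> \<le> 1 / 2 ^ (N + 1) * f s + (256 * M / k ^ (4 * m) * x) / d ^ N"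
        by (intro add_right_mono mult_right_mono k4 f0)
      finally show "f r \<le> 1 / 2 ^ (N + 1) * f s + 256 * M / k ^ (4 * m) * x / (s - r) ^ N"
        by (simp add: d_def)
    qed
    then have "f 1 \<le> C * x" by (simp add: C_def mult.assoc)
    then have "Y 1 \<le> ennreal C * X 2"
      using C x0 by (simp add: Yf Xx ennreal_mult'[symmetric] ennreal_leI)
    then show "ball_int (gradsq v) 1 \<le> ennreal C * ball_int (vsq v) 2"
      unfolding X_def Y_def .
  qed
qed

section \<open>Consequences of the scale-invariant bounds\<close>

lemma ennreal_rpow_ennreal: "a \<ge> 0 \<Longrightarrow> ennreal_rpow (ennreal a) r = ennreal (a powr r)"
  by (simp add: ennreal_rpow_def)

lemma weak_Leb_norm_superlevel:
  fixes u :: "real^'n::finite \<Rightarrow> real^'m::finite"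
  assumes u: "continuous_on UNIV u" and q: "q > 0" and M: "M \<ge> 0" and R: "R > 0" and l: "l > 0"
    and le: "ennreal (R powr (1 - 3 / q)) * weak_Leb_norm q (ball 0 R) u \<le> ennreal M"
  shows "emeasure lborel {x \<in> ball 0 R. norm (u x) > l} \<le> ennreal ((M * R powr (3 / q - 1) / l) powr q)"
proof -
  let ?S = "{x \<in> ball 0 R. norm (u x) > l}"
  have "open {x. norm (u x) > l}"
    by (intro open_Collect_less continuous_on_norm u continuous_on_const)
  then have "open (ball 0 R \<inter> {x. norm (u x) > l})" by (intro open_Int open_ball)
  moreover have "ball 0 R \<inter> {x. norm (u x) > l} = ?S" by auto
  ultimately have op: "?S \<in> sets borel" using borel_open by metis
  have "emeasure lborel ?S \<le> emeasure lborel (ball (0::real^'n) R)" by (rule emeasure_mono) auto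
  also have "\<dots> < \<infinity>" by (rule emeasure_lborel_ball_finite)
  finally have fin: "emeasure lborel ?S = ennreal (measure lborel ?S)"
    by (intro emeasure_eq_ennreal_measure) (simp add: less_top)
  let ?m = "measure lborel ?S"
  have "ennreal (R powr (1 - 3 / q)) * (ennreal l * ennreal (?m powr (1 / q))) \<le> ennreal (R powr (1 - 3 / q)) * weak_Leb_norm q (ball 0 R) u"
  proof (rule mult_left_mono)
    have "ennreal l * ennreal_rpow (emeasure lebesgue ?S) (1 / q) \<le> weak_Leb_norm q (ball 0 R) u"
      unfolding weak_Leb_norm_def by (rule SUP_upper) (use l in simp)
    moreover have "emeasure lebesgue ?S = ennreal ?m" using op fin by simp
    ultimately show "ennreal l * ennreal (?m powr (1 / q)) \<le> weak_Leb_norm q (ball 0 R) u"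
      by (simp add: ennreal_rpow_ennreal)
  qed simp
  also note le
  finally have "R powr (1 - 3 / q) * (l * ?m powr (1 / q)) \<le> M"
    using M l by (simp add: ennreal_mult[symmetric])
  then have "R powr (3 / q - 1) * (R powr (1 - 3 / q) * (l * ?m powr (1 / q))) \<le> R powr (3 / q - 1) * M"
    by (rule mult_left_mono) simp
  moreover have "R powr (3 / q - 1) * (R powr (1 - 3 / q) * T) = T" for T
    using R by (simp add: mult.assoc[symmetric] powr_add[symmetric])
  ultimately have "l * ?m powr (1 / q) \<le> R powr (3 / q - 1) * M" by (simp only:)
  then have "?m powr (1 / q) \<le> M * R powr (3 / q - 1) / l" using l by (simp add: field_simps)
  then have "(?m powr (1 / q)) powr q \<le> (M * R powr (3 / q - 1) / l) powr q"
    using q by (intro powr_mono2) auto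
  moreover have "(?m powr (1 / q)) powr q = ?m" using q by (simp add: powr_powr)
  ultimately show ?thesis unfolding fin by (intro ennreal_leI) simp
qed

text \<open>Cut the layer-cake integral at height \<open>L\<close>: below, count the whole unit ball; above, use the
  superlevel bound.\<close>

lemma layer_cake_unit_ball:
  fixes g :: "real^'n::finite \<Rightarrow> real"
  assumes g [measurable]: "g \<in> borel_measurable borel" and q: "q > 1" and L: "L > 0" and A: "A \<ge> 0"
    and lev: "\<And>l. l > 0 \<Longrightarrow> emeasure lborel {y \<in> ball 0 1. g y > l} \<le> ennreal (A * l powr (-q))"
  shows "ball_int g 1 \<le> ennreal (L * unit_vol TYPE('n) + A * L powr (1 - q) / (q - 1))"
proof -
  \<comment> \<open>The region below the graph of \<open>g\<close> and above the height \<open>L\<close>.\<close>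
  define H where "H = (\<lambda>l (y::real^'n). if L \<le> l \<and> l < g y \<and> y \<in> ball 0 1 then 1 else 0 :: ennreal)"
  have [measurable]: "(\<lambda>(l, y). H l y) \<in> borel_measurable (borel \<Otimes>\<^sub>M borel)"
    unfolding H_def by measurable
  have [measurable]: "(\<lambda>(y, l). H l y) \<in> borel_measurable (borel \<Otimes>\<^sub>M borel)"
    unfolding H_def by measurable
  have "ball_int g 1 \<le>
    (\<integral>\<^sup>+y. ennreal L * indicator (ball 0 1) y + (\<integral>\<^sup>+l. H l y \<partial>lborel) \<partial>lborel)"
  proof (rule nn_integral_mono)
    fix y :: "real^'n"
    show "ennreal (g y) * indicator (ball 0 1) y \<le> ennreal L * indicator (ball 0 1) y + (\<integral>\<^sup>+l. H l y \<partial>lborel)"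
    proof (cases "y \<in> ball 0 1")
      case True
      have "(\<integral>\<^sup>+l. H l y \<partial>lborel) = (\<integral>\<^sup>+l. indicator {L..<g y} l \<partial>lborel)"
        using True by (intro nn_integral_cong) (auto simp: indicator_def H_def)
      also have "\<dots> = emeasure lborel {L..<g y}" by simp
      also have "\<dots> = ennreal (g y - L)" by (cases "L \<le> g y") (auto simp: ennreal_neg)
      finally have e: "(\<integral>\<^sup>+l. H l y \<partial>lborel) = ennreal (g y - L)" .
      have "ennreal (g y) \<le> ennreal L + ennreal (g y - L)"
      proof (cases "L \<le> g y")
        case True
        then show ?thesis using L by (simp add: ennreal_plus[symmetric] del: ennreal_plus)
      next
        case False
        then have "ennreal (g y) \<le> ennreal L" by (intro ennreal_leI) simp
        then show ?thesis by (simp add: add_increasing2)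
      qed
      then show ?thesis unfolding e using True by simp
    qed simp
  qed
  also have "\<dots> = ennreal L * ennreal (unit_vol TYPE('n)) + (\<integral>\<^sup>+y. (\<integral>\<^sup>+l. H l y \<partial>lborel) \<partial>lborel)"
    by (subst nn_integral_add) (simp_all add: nn_integral_cmult nn_integral_indicator_unit_ball del: nn_integral_indicator)
  also have "(\<integral>\<^sup>+y. (\<integral>\<^sup>+l. H l y \<partial>lborel) \<partial>lborel) = (\<integral>\<^sup>+l. (\<integral>\<^sup>+y. H l y \<partial>lborel) \<partial>lborel)"
    by (rule lborel_pair.Fubini') simp
  also have "\<dots> \<le> (\<integral>\<^sup>+l. ennreal (A * (l powr (-q) * indicator {L..} l)) \<partial>lborel)"
  proof (rule nn_integral_mono)
    fix l :: real
    have "(\<integral>\<^sup>+y. H l y \<partial>lborel) = indicator {L..} l * emeasure lborel {y \<in> ball 0 1. g y > l}"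
    proof -
      have "(\<lambda>y. H l y) = (\<lambda>y. (indicator {L..} l :: ennreal) * indicator {y \<in> ball 0 1. g y > l} y)"
        by (auto simp: indicator_def H_def fun_eq_iff)
      then show ?thesis by (simp add: nn_integral_cmult)
    qed
    also have "\<dots> \<le> ennreal (A * (l powr (-q) * indicator {L..} l))"
      using lev[of l] L by (cases "l \<ge> L") auto
    finally show "(\<integral>\<^sup>+y. H l y \<partial>lborel) \<le> ennreal (A * (l powr (-q) * indicator {L..} l))" .
  qed
  also have "\<dots> = ennreal A * ennreal (L powr (1 - q) / (q - 1))"
  proof -
    have "((\<lambda>l. l powr (-q)) has_integral -(L powr (-q + 1)) / (-q + 1)) {L..}"
      using q L by (intro has_integral_powr_to_inf) auto
    then have "((\<lambda>l. l powr (-q) * indicator {L..} l) has_integral -(L powr (-q + 1)) / (-q + 1)) UNIV"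
    proof -
      have "(\<lambda>l. l powr (-q) * indicator {L..} l) = (\<lambda>l. if l \<in> {L..} then l powr (-q) else 0)"
        by (auto simp: indicator_def fun_eq_iff)
      then show ?thesis using \<open>(_ has_integral _) {L..}\<close> by (simp only: has_integral_restrict_UNIV)
    qed
    then have "(\<integral>\<^sup>+l. ennreal (l powr (-q) * indicator {L..} l) \<partial>lborel) = ennreal (-(L powr (-q + 1)) / (-q + 1))"
      by (rule nn_integral_has_integral_lborel[rotated 2]) auto
    also have "-(L powr (-q + 1)) / (-q + 1) = L powr (1 - q) / (q - 1)"
      using q by (simp add: field_simps)
    finally show ?thesis
      using A by (simp add: ennreal_mult nn_integral_cmult)
  qed
  finally have "ball_int g 1 \<le> ennreal L * ennreal (unit_vol TYPE('n)) + ennreal A * ennreal (L powr (1 - q) / (q - 1))"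
    by (simp add: add_left_mono)
  also have "\<dots> = ennreal (L * unit_vol TYPE('n) + A * L powr (1 - q) / (q - 1))"
    using L A q unit_vol_pos[where 'n='n] by (simp add: ennreal_mult'[symmetric] ennreal_plus[symmetric] del: ennreal_plus)
  finally show ?thesis .
qed

lemma affine_vimage_borel:
  fixes b :: "'a::euclidean_space"
  assumes "S \<in> sets borel"
  shows "{y. b + c *\<^sub>R y \<in> S} \<in> sets borel"
proof -
  have "(\<lambda>y. b + c *\<^sub>R y) \<in> borel_measurable borel" by measurable
  from measurable_sets[OF this assms] show ?thesis by (simp add: vimage_def)
qed

lemma emeasure_lborel_affine_vimage:
  fixes b :: "'a::euclidean_space"
  assumes "S \<in> sets borel" "c > 0"
  shows "ennreal (c ^ DIM('a)) * emeasure lborel {y. b + c *\<^sub>R y \<in> S} = emeasure lborel S"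
proof -
  note m = affine_vimage_borel[OF assms(1), of b c]
  have "(\<lambda>y. indicator S (b + c *\<^sub>R y) :: ennreal) = indicator {y. b + c *\<^sub>R y \<in> S}"
    by (auto simp: indicator_def)
  then show ?thesis
    using nn_integral_lborel_affine[of "indicator S" c b] assms m by simp
qed

text \<open>The cut at height \<open>s\<^sup>-\<^sup>3\<^sup>/\<^sup>q\<close> balances the two parts of \<open>layer_cake_unit_ball\<close>. The powers of \<open>R\<close> cancel, which
  is the scale invariance of the condition on \<open>u\<close>.\<close>

lemma weak_norm_morrey:
  fixes u :: "real^3 \<Rightarrow> real^3"
  assumes u: "continuous_on UNIV u" and q: "3 / 2 < q" and M: "M \<ge> 0"
    and le: "\<And>R. R > 0 \<Longrightarrow> ennreal (R powr (1 - 3 / q)) * weak_Leb_norm q (ball 0 R) u \<le> ennreal M"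
    and R: "R > 0"
  shows "morrey (\<lambda>x. ennreal (R * norm (u (R *\<^sub>R x))) * indicator (ball 0 2) x)
     (unit_vol TYPE(3) + M powr q * 2 powr (3 - q) / (q - 1)) (3 / q)"
  unfolding morrey_def
proof (intro conjI allI impI)
  have cu: "continuous_on UNIV (\<lambda>x. R * norm (u (R *\<^sub>R x)))"
    by (intro continuous_intros continuous_on_compose2[OF u]) auto
  then have [measurable]: "(\<lambda>x. R * norm (u (R *\<^sub>R x))) \<in> borel_measurable borel"
    by (rule borel_measurable_continuous_onI)
  show "(\<lambda>x. ennreal (R * norm (u (R *\<^sub>R x))) * indicator (ball 0 2) x) \<in> borel_measurable borel" by measurable
  fix z :: "real^3" and s :: real assume s': "0 < s \<and> s \<le> 1"
  then have s: "0 < s" by simp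
  define g where "g = (\<lambda>y. R * norm (u (R *\<^sub>R (z + s *\<^sub>R y))) * indicator (ball 0 2) (z + s *\<^sub>R y))"
  have [measurable]: "g \<in> borel_measurable borel"
  proof -
    have "(\<lambda>x. R * norm (u (R *\<^sub>R x)) * indicator (ball 0 2) x) \<in> borel_measurable borel" by measurable
    then have "(\<lambda>y. (\<lambda>x. R * norm (u (R *\<^sub>R x)) * indicator (ball 0 2) x) (z + s *\<^sub>R y)) \<in> borel_measurable borel"
      by (rule measurable_compose[rotated]) simp
    then show ?thesis by (simp add: g_def)
  qed
  let ?A = "s powr (-3) * (M powr q * 2 powr (3 - q))"
  have "ball_int g 1 \<le>
     ennreal (s powr (- (3 / q)) * unit_vol TYPE(3) + ?A * (s powr (- (3 / q))) powr (1 - q) / (q - 1))"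
  proof (rule layer_cake_unit_ball)
    fix l :: real assume l: "l > 0"
    let ?E = "{x \<in> ball 0 (2 * R). norm (u x) > l / R}"
    have "open {x. norm (u x) > l / R}"
      by (intro open_Collect_less continuous_on_norm u continuous_on_const)
    then have "open (ball 0 (2 * R) \<inter> {x. norm (u x) > l / R})" by (intro open_Int open_ball)
    moreover have "ball 0 (2 * R) \<inter> {x. norm (u x) > l / R} = ?E" by auto
    ultimately have E: "?E \<in> sets borel" using borel_open by metis
    have sub: "{y \<in> ball 0 1. g y > l} \<subseteq> {y. R *\<^sub>R z + (R * s) *\<^sub>R y \<in> ?E}"
    proof
      fix y assume "y \<in> {y \<in> ball 0 1. g y > l}"
      then have gy: "g y > l" by simp
      then have in2: "norm (z + s *\<^sub>R y) < 2" using l by (cases "norm (z + s *\<^sub>R y) < 2") (auto simp: g_def)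
      then have "l < R * norm (u (R *\<^sub>R (z + s *\<^sub>R y)))" using gy by (simp add: g_def)
      moreover have "norm (R *\<^sub>R (z + s *\<^sub>R y)) < 2 * R" using in2 R by simp
      ultimately show "y \<in> {y. R *\<^sub>R z + (R * s) *\<^sub>R y \<in> ?E}"
        using R by (simp add: scaleR_add_right field_simps)
    qed
    have "emeasure lborel {y \<in> ball 0 1. g y > l} \<le> emeasure lborel {y. R *\<^sub>R z + (R * s) *\<^sub>R y \<in> ?E}"
      using sub by (rule emeasure_mono) (simp only: sets_lborel affine_vimage_borel[OF E])
    also have "\<dots> = ennreal ((R * s) powr (-3)) * (ennreal ((R * s) ^ 3) * emeasure lborel {y. R *\<^sub>R z + (R * s) *\<^sub>R y \<in> ?E})"
    proof -
      have "(R * s) powr (-3) * (R * s) ^ 3 = 1"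
      proof -
        have "R * s > 0" using R s by simp
        then have "(R * s) powr 3 = (R * s) ^ 3" using powr_realpow[of "R * s" 3] by simp
        moreover have "(R * s) powr (-3) = inverse ((R * s) powr 3)" by (rule powr_minus)
        ultimately show ?thesis using R s by (simp only: left_inverse mult_eq_0_iff power_eq_0_iff less_imp_neq[symmetric]) simp
      qed
      then have "ennreal ((R * s) powr (-3)) * ennreal ((R * s) ^ 3) = 1"
        using R s by (simp add: ennreal_mult[symmetric])
      then show ?thesis by (simp add: mult.assoc[symmetric])
    qed
    also have "ennreal ((R * s) ^ 3) * emeasure lborel {y. R *\<^sub>R z + (R * s) *\<^sub>R y \<in> ?E} = emeasure lborel ?E"
      using emeasure_lborel_affine_vimage[OF E, of "R * s" "R *\<^sub>R z"] R s by simp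
    also have "\<dots> \<le> ennreal ((M * (2 * R) powr (3 / q - 1) / (l / R)) powr q)"
      by (rule weak_Leb_norm_superlevel[OF u]) (use q M R l le[of "2 * R"] in auto)
    also have "ennreal ((R * s) powr (-3)) * ennreal ((M * (2 * R) powr (3 / q - 1) / (l / R)) powr q) = ennreal (?A * l powr (-q))"
    proof -
      have "(M * (2 * R) powr (3 / q - 1) / (l / R)) powr q = M powr q * (2 * R) powr (3 - q) * R powr q * l powr (-q)"
      proof -
        have "M * (2 * R) powr (3 / q - 1) / (l / R) = M * (2 * R) powr (3 / q - 1) * R * inverse l" using R l by (simp add: field_simps)
        moreover have "((2 * R) powr (3 / q - 1)) powr q = (2 * R) powr (3 - q)" using q by (simp add: powr_powr left_diff_distrib)
        moreover have "inverse l powr q = l powr (-q)" using l by (simp add: powr_minus inverse_powr)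
        ultimately show ?thesis by (simp add: powr_mult)
      qed
      moreover have "(R * s) powr (-3) * (M powr q * (2 * R) powr (3 - q) * R powr q * l powr (-q)) = ?A * l powr (-q)"
      proof -
        have "R powr (-3) * R powr (3 - q) * R powr q = 1" using R by (simp add: powr_add[symmetric])
        moreover have "(R * s) powr (-3) * (M powr q * (2 * R) powr (3 - q) * R powr q * l powr (-q)) =
            (R powr (-3) * R powr (3 - q) * R powr q) * (?A * l powr (-q))"
          by (simp add: powr_mult ac_simps)
        ultimately show ?thesis by simp
      qed
      ultimately show ?thesis by (simp add: ennreal_mult[symmetric])
    qed
    finally show "emeasure lborel {y \<in> ball 0 1. g y > l} \<le> ennreal (?A * l powr (-q))"
      by (simp add: mult_left_mono)
  qed (use q s in auto)
  also have "s powr (- (3 / q)) * unit_vol TYPE(3) + ?A * (s powr (- (3 / q))) powr (1 - q) / (q - 1) =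
     (unit_vol TYPE(3) + M powr q * 2 powr (3 - q) / (q - 1)) * s powr (- (3 / q))"
  proof -
    have e: "- 3 + - (3 / q) * (1 - q) = - (3 / q)" using q by (simp add: field_simps)
    have "s powr (-3) * (s powr (- (3 / q))) powr (1 - q) = s powr (-3 + - (3 / q) * (1 - q))"
      by (simp only: powr_powr powr_add)
    then have "s powr (-3) * (s powr (- (3 / q))) powr (1 - q) = s powr (- (3 / q))" unfolding e .
    then have "?A * (s powr (- (3 / q))) powr (1 - q) = M powr q * 2 powr (3 - q) * s powr (- (3 / q))"
      by (simp add: ac_simps)
    then show ?thesis by (simp add: distrib_right)
  qed
  finally have main: "ball_int g 1 \<le>
     ennreal ((unit_vol TYPE(3) + M powr q * 2 powr (3 - q) / (q - 1)) * s powr (- (3 / q)))" .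
  have "(\<lambda>y. ennreal (R * norm (u (R *\<^sub>R (z + s *\<^sub>R y)))) * indicator (ball 0 2) (z + s *\<^sub>R y)) = (\<lambda>y. ennreal (g y))"
    by (auto simp: g_def indicator_def)
  with main show "(\<integral>\<^sup>+y. ennreal (R * norm (u (R *\<^sub>R (z + s *\<^sub>R y)))) * indicator (ball 0 2) (z + s *\<^sub>R y) * indicator (ball 0 1) y \<partial>lborel) \<le>
     ennreal ((unit_vol TYPE(3) + M powr q * 2 powr (3 - q) / (q - 1)) * s powr (- (3 / q)))"
    by metis
qed

lemma emeasure_ball_3: "R > 0 \<Longrightarrow> emeasure lborel (ball (0::real^3) R) = ennreal (R ^ 3 * unit_vol TYPE(3))"
proof -
  assume R: "R > 0"
  have "{y::real^3. 0 + R *\<^sub>R y \<in> ball 0 R} = ball 0 1" using R by auto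
  then have "emeasure lborel (ball (0::real^3) R) = ennreal (R ^ 3) * emeasure lborel (ball (0::real^3) 1)"
    using emeasure_lborel_affine_vimage[of "ball (0::real^3) R" R 0] R by simp
  also have "emeasure lborel (ball (0::real^3) 1) = ennreal (unit_vol TYPE(3))"
    using nn_integral_indicator_unit_ball[where 'n=3] by simp
  finally show ?thesis using R by (simp add: ennreal_mult')
qed

text \<open>Split at \<open>\<bar>v\<bar> = R powr (-1/2)\<close>, the height at which both halves have the same scaling.\<close>

lemma Leb_norm_square:
  fixes v :: "real^3 \<Rightarrow> real^3"
  assumes v: "continuous_on UNIV v" and s: "2 \<le> s" and N: "N \<ge> 0" and R: "R > 0"
    and le: "ennreal (R powr (1 / 2 - 3 / s)) * Leb_norm s (ball 0 R) v \<le> ennreal N"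
  shows "ball_int (\<lambda>x. (norm (v x))\<^sup>2) R \<le> ennreal ((unit_vol TYPE(3) + N powr s) * R\<^sup>2)"
proof -
  have [measurable]: "v \<in> borel_measurable borel" using v by (rule borel_measurable_continuous_onI)
  define I where "I = ball_int (\<lambda>x. norm (v x) powr s) R"
  have Leb: "Leb_norm s (ball 0 R) v = ennreal_rpow I (1 / s)"
    unfolding Leb_norm_def I_def by (subst nn_integral_completion) auto
  have Ifin: "I \<noteq> \<infinity>"
  proof
    assume "I = \<infinity>"
    then have "ennreal (R powr (1 / 2 - 3 / s)) * Leb_norm s (ball 0 R) v = \<infinity>"
      using R unfolding Leb by (simp add: ennreal_rpow_def ennreal_mult_top)
    with le show False by (simp add: top_unique)
  qed
  define i where "i = enn2real I"
  have I: "I = ennreal i" and i0: "i \<ge> 0" using Ifin by (auto simp: i_def less_top)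
  have "R powr (1 / 2 - 3 / s) * i powr (1 / s) \<le> N"
    using le N unfolding Leb I ennreal_rpow_ennreal[OF i0] by (simp add: ennreal_mult[symmetric])
  then have "(R powr (1 / 2 - 3 / s) * i powr (1 / s)) powr s \<le> N powr s"
    using s by (intro powr_mono2) auto
  moreover have "(R powr (1 / 2 - 3 / s) * i powr (1 / s)) powr s = R powr (s / 2 - 3) * i"
    using s i0 by (simp add: powr_mult powr_powr left_diff_distrib)
  ultimately have i: "R powr (s / 2 - 3) * i \<le> N powr s" by simp
  have pw: "(norm (v x))\<^sup>2 \<le> 1 / R + R powr (s / 2 - 1) * norm (v x) powr s" for x
  proof (cases "norm (v x) \<le> R powr (- 1 / 2)")
    case True
    have "(norm (v x))\<^sup>2 \<le> (R powr (- 1 / 2))\<^sup>2" using True by (intro power_mono) auto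
    also have "\<dots> = R powr (- 1)" by (simp add: power2_eq_square powr_add[symmetric])
    also have "\<dots> = inverse (R powr 1)" by (rule powr_minus)
    also have "\<dots> = 1 / R" using R by (simp add: divide_inverse)
    finally show ?thesis by (simp add: add_increasing2)
  next
    case False
    then have n: "norm (v x) > R powr (- 1 / 2)" by simp
    then have n0: "norm (v x) > 0" using powr_ge_zero[of R "-1/2"] by linarith
    have "(norm (v x))\<^sup>2 = norm (v x) powr (2 - s) * norm (v x) powr s"
      using n0 powr_realpow[OF n0, of 2] by (simp add: powr_add[symmetric])
    also have "norm (v x) powr (2 - s) \<le> (R powr (- 1 / 2)) powr (2 - s)"
      using n s R by (intro powr_mono2') auto
    also have "(R powr (- 1 / 2)) powr (2 - s) = R powr (s / 2 - 1)"
    proof -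
      have e: "- 1 / 2 * (2 - s) = s / 2 - 1" by (simp add: field_simps)
      show ?thesis by (simp only: powr_powr e)
    qed
    finally have "(norm (v x))\<^sup>2 \<le> R powr (s / 2 - 1) * norm (v x) powr s" by (simp add: mult_right_mono)
    then show ?thesis using R by (simp add: add_increasing)
  qed
  have "ball_int (\<lambda>x. (norm (v x))\<^sup>2) R \<le>
    (\<integral>\<^sup>+x. ennreal (1 / R) * indicator (ball 0 R) x + ennreal (R powr (s / 2 - 1)) * (ennreal (norm (v x) powr s) * indicator (ball 0 R) x) \<partial>lborel)"
  proof (rule nn_integral_mono)
    fix x
    have "ennreal ((norm (v x))\<^sup>2) \<le> ennreal (1 / R) + ennreal (R powr (s / 2 - 1)) * ennreal (norm (v x) powr s)"
      using ennreal_leI[OF pw[of x]] R by (simp add: ennreal_mult)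
    then show "ennreal ((norm (v x))\<^sup>2) * indicator (ball 0 R) x \<le> ennreal (1 / R) * indicator (ball 0 R) x + ennreal (R powr (s / 2 - 1)) * (ennreal (norm (v x) powr s) * indicator (ball 0 R) x)"
      by (auto simp: indicator_def)
  qed
  also have "\<dots> = ennreal (1 / R) * ennreal (R ^ 3 * unit_vol TYPE(3)) + ennreal (R powr (s / 2 - 1)) * I"
    unfolding I_def using R by (simp add: nn_integral_add nn_integral_cmult emeasure_ball_3)
  also have "\<dots> = ennreal (R\<^sup>2 * unit_vol TYPE(3) + R powr (s / 2 - 1) * i)"
    using R i0 unit_vol_pos[where 'n=3] unfolding I
    by (simp add: ennreal_mult[symmetric] ennreal_plus[symmetric] power2_eq_square power3_eq_cube del: ennreal_plus)
  also have "\<dots> \<le> ennreal ((unit_vol TYPE(3) + N powr s) * R\<^sup>2)"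
  proof (rule ennreal_leI)
    have "R powr (s / 2 - 1) * i = R\<^sup>2 * (R powr (s / 2 - 3) * i)"
    proof -
      have "R\<^sup>2 * R powr (s / 2 - 3) = R powr (s / 2 - 1)"
      proof -
        have "R\<^sup>2 = R powr 2" using powr_realpow[OF R, of 2] by simp
        then have "R\<^sup>2 * R powr (s / 2 - 3) = R powr (2 + (s / 2 - 3))" by (simp only: powr_add)
        also have "2 + (s / 2 - 3) = s / 2 - 1" by simp
        finally show ?thesis .
      qed
      then show ?thesis by (simp add: mult.assoc[symmetric])
    qed
    also have "\<dots> \<le> R\<^sup>2 * N powr s" by (rule mult_left_mono[OF i]) simp
    finally show "R\<^sup>2 * unit_vol TYPE(3) + R powr (s / 2 - 1) * i \<le> (unit_vol TYPE(3) + N powr s) * R\<^sup>2"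
      by (simp add: algebra_simps)
  qed
  finally show ?thesis .
qed

section \<open>A Hardy inequality\<close>

definition hardy_weight :: "real^'n::finite \<Rightarrow> real" where "hardy_weight x = inverse (1 + x \<bullet> x)"

lemma hardy_weight_pos: "hardy_weight x > 0"
  by (simp add: hardy_weight_def add_pos_nonneg)

lemma hardy_weight_bound: "(x \<bullet> x) * hardy_weight x \<le> 1"
  by (simp add: hardy_weight_def divide_inverse[symmetric] divide_le_eq add_pos_nonneg)

lemma has_derivative_hardy_weight: "(hardy_weight has_derivative (\<lambda>h. - (hardy_weight x * (2 * (x \<bullet> h)) * hardy_weight x))) (at (x::real^'n::finite))"
proof -
  have p: "1 + x \<bullet> x \<noteq> 0" using inner_ge_zero[of x] by linarith
  have "((\<lambda>x::real^'n. 1 + x \<bullet> x) has_derivative (\<lambda>h. 2 * (x \<bullet> h))) (at x)"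
    by (auto intro!: derivative_eq_intros simp: inner_commute)
  from Deriv.has_derivative_inverse[OF p this] show ?thesis by (simp add: hardy_weight_def[abs_def])
qed

lemma C_k_hardy_weight: "C_k 1 (hardy_weight :: real^'n::finite \<Rightarrow> real)"
  and has_partial_hardy_weight: "has_partial hardy_weight j (- (2 * x $ j * hardy_weight x * hardy_weight x)) (x :: real^'n)"
proof -
  have d: "hardy_weight differentiable (at x)" for x :: "real^'n"
    using has_derivative_hardy_weight unfolding differentiable_def by blast
  have p: "D j hardy_weight x = - (2 * x $ j * hardy_weight x * hardy_weight x)" for j and x :: "real^'n"
    by (subst partial_deriv_eqI[OF has_derivative_hardy_weight]) (simp add: inner_axis)
  show "has_partial hardy_weight j (- (2 * x $ j * hardy_weight x * hardy_weight x)) x" using d p by (simp add: has_partial_def)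
  have c: "continuous_on UNIV (hardy_weight :: real^'n \<Rightarrow> real)"
    using d by (intro differentiable_imp_continuous_on) (auto simp: differentiable_on_def)
  have "D j hardy_weight = (\<lambda>x::real^'n. - (2 * x $ j * hardy_weight x * hardy_weight x))" for j using p by blast
  then show "C_k 1 (hardy_weight :: real^'n \<Rightarrow> real)"
    using d by (auto simp: differentiable_on_def intro!: continuous_intros c)
qed

lemma C_k_vsq: "(\<And>i. C_k k (v i)) \<Longrightarrow> C_k k (vsq v)"
  unfolding vsq_def[abs_def] power2_eq_square by (intro C_k_sum C_k_mult) auto

lemma has_partial_vsq:
  assumes "\<And>i. C_k 1 (v i)"
  shows "has_partial (vsq v) j (\<Sum>i\<in>UNIV. 2 * v i x * D j (v i) x) x"
proof -
  have c: "C_k (Suc 0) (v i)" for i using assms[of i] by simp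
  have "has_partial (vsq v) j (\<Sum>i\<in>UNIV. D j (v i) x * v i x + v i x * D j (v i) x) x"
    unfolding vsq_def[abs_def] power2_eq_square by (intro has_partial_sum has_partial_mult has_partial_C_k[OF c] finite)
  moreover have "D j (v i) x * v i x + v i x * D j (v i) x = 2 * v i x * D j (v i) x" for i
    by simp
  ultimately show ?thesis by (simp only:)
qed

text \<open>The field \<open>X = x / (1 + \<bar>x\<bar>\<^sup>2)\<close> has divergence at least \<open>1 / (1 + \<bar>x\<bar>\<^sup>2)\<close> in three dimensions and satisfies
  \<open>\<bar>X\<bar>\<^sup>2 \<le> 1 / (1 + \<bar>x\<bar>\<^sup>2)\<close>; the claim follows from the divergence of \<open>2 \<psi> \<bar>v\<bar>\<^sup>2 X\<close> and Young's inequality.\<close>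

lemma hardy_pointwise:
  fixes v :: "3 \<Rightarrow> real^3 \<Rightarrow> real"
  assumes v: "\<And>i. C_k 1 (v i)" and r: "r > 0"
  shows "bump 4 r x * (vsq v x * hardy_weight x) \<le> (4 * gradsq v x + 16 / r\<^sup>2 * vsq v x) * indicator (ball 0 r) x
     + (\<Sum>j\<in>UNIV. D j (\<lambda>x. 2 * (bump 4 r x * (vsq v x * (x $ j * hardy_weight x)))) x)"
proof -
  let ?q = "vsq v x" and ?w = "hardy_weight x" and ?b = "bump 4 r x"
  let ?dq = "\<lambda>j. \<Sum>i\<in>UNIV. 2 * v i x * D j (v i) x"
  have "C_k 1 (bump 4 r :: real^3 \<Rightarrow> real)" by (rule C_k_bump) simp
  then have b1: "C_k (Suc 0) (bump 4 r :: real^3 \<Rightarrow> real)" by simp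
  have D1: "D j (bump 4 r) x = (- (8 / r\<^sup>2)) * (x $ j * bump 3 r x)" for j
    using partial_deriv_bump[of 3 j r] by simp
  have px: "has_partial (\<lambda>x::real^3. x $ j) j 1 x" for j
    by (simp add: has_partial_def differentiable_coordinate partial_deriv_coordinate)
  have pd: "D j (\<lambda>x. 2 * (bump 4 r x * (vsq v x * (x $ j * hardy_weight x)))) x =
      2 * (D j (bump 4 r) x * (?q * (x $ j * ?w)) + ?b * (?dq j * (x $ j * ?w) + ?q * (1 * ?w + x $ j * (- (2 * x $ j * ?w * ?w)))))" for j
    by (intro has_partialD has_partial_cmult has_partial_mult has_partial_C_k[OF b1] has_partial_vsq v px has_partial_hardy_weight)
  have xx: "(\<Sum>j\<in>UNIV. x $ j * x $ j) = x \<bullet> x" by (simp add: inner_vec_def)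
  have w: "?w > 0" "(x \<bullet> x) * ?w \<le> 1" by (rule hardy_weight_pos, rule hardy_weight_bound)
  have bn: "0 \<le> ?b" "?b \<le> 1" "0 \<le> bump 3 r x" "bump 3 r x \<le> 1"
    by (auto intro: bump_nonneg bump_le_1)
  have q0: "?q \<ge> 0" "gradsq v x \<ge> 0" by (rule vsq_nonneg, rule gradsq_nonneg)
  have sum: "(\<Sum>j\<in>UNIV. D j (\<lambda>x. 2 * (bump 4 r x * (vsq v x * (x $ j * hardy_weight x)))) x) =
     - (16 / r\<^sup>2) * (bump 3 r x * ?q * ((x \<bullet> x) * ?w)) + 2 * ?b * (\<Sum>j\<in>UNIV. ?dq j * (x $ j * ?w)) + 2 * ?b * ?q * ?w * (3 - 2 * ((x \<bullet> x) * ?w))"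
  proof -
    have "(\<Sum>j\<in>UNIV. 2 * (D j (bump 4 r) x * (?q * (x $ j * ?w)))) = - (16 / r\<^sup>2) * (bump 3 r x * ?q * ((x \<bullet> x) * ?w))"
    proof -
      have "(\<Sum>j\<in>UNIV. 2 * (D j (bump 4 r) x * (?q * (x $ j * ?w)))) = (\<Sum>j\<in>UNIV. (- (16 / r\<^sup>2) * (bump 3 r x * ?q * ?w)) * (x $ j * x $ j))"
        unfolding D1 by (intro sum.cong refl) (simp add: algebra_simps)
      also have "\<dots> = (- (16 / r\<^sup>2) * (bump 3 r x * ?q * ?w)) * (x \<bullet> x)" by (simp only: sum_distrib_left[symmetric] xx)
      finally show ?thesis by (simp add: ac_simps)
    qed
    moreover have "(\<Sum>j\<in>(UNIV::3 set). 2 * (?b * (?q * (1 * ?w + x $ j * (- (2 * x $ j * ?w * ?w)))))) = 2 * ?b * ?q * ?w * (3 - 2 * ((x \<bullet> x) * ?w))"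
    proof -
      have "(\<Sum>j\<in>(UNIV::3 set). 2 * (?b * (?q * (1 * ?w + x $ j * (- (2 * x $ j * ?w * ?w)))))) = (\<Sum>j\<in>(UNIV::3 set). 2 * ?b * ?q * ?w - (4 * ?b * ?q * ?w * ?w) * (x $ j * x $ j))"
        by (intro sum.cong refl) (simp add: algebra_simps)
      also have "\<dots> = 3 * (2 * ?b * ?q * ?w) - (4 * ?b * ?q * ?w * ?w) * (x \<bullet> x)"
        by (simp only: sum_subtractf sum_distrib_left[symmetric] xx) simp
      finally show ?thesis by (simp add: algebra_simps)
    qed
    moreover have "(\<Sum>j\<in>UNIV. 2 * (?b * (?dq j * (x $ j * ?w)))) = 2 * ?b * (\<Sum>j\<in>UNIV. ?dq j * (x $ j * ?w))"
      by (simp only: sum_distrib_left mult.assoc)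
    moreover have "(\<Sum>j\<in>UNIV. D j (\<lambda>x. 2 * (bump 4 r x * (vsq v x * (x $ j * hardy_weight x)))) x) =
      (\<Sum>j\<in>UNIV. 2 * (D j (bump 4 r) x * (?q * (x $ j * ?w)))) + (\<Sum>j\<in>UNIV. 2 * (?b * (?dq j * (x $ j * ?w))))
      + (\<Sum>j\<in>(UNIV::3 set). 2 * (?b * (?q * (1 * ?w + x $ j * (- (2 * x $ j * ?w * ?w))))))"
      unfolding pd sum.distrib[symmetric] by (intro sum.cong refl) (simp only: distrib_left)
    ultimately show ?thesis by (simp only:)
  qed
  have cross: "- (\<Sum>j\<in>UNIV. ?dq j * (x $ j * ?w)) \<le> 1 / 2 * (?q * ?w) + 2 * gradsq v x"
  proof -
    have "- (\<Sum>j\<in>UNIV. ?dq j * (x $ j * ?w)) = (\<Sum>j\<in>UNIV. \<Sum>i\<in>UNIV. - (2 * v i x * D j (v i) x * (x $ j * ?w)))"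
      by (simp add: sum_distrib_right sum_negf)
    also have "\<dots> \<le> (\<Sum>j\<in>UNIV. \<Sum>i\<in>UNIV. 1 / 2 * ((v i x)\<^sup>2 * (x $ j * ?w)\<^sup>2) + 2 * (D j (v i) x)\<^sup>2)"
    proof (intro sum_mono)
      fix i j
      have "0 \<le> (v i x * (x $ j * ?w) + 2 * D j (v i) x)\<^sup>2" by simp
      then show "- (2 * v i x * D j (v i) x * (x $ j * ?w)) \<le> 1 / 2 * ((v i x)\<^sup>2 * (x $ j * ?w)\<^sup>2) + 2 * (D j (v i) x)\<^sup>2"
        by (simp add: power2_eq_square algebra_simps)
    qed
    also have "\<dots> = 1 / 2 * (\<Sum>j\<in>UNIV. \<Sum>i\<in>UNIV. (v i x)\<^sup>2 * (x $ j * ?w)\<^sup>2) + 2 * (\<Sum>j\<in>UNIV. \<Sum>i\<in>UNIV. (D j (v i) x)\<^sup>2)"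
      by (simp only: sum.distrib sum_distrib_left)
    also have "(\<Sum>j\<in>UNIV. \<Sum>i\<in>UNIV. (D j (v i) x)\<^sup>2) = gradsq v x"
      unfolding gradsq_def by (rule sum.swap)
    also have "(\<Sum>j\<in>UNIV. \<Sum>i\<in>UNIV. (v i x)\<^sup>2 * (x $ j * ?w)\<^sup>2) = ?q * ((x \<bullet> x) * ?w) * ?w"
    proof -
      have "(\<Sum>j\<in>UNIV. \<Sum>i\<in>UNIV. (v i x)\<^sup>2 * (x $ j * ?w)\<^sup>2) = (\<Sum>j\<in>UNIV. ?q * ?w * ?w * (x $ j * x $ j))"
      proof (rule sum.cong[OF refl])
        fix j :: 3
        have "(\<Sum>i\<in>UNIV. (v i x)\<^sup>2 * (x $ j * ?w)\<^sup>2) = ?q * (x $ j * ?w)\<^sup>2"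
          unfolding vsq_def by (rule sum_distrib_right[symmetric])
        then show "(\<Sum>i\<in>UNIV. (v i x)\<^sup>2 * (x $ j * ?w)\<^sup>2) = ?q * ?w * ?w * (x $ j * x $ j)"
          by (simp add: power2_eq_square ac_simps)
      qed
      also have "\<dots> = ?q * ?w * ?w * (x \<bullet> x)" by (simp only: sum_distrib_left[symmetric] xx)
      finally show ?thesis by (simp add: ac_simps)
    qed
    also have "1 / 2 * (?q * ((x \<bullet> x) * ?w) * ?w) \<le> 1 / 2 * (?q * 1 * ?w)"
      using q0 w by (intro mult_left_mono mult_right_mono) auto
    finally show ?thesis by simp
  qed
  show ?thesis
  proof (cases "norm x < r")
    case False
    then have "?b = 0" "bump 3 r x = 0" using r by (auto simp: bump_outside)
    then show ?thesis unfolding sum using False by simp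
  next
    case True
    have t1: "(16 / r\<^sup>2) * (bump 3 r x * ?q * ((x \<bullet> x) * ?w)) \<le> 16 / r\<^sup>2 * (1 * ?q * 1)"
      using q0 w bn by (intro mult_left_mono mult_mono) auto
    have t2: "2 * ?b * (- (\<Sum>j\<in>UNIV. ?dq j * (x $ j * ?w))) \<le> 2 * ?b * (1 / 2 * (?q * ?w) + 2 * gradsq v x)"
      using bn by (intro mult_left_mono cross) auto
    have t3: "2 * ?b * (2 * gradsq v x) \<le> 4 * gradsq v x"
      using bn q0 mult_right_mono[of ?b 1 "gradsq v x"] by simp
    have t4: "2 * ?b * ?q * ?w * 1 \<le> 2 * ?b * ?q * ?w * (3 - 2 * ((x \<bullet> x) * ?w))"
      using bn q0 w by (intro mult_left_mono) auto
    have "2 * ?b * (1 / 2 * (?q * ?w) + 2 * gradsq v x) = ?b * (?q * ?w) + 2 * ?b * (2 * gradsq v x)"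
      by (simp add: algebra_simps)
    then have "?b * (?q * ?w) \<le> 4 * gradsq v x + 16 / r\<^sup>2 * ?q
       + (- ((16 / r\<^sup>2) * (bump 3 r x * ?q * ((x \<bullet> x) * ?w))) + 2 * ?b * (\<Sum>j\<in>UNIV. ?dq j * (x $ j * ?w)) + 2 * ?b * ?q * ?w * (3 - 2 * ((x \<bullet> x) * ?w)))"
      using t1 t2 t3 t4 by (simp add: mult.assoc)
    then show ?thesis unfolding sum using True by simp
  qed
qed

text \<open>The growth condition replaces decay of \<open>v\<close> at infinity: it bounds the terms with a derivative of the cut-off
  uniformly in its radius.\<close>

lemma hardy:
  fixes v :: "3 \<Rightarrow> real^3 \<Rightarrow> real"
  assumes v: "\<And>i. C_k 1 (v i)" and G0: "G \<ge> 0" and N0: "N \<ge> 0"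
    and G: "\<And>R. R > 0 \<Longrightarrow> (ball_int (gradsq v) R) \<le> ennreal G"
    and N: "\<And>R. R > 0 \<Longrightarrow> (ball_int (vsq v) R) \<le> ennreal (N * R\<^sup>2)"
  shows "integrable lborel (\<lambda>x. vsq v x * hardy_weight x)"
proof -
  have cq: "continuous_on UNIV (vsq v)" using v by (intro continuous_on_vsq) (simp add: differentiable_imp_continuous_on)
  have cg: "continuous_on UNIV (gradsq v)" using v by (rule continuous_on_gradsq)
  have cw: "continuous_on UNIV (hardy_weight :: real^3 \<Rightarrow> real)" using C_k_hardy_weight by (rule C_k_continuous)
  have cb: "continuous_on UNIV (bump 4 r :: real^3 \<Rightarrow> real)" for r by (rule C_k_continuous[OF C_k_bump[of 0]]) simp
  have [measurable]: "vsq v \<in> borel_measurable borel" "gradsq v \<in> borel_measurable borel" "(hardy_weight :: real^3 \<Rightarrow> real) \<in> borel_measurable borel"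
    using cq cg cw by (auto intro: borel_measurable_continuous_onI)
  have nn: "vsq v x * hardy_weight x \<ge> 0" for x using vsq_nonneg[of v x] hardy_weight_pos[of x] by simp
  let ?f = "\<lambda>x. ennreal (vsq v x * hardy_weight x)"
  have B: "(\<integral>\<^sup>+x. ?f x * indicator (ball 0 (real n)) x \<partial>lborel) \<le> ennreal (16 * (4 * G + 16 * N))" for n :: nat
  proof (cases "n = 0")
    case False
    define r where "r = 2 * real n"
    have r: "r > 0" "real n = r / 2" using False by (auto simp: r_def)
    have "(\<integral>\<^sup>+x. ennreal (bump 4 r x * (vsq v x * hardy_weight x)) \<partial>lborel) \<le> (\<integral>\<^sup>+x. ennreal ((4 * gradsq v x + 16 / r\<^sup>2 * vsq v x) * indicator (ball 0 r) x) \<partial>lborel)"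
    proof (rule nn_integral_le_divergence[where P="\<lambda>j x. 2 * (bump 4 r x * (vsq v x * (x $ j * hardy_weight x)))" and r = r])
      show "C_k 1 (\<lambda>x. 2 * (bump 4 r x * (vsq v x * (x $ j * hardy_weight x))))" for j :: 3
        by (intro C_k_cmult C_k_mult C_k_bump C_k_vsq v C_k_coordinate C_k_hardy_weight) simp
      show "2 * (bump 4 r x * (vsq v x * (x $ j * hardy_weight x))) = 0" if "norm x > r" for j x using that r by (simp add: bump_outside)
      show "continuous_on UNIV (\<lambda>x. bump 4 r x * (vsq v x * hardy_weight x))" by (intro continuous_intros cb cq cw)
      show "bump 4 r x * (vsq v x * hardy_weight x) = 0" if "norm x > r" for x using that r by (simp add: bump_outside)
      show "0 \<le> bump 4 r x * (vsq v x * hardy_weight x)" for x using nn by (simp add: bump_nonneg)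
      show "bump 4 r x * (vsq v x * hardy_weight x) \<le> (4 * gradsq v x + 16 / r\<^sup>2 * vsq v x) * indicator (ball 0 r) x
        + (\<Sum>j\<in>UNIV. D j (\<lambda>x. 2 * (bump 4 r x * (vsq v x * (x $ j * hardy_weight x)))) x)" for x
        by (rule hardy_pointwise[OF v r(1)])
    qed
    also have "\<dots> = (\<integral>\<^sup>+x. ennreal 4 * (ennreal (gradsq v x) * indicator (ball 0 r) x) + ennreal (16 / r\<^sup>2) * (ennreal (vsq v x) * indicator (ball 0 r) x) \<partial>lborel)"
    proof (rule nn_integral_cong)
      fix x
      have "ennreal (4 * gradsq v x + 16 / r\<^sup>2 * vsq v x) = ennreal 4 * ennreal (gradsq v x) + ennreal (16 / r\<^sup>2) * ennreal (vsq v x)"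
      proof -
        have "0 \<le> 4 * gradsq v x" "0 \<le> 16 / r\<^sup>2 * vsq v x" using vsq_nonneg[of v x] gradsq_nonneg[of v x] by auto
        moreover have "ennreal (4 * gradsq v x) = ennreal 4 * ennreal (gradsq v x)" by (rule ennreal_mult') simp
        moreover have "ennreal (16 / r\<^sup>2 * vsq v x) = ennreal (16 / r\<^sup>2) * ennreal (vsq v x)" by (rule ennreal_mult') simp
        ultimately show ?thesis by (simp only: ennreal_plus)
      qed
      then show "ennreal ((4 * gradsq v x + 16 / r\<^sup>2 * vsq v x) * indicator (ball 0 r) x) = ennreal 4 * (ennreal (gradsq v x) * indicator (ball 0 r) x) + ennreal (16 / r\<^sup>2) * (ennreal (vsq v x) * indicator (ball 0 r) x)"
        by (auto simp: indicator_def)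
    qed
    also have "\<dots> = ennreal 4 * ball_int (gradsq v) r + ennreal (16 / r\<^sup>2) * ball_int (vsq v) r"
      by (simp add: nn_integral_add nn_integral_cmult)
    also have "\<dots> \<le> ennreal 4 * ennreal G + ennreal (16 / r\<^sup>2) * ennreal (N * r\<^sup>2)"
      using r by (intro add_mono mult_left_mono G N) auto
    also have "\<dots> = ennreal (4 * G + 16 * N)"
    proof -
      have "ennreal 4 * ennreal G = ennreal (4 * G)" by (rule ennreal_mult'[symmetric]) simp
      moreover have "ennreal (16 / r\<^sup>2) * ennreal (N * r\<^sup>2) = ennreal (16 * N)"
        using r by (simp add: ennreal_mult'[symmetric])
      ultimately show ?thesis using G0 N0 by (simp only: ennreal_plus[symmetric] mult_nonneg_nonneg zero_le_numeral)
    qed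
    finally have 1: "(\<integral>\<^sup>+x. ennreal (bump 4 r x * (vsq v x * hardy_weight x)) \<partial>lborel) \<le> ennreal (4 * G + 16 * N)" .
    have "(\<integral>\<^sup>+x. ?f x * indicator (ball 0 (real n)) x \<partial>lborel) \<le> (\<integral>\<^sup>+x. ennreal 16 * ennreal (bump 4 r x * (vsq v x * hardy_weight x)) \<partial>lborel)"
    proof (rule nn_integral_mono)
      fix x :: "real^3"
      show "?f x * indicator (ball 0 (real n)) x \<le> ennreal 16 * ennreal (bump 4 r x * (vsq v x * hardy_weight x))"
      proof (cases "norm x < real n")
        case True
        have "((r - r / 2) / r) ^ 4 \<le> bump 4 r x" using True r by (intro bump_inside) auto
        moreover have half: "(r - r / 2) / r = 1 / 2" using r by (simp add: field_simps)
        ultimately have "(1 / 2) ^ 4 \<le> bump 4 r x" by (simp only: half)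
        then have "1 \<le> 16 * bump 4 r x" by (simp add: power_divide)
        then have "1 * (vsq v x * hardy_weight x) \<le> (16 * bump 4 r x) * (vsq v x * hardy_weight x)" by (rule mult_right_mono) (rule nn)
        then have "?f x \<le> ennreal (16 * (bump 4 r x * (vsq v x * hardy_weight x)))" by (intro ennreal_leI) (simp add: mult.assoc)
        also have "\<dots> = ennreal 16 * ennreal (bump 4 r x * (vsq v x * hardy_weight x))" by (rule ennreal_mult') simp
        finally show ?thesis using True by simp
      qed simp
    qed
    also have "\<dots> = ennreal 16 * (\<integral>\<^sup>+x. ennreal (bump 4 r x * (vsq v x * hardy_weight x)) \<partial>lborel)"
      using cb[of r] by (intro nn_integral_cmult) (auto intro!: borel_measurable_times dest: borel_measurable_continuous_onI)
    also have "\<dots> \<le> ennreal 16 * ennreal (4 * G + 16 * N)" by (intro mult_left_mono 1) simp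
    also have "\<dots> = ennreal (16 * (4 * G + 16 * N))" by (rule ennreal_mult'[symmetric]) simp
    finally show ?thesis .
  qed simp
  have "(\<integral>\<^sup>+x. ?f x \<partial>lborel) = (\<integral>\<^sup>+x. (SUP n. ?f x * indicator (ball 0 (real n)) x) \<partial>lborel)"
  proof (rule nn_integral_cong)
    fix x :: "real^3"
    obtain n :: nat where n: "norm x < real n" using reals_Archimedean2 by blast
    show "?f x = (SUP n. ?f x * indicator (ball 0 (real n)) x)"
    proof (rule antisym)
      have "?f x = ?f x * indicator (ball 0 (real n)) x" using n by simp
      also have "\<dots> \<le> (SUP n. ?f x * indicator (ball 0 (real n)) x)" by (rule SUP_upper) simp
      finally show "?f x \<le> (SUP n. ?f x * indicator (ball 0 (real n)) x)" .
      show "(SUP n. ?f x * indicator (ball 0 (real n)) x) \<le> ?f x"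
        by (rule SUP_least) (auto simp: indicator_def)
    qed
  qed
  also have "\<dots> = (SUP n. \<integral>\<^sup>+x. ?f x * indicator (ball 0 (real n)) x \<partial>lborel)"
    by (rule nn_integral_monotone_convergence_SUP) (auto simp: incseq_def le_fun_def indicator_def)
  also have "\<dots> \<le> ennreal (16 * (4 * G + 16 * N))" by (intro SUP_least B)
  also have "\<dots> < \<infinity>" by simp
  finally have fin: "(\<integral>\<^sup>+x. ?f x \<partial>lborel) < \<infinity>" .
  show ?thesis
    using fin nn by (intro integrableI_bounded) auto
qed

text \<open>Dominated convergence: for \<open>R \<ge> 1\<close> the function that is \<open>R\<^sup>-\<^sup>2\<close> on the ball of radius \<open>R\<close> and zero
  outside is at most twice the Hardy weight.\<close>

lemma mean_square_tendsto_0: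
  fixes v :: "3 \<Rightarrow> real^3 \<Rightarrow> real"
  assumes v: "\<And>i. C_k 0 (v i)" and I: "integrable lborel (\<lambda>x. vsq v x * hardy_weight x)"
  shows "(\<lambda>n. \<integral>x. vsq v x * indicator (ball 0 (2 * real (Suc n))) x / (2 * real (Suc n))\<^sup>2 \<partial>lborel) \<longlonglongrightarrow> 0"
proof -
  have cq: "continuous_on UNIV (vsq v)" using v by (rule continuous_on_vsq)
  have [measurable]: "vsq v \<in> borel_measurable borel" using cq by (rule borel_measurable_continuous_onI)
  have "(\<lambda>n. \<integral>x. vsq v x * indicator (ball 0 (2 * real (Suc n))) x / (2 * real (Suc n))\<^sup>2 \<partial>lborel) \<longlonglongrightarrow> (\<integral>x. 0 \<partial>(lborel :: (real^3) measure))"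
  proof (rule integral_dominated_convergence[where w="\<lambda>x. 2 * (vsq v x * hardy_weight x)"])
    show "integrable lborel (\<lambda>x. 2 * (vsq v x * hardy_weight x))" using I by simp
    show "AE x in lborel. (\<lambda>n. vsq v x * indicator (ball 0 (2 * real (Suc n))) x / (2 * real (Suc n))\<^sup>2) \<longlonglongrightarrow> 0"
    proof (rule AE_I2)
      fix x :: "real^3"
      have l: "(\<lambda>n. vsq v x * (1 / real (Suc n))) \<longlonglongrightarrow> vsq v x * 0"
        by (intro tendsto_mult tendsto_const LIMSEQ_Suc[OF lim_1_over_n])
      show "(\<lambda>n. vsq v x * indicator (ball 0 (2 * real (Suc n))) x / (2 * real (Suc n))\<^sup>2) \<longlonglongrightarrow> 0"
      proof (rule Lim_null_comparison[OF _ l[unfolded mult_zero_right]], rule always_eventually, rule allI)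
        fix n :: nat
        have "real (Suc n) \<le> (2 * real (Suc n))\<^sup>2"
        proof -
          have "1 * real (Suc n) \<le> (4 * real (Suc n)) * real (Suc n)" by (intro mult_right_mono) auto
          also have "(4 * real (Suc n)) * real (Suc n) = (2 * real (Suc n))\<^sup>2" by (simp only: power2_eq_square)
          finally show ?thesis by simp
        qed
        then have "1 / (2 * real (Suc n))\<^sup>2 \<le> 1 / real (Suc n)" by (intro divide_left_mono) auto
        then have "vsq v x * (1 / (2 * real (Suc n))\<^sup>2) \<le> vsq v x * (1 / real (Suc n))"
          by (rule mult_left_mono) (rule vsq_nonneg)
        then show "norm (vsq v x * indicator (ball 0 (2 * real (Suc n))) x / (2 * real (Suc n))\<^sup>2) \<le> vsq v x * (1 / real (Suc n))"
          using vsq_nonneg[of v x] by (auto simp: indicator_def)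
      qed
    qed
    show "AE x in lborel. norm (vsq v x * indicator (ball 0 (2 * real (Suc n))) x / (2 * real (Suc n))\<^sup>2) \<le> 2 * (vsq v x * hardy_weight x)" for n
    proof (rule AE_I2)
      fix x :: "real^3"
      define R where "R = 2 * real (Suc n)"
      have R: "R \<ge> 1" by (simp add: R_def)
      show "norm (vsq v x * indicator (ball 0 (2 * real (Suc n))) x / (2 * real (Suc n))\<^sup>2) \<le> 2 * (vsq v x * hardy_weight x)"
        unfolding R_def[symmetric]
      proof (cases "norm x < R")
        case True
        have "x \<bullet> x \<le> R\<^sup>2" using True R by (simp add: power2_norm_eq_inner[symmetric] power_mono)
        moreover have "1 \<le> R\<^sup>2" using R by simp
        ultimately have "1 + x \<bullet> x \<le> 2 * R\<^sup>2" by simp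
        moreover have "0 < 1 + x \<bullet> x" using inner_ge_zero[of x] by linarith
        moreover have "0 < R\<^sup>2" using R by simp
        ultimately have "1 / R\<^sup>2 \<le> 2 * hardy_weight x" by (simp add: hardy_weight_def divide_simps)
        then have "vsq v x * (1 / R\<^sup>2) \<le> vsq v x * (2 * hardy_weight x)" by (rule mult_left_mono) (rule vsq_nonneg)
        then show "norm (vsq v x * indicator (ball 0 R) x / R\<^sup>2) \<le> 2 * (vsq v x * hardy_weight x)"
          using True vsq_nonneg[of v x] by simp
      next
        case False
        then show "norm (vsq v x * indicator (ball 0 R) x / R\<^sup>2) \<le> 2 * (vsq v x * hardy_weight x)"
          using vsq_nonneg[of v x] hardy_weight_pos[of x] by simp
      qed
    qed
  qed (use I in auto)
  then show ?thesis by simp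
qed

section \<open>Rescaling and the Liouville theorem\<close>

lemma partial_deriv_scale:
  fixes f :: "real^'n::finite \<Rightarrow> real"
  assumes "C_k (Suc k) f"
  shows "D j (\<lambda>x. f (c *\<^sub>R x)) x = c * D j f (c *\<^sub>R x)"
  using partial_deriv_affine[of f 0 c x j] C_k_Suc_differentiable[OF assms] by simp

lemma C_k_scale:
  fixes f :: "real^'n::finite \<Rightarrow> real"
  shows "C_k k f \<Longrightarrow> C_k k (\<lambda>x. f (c *\<^sub>R x))"
  using C_k_affine[of k f 0 c] by simp

text \<open>The drift has the dimension of an inverse length, which explains the factor \<open>c\<close>.\<close>

lemma drift_system_scale:
  assumes "drift_system u v"
  shows "drift_system (\<lambda>i x. c * u i (c *\<^sub>R x)) (\<lambda>i x. v i (c *\<^sub>R x))"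
proof -
  interpret drift_system u v by (rule assms)
  have Dv: "D j (\<lambda>x. v i (c *\<^sub>R x)) = (\<lambda>x. c * D j (v i) (c *\<^sub>R x))" for i j
    using partial_deriv_scale[OF v] by blast
  have DDv: "D j (\<lambda>x. c * D j (v i) (c *\<^sub>R x)) x = c * (c * D j (D j (v i)) (c *\<^sub>R x))" for i j x
    using partial_deriv_cmult[OF C_k_Suc_differentiable[OF C_k_scale[OF C_k_partial_deriv_v]]] partial_deriv_scale[OF C_k_partial_deriv_v] by simp
  have Du: "D j (\<lambda>x. c * u i (c *\<^sub>R x)) x = c * (c * D j (u i) (c *\<^sub>R x))" for i j x
    using partial_deriv_cmult[OF C_k_Suc_differentiable[OF C_k_scale[OF u]]] partial_deriv_scale[OF u] by simp
  have F: "(\<lambda>x. (\<Sum>j\<in>UNIV. c * u j (c *\<^sub>R x) * D j (\<lambda>x. v i (c *\<^sub>R x)) x) - (\<Sum>j\<in>UNIV. D j (D j (\<lambda>x. v i (c *\<^sub>R x))) x))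
    = (\<lambda>x. (c * c) * force i (c *\<^sub>R x))" for i
    by (rule ext) (simp add: Dv DDv force_def right_diff_distrib sum_distrib_left ac_simps)
  have DF: "D k (\<lambda>x. (c * c) * force i (c *\<^sub>R x)) x = (c * c) * (c * D k (force i) (c *\<^sub>R x))" for i k x
    using partial_deriv_cmult[OF C_k_Suc_differentiable[OF C_k_scale[OF C_k_force]]] partial_deriv_scale[OF C_k_force] by simp
  show ?thesis
  proof
    show "C_k k (\<lambda>x. c * u i (c *\<^sub>R x))" for i k by (intro C_k_cmult C_k_scale u)
    show "C_k k (\<lambda>x. v i (c *\<^sub>R x))" for i k by (intro C_k_scale v)
    show "(\<Sum>j\<in>UNIV. D j (\<lambda>x. c * u j (c *\<^sub>R x)) x) = 0" for x
      by (simp only: Du sum_distrib_left[symmetric] div_u mult_zero_right)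
    show "(\<Sum>j\<in>UNIV. D j (\<lambda>x. v j (c *\<^sub>R x)) x) = 0" for x
      by (simp only: Dv sum_distrib_left[symmetric] div_v mult_zero_right)
    show "D k (\<lambda>x. (\<Sum>j\<in>UNIV. c * u j (c *\<^sub>R x) * D j (\<lambda>x. v i (c *\<^sub>R x)) x) - (\<Sum>j\<in>UNIV. D j (D j (\<lambda>x. v i (c *\<^sub>R x))) x)) x
      = D i (\<lambda>x. (\<Sum>j\<in>UNIV. c * u j (c *\<^sub>R x) * D j (\<lambda>x. v k (c *\<^sub>R x)) x) - (\<Sum>j\<in>UNIV. D j (D j (\<lambda>x. v k (c *\<^sub>R x))) x)) x" for i k x
      unfolding F DF curl_force[of k i] ..
  qed
qed

lemma nn_integral_ball_scale:
  fixes f :: "real^3 \<Rightarrow> real"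
  assumes f: "continuous_on UNIV f" and R: "R > 0"
  shows "ball_int f ((R * r)) = ennreal (R ^ 3) * ball_int (\<lambda>x. f (R *\<^sub>R x)) r"
proof -
  have [measurable]: "f \<in> borel_measurable borel" using f by (rule borel_measurable_continuous_onI)
  have "ball_int f ((R * r)) =
     ennreal (R ^ 3) * (\<integral>\<^sup>+x. ennreal (f (0 + R *\<^sub>R x)) * indicator (ball 0 (R * r)) (0 + R *\<^sub>R x) \<partial>lborel)"
    using nn_integral_lborel_affine[of "\<lambda>x. ennreal (f x) * indicator (ball 0 (R * r)) x" R 0] R by simp
  also have "(\<lambda>x. ennreal (f (0 + R *\<^sub>R x)) * indicator (ball 0 (R * r)) (0 + R *\<^sub>R x)) = (\<lambda>x. ennreal (f (R *\<^sub>R x)) * indicator (ball 0 r) x)"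
    using R by (auto simp: indicator_def fun_eq_iff)
  finally show ?thesis .
qed

text \<open>The Caccioppoli inequality is scale invariant, so the unit-scale version gives all scales.\<close>

lemma caccioppoli:
  fixes u v :: "3 \<Rightarrow> real^3 \<Rightarrow> real" and W :: "real^3 \<Rightarrow> real"
  assumes ds: "drift_system u v" and K: "K \<ge> 0" and a: "1 / 2 \<le> a" "a < 1" and W: "continuous_on UNIV W"
    and uW: "\<And>x j. \<bar>u j x\<bar> \<le> W x"
    and mor: "\<And>R. R > 0 \<Longrightarrow> morrey (\<lambda>x. ennreal (R * W (R *\<^sub>R x)) * indicator (ball 0 2) x) K (2 * a)"
  shows "\<exists>C>0. \<forall>R>0. (ball_int (gradsq v) R) \<le>
    ennreal (C / R\<^sup>2) * ball_int (vsq v) ((2 * R))"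
proof -
  interpret drift_system u v by (rule ds)
  from caccioppoli_unit[OF K a, where 'n=3] obtain C where C: "C > 0"
    and unit: "\<And>u v W. drift_system u v \<Longrightarrow> morrey (\<lambda>x::real^3. ennreal (W x) * indicator (ball 0 2) x) K (2 * a) \<Longrightarrow>
     \<forall>x j. \<bar>u j x\<bar> \<le> W x \<Longrightarrow> W \<in> borel_measurable borel \<Longrightarrow>
     (ball_int (gradsq v) 1) \<le> ennreal C * ball_int (vsq v) 2"
    by (elim exE conjE) (rule that, assumption, simp)
  show ?thesis
  proof (intro exI[of _ C] conjI C allI impI)
    fix R :: real assume R: "R > 0"
    have cW: "continuous_on UNIV (\<lambda>x. R * W (R *\<^sub>R x))"
      by (intro continuous_intros continuous_on_compose2[OF W]) auto
    have u: "ball_int (\<lambda>x. gradsq (\<lambda>i x. v i (R *\<^sub>R x)) x) 1 \<le> ennreal C * ball_int (\<lambda>x. vsq (\<lambda>i x. v i (R *\<^sub>R x)) x) 2"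
    proof (rule unit[OF drift_system_scale[OF ds, of R] mor[OF R]])
      show "\<forall>x j. \<bar>R * u j (R *\<^sub>R x)\<bar> \<le> R * W (R *\<^sub>R x)" using uW R by (simp add: abs_mult)
      show "(\<lambda>x. R * W (R *\<^sub>R x)) \<in> borel_measurable borel" using cW by (rule borel_measurable_continuous_onI)
    qed
    have cq: "continuous_on UNIV (vsq v)" and cg: "continuous_on UNIV (gradsq v)"
      by (intro continuous_on_vsq continuous_on_gradsq v)+
    have [measurable]: "gradsq v \<in> borel_measurable borel" "vsq v \<in> borel_measurable borel"
      using cq cg by (auto intro: borel_measurable_continuous_onI)
    have g: "gradsq (\<lambda>i x. v i (R *\<^sub>R x)) x = R\<^sup>2 * gradsq v (R *\<^sub>R x)" for x
      unfolding gradsq_def partial_deriv_scale[OF v] by (simp add: power_mult_distrib sum_distrib_left)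
    have q: "vsq (\<lambda>i x. v i (R *\<^sub>R x)) x = vsq v (R *\<^sub>R x)" for x by (simp add: vsq_def)
    let ?I = "\<integral>\<^sup>+x. ennreal (gradsq v (R *\<^sub>R x)) * indicator (ball 0 1) x \<partial>lborel"
    let ?J = "\<integral>\<^sup>+x. ennreal (vsq v (R *\<^sub>R x)) * indicator (ball 0 2) x \<partial>lborel"
    have "ball_int (\<lambda>x. gradsq (\<lambda>i x. v i (R *\<^sub>R x)) x) 1 = ennreal (R\<^sup>2) * ?I"
      unfolding g using R by (subst nn_integral_cmult[symmetric]) (auto simp: ennreal_mult' mult.assoc)
    with u have le: "ennreal (R\<^sup>2) * ?I \<le> ennreal C * ?J" unfolding q by simp
    have "ball_int (gradsq v) R = ennreal (R ^ 3) * ?I"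
      using nn_integral_ball_scale[OF cg R, of 1] by simp
    also have "\<dots> = ennreal R * (ennreal (R\<^sup>2) * ?I)"
      using R by (simp add: ennreal_mult'[symmetric] mult.assoc[symmetric] power3_eq_cube power2_eq_square)
    also have "\<dots> \<le> ennreal R * (ennreal C * ?J)" by (rule mult_left_mono[OF le]) simp
    also have "\<dots> = ennreal (C / R\<^sup>2) * (ennreal (R ^ 3) * ?J)"
    proof -
      have "ennreal R * ennreal C = ennreal (C / R\<^sup>2) * ennreal (R ^ 3)"
        using R C by (simp add: ennreal_mult'[symmetric] power3_eq_cube power2_eq_square)
      then show ?thesis by (simp add: mult.assoc[symmetric])
    qed
    also have "ennreal (R ^ 3) * ?J = ball_int (vsq v) ((2 * R))"
      using nn_integral_ball_scale[OF cq R, of 2] by (simp add: mult.commute)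
    finally show "ball_int (gradsq v) R \<le>
       ennreal (C / R\<^sup>2) * ball_int (vsq v) ((2 * R))" .
  qed
qed

lemma continuous_nn_integral_ball_0:
  fixes f :: "real^'n::finite \<Rightarrow> real"
  assumes f: "continuous_on UNIV f" and nn: "\<And>x. f x \<ge> 0"
    and z: "\<And>R. R > 0 \<Longrightarrow> (ball_int f R) = 0"
  shows "f x = 0"
proof (rule ccontr)
  assume "f x \<noteq> 0"
  then have fx: "f x > 0" using nn[of x] by linarith
  have "isCont f x" using f by (simp add: continuous_on_eq_continuous_at)
  then obtain d where d: "d > 0" "\<And>y. dist y x < d \<Longrightarrow> dist (f y) (f x) < f x / 2"
    using fx unfolding continuous_at_eps_delta by (metis half_gt_zero)
  have "ennreal (f x / 2) * emeasure lborel (ball x d) = (\<integral>\<^sup>+y. ennreal (f x / 2) * indicator (ball x d) y \<partial>lborel)"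
    by (simp add: nn_integral_cmult)
  also have "\<dots> \<le> ball_int f ((norm x + d))"
  proof (rule nn_integral_mono)
    fix y
    show "ennreal (f x / 2) * indicator (ball x d) y \<le> ennreal (f y) * indicator (ball 0 (norm x + d)) y"
    proof (cases "dist x y < d")
      case True
      have "f x / 2 \<le> f y" using d(2)[of y] True by (simp add: dist_commute dist_real_def abs_if split: if_splits)
      moreover have "norm y < norm x + d" using norm_triangle_sub[of y x] True by (simp add: dist_norm norm_minus_commute)
      ultimately show ?thesis using True by (simp add: ennreal_leI)
    qed simp
  qed
  also have "\<dots> = 0" using d(1) by (intro z) (simp add: add_nonneg_pos)
  finally have "ennreal (f x / 2) * emeasure lborel (ball x d) = 0" by simp
  moreover have "emeasure lborel (ball x d) \<noteq> 0"
    using content_ball_pos[OF d(1), of x] by (auto simp: measure_def)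
  ultimately show False using fx by simp
qed

text \<open>Used first, the Caccioppoli inequality makes \<open>\<nabla>v\<close> square integrable; used again, after \<open>hardy\<close> has improved
  the bounded mean squares to vanishing ones, it makes \<open>\<nabla>v\<close> zero.\<close>

lemma drift_liouville:
  fixes u v :: "3 \<Rightarrow> real^3 \<Rightarrow> real" and W :: "real^3 \<Rightarrow> real"
  assumes ds: "drift_system u v" and K: "K \<ge> 0" and a: "1 / 2 \<le> a" "a < 1" and W: "continuous_on UNIV W"
    and uW: "\<And>x j. \<bar>u j x\<bar> \<le> W x"
    and mor: "\<And>R. R > 0 \<Longrightarrow> morrey (\<lambda>x. ennreal (R * W (R *\<^sub>R x)) * indicator (ball 0 2) x) K (2 * a)"
    and N0: "N \<ge> 0"
    and N: "\<And>R. R > 0 \<Longrightarrow> (ball_int (vsq v) R) \<le> ennreal (N * R\<^sup>2)"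
  shows "v i x = 0"
proof -
  interpret drift_system u v by (rule ds)
  have "\<exists>C>0. \<forall>R>0. (ball_int (gradsq v) R) \<le>
    ennreal (C / R\<^sup>2) * ball_int (vsq v) ((2 * R))"
    by (rule caccioppoli[OF ds K a W uW mor])
  then obtain C where C: "C > 0"
    and cac: "\<And>R. R > 0 \<Longrightarrow> (ball_int (gradsq v) R) \<le>
    ennreal (C / R\<^sup>2) * ball_int (vsq v) ((2 * R))"
    by (elim exE conjE) (rule that, assumption, simp)
  have cq: "continuous_on UNIV (vsq v)" and cg: "continuous_on UNIV (gradsq v)"
    by (intro continuous_on_vsq continuous_on_gradsq v)+
  have [measurable]: "vsq v \<in> borel_measurable borel" using cq by (rule borel_measurable_continuous_onI)
  have G: "ball_int (gradsq v) R \<le> ennreal (4 * C * N)" if R: "R > 0" for R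
  proof -
    note cac[OF R]
    also have "ennreal (C / R\<^sup>2) * ball_int (vsq v) ((2 * R)) \<le> ennreal (C / R\<^sup>2) * ennreal (N * (2 * R)\<^sup>2)"
      using R by (intro mult_left_mono N) auto
    also have "\<dots> = ennreal (4 * C * N)"
      using R C N0 by (simp add: ennreal_mult'[symmetric] power2_eq_square)
    finally show ?thesis .
  qed
  have I: "integrable lborel (\<lambda>x. vsq v x * hardy_weight x)"
    by (rule hardy[OF v _ N0 G N]) (use C N0 in auto)
  define m where "m = (\<lambda>n. \<integral>x. vsq v x * indicator (ball 0 (2 * real (Suc n))) x / (2 * real (Suc n))\<^sup>2 \<partial>lborel)"
  have m: "m \<longlonglongrightarrow> 0" unfolding m_def by (rule mean_square_tendsto_0[OF v I])
  have G0: "ball_int (gradsq v) R = 0" if R: "R > 0" for R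
  proof -
    let ?Y = "\<integral>\<^sup>+x. ennreal (gradsq v x) * indicator (ball 0 R) x \<partial>lborel"
    have le: "?Y \<le> ennreal (4 * C * m n)" if n: "R \<le> real (Suc n)" for n
    proof -
      let ?r = "real (Suc n)"
      have i: "integrable lborel (\<lambda>x. vsq v x * indicator (ball 0 (2 * ?r)) x / (2 * ?r)\<^sup>2)"
      proof (rule Bochner_Integration.integrable_bound)
        show "integrable lborel (\<lambda>x. indicator (cball 0 (2 * ?r)) x *\<^sub>R vsq v x)"
          by (rule borel_integrable_compact) (auto intro: continuous_on_subset[OF cq])
        show "AE x in lborel. norm (vsq v x * indicator (ball 0 (2 * ?r)) x / (2 * ?r)\<^sup>2) \<le> norm (indicator (cball 0 (2 * ?r)) x *\<^sub>R vsq v x)"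
        proof (rule AE_I2)
          fix x
          have "1 \<le> (2 * ?r)\<^sup>2" by (rule one_le_power) simp
          then have "vsq v x / (2 * ?r)\<^sup>2 \<le> vsq v x"
            using vsq_nonneg[of v x] by (simp add: divide_le_eq mult_left_le del: of_nat_Suc) (metis mult.commute mult_left_mono mult_1)
          then show "norm (vsq v x * indicator (ball 0 (2 * ?r)) x / (2 * ?r)\<^sup>2) \<le> norm (indicator (cball 0 (2 * ?r)) x *\<^sub>R vsq v x)"
            using vsq_nonneg[of v x] by (auto simp: indicator_def simp del: of_nat_Suc)
        qed
      qed simp
      have mn: "ennreal (m n) = (\<integral>\<^sup>+x. ennreal (vsq v x * indicator (ball 0 (2 * ?r)) x / (2 * ?r)\<^sup>2) \<partial>lborel)"
        unfolding m_def by (rule nn_integral_eq_integral[symmetric, OF i]) (simp add: vsq_nonneg)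
      have "?Y \<le> ball_int (gradsq v) ?r"
        using n by (intro nn_integral_mono) (auto simp: indicator_def)
      also have "\<dots> \<le> ennreal (C / ?r\<^sup>2) * ball_int (vsq v) ((2 * ?r))"
        by (rule cac) simp
      also have "\<dots> = (\<integral>\<^sup>+x. ennreal (C / ?r\<^sup>2) * (ennreal (vsq v x) * indicator (ball 0 (2 * ?r)) x) \<partial>lborel)"
        by (rule nn_integral_cmult[symmetric]) simp
      also have "\<dots> = (\<integral>\<^sup>+x. ennreal (4 * C) * ennreal (vsq v x * indicator (ball 0 (2 * ?r)) x / (2 * ?r)\<^sup>2) \<partial>lborel)"
      proof (rule nn_integral_cong)
        fix x
        have "C / ?r\<^sup>2 * vsq v x = 4 * C * (vsq v x / (2 * ?r)\<^sup>2)" by (simp add: power_mult_distrib del: of_nat_Suc)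
        then have "ennreal (C / ?r\<^sup>2) * ennreal (vsq v x) = ennreal (4 * C) * ennreal (vsq v x / (2 * ?r)\<^sup>2)"
          using C by (simp add: ennreal_mult'[symmetric] del: of_nat_Suc)
        then show "ennreal (C / ?r\<^sup>2) * (ennreal (vsq v x) * indicator (ball 0 (2 * ?r)) x) = ennreal (4 * C) * ennreal (vsq v x * indicator (ball 0 (2 * ?r)) x / (2 * ?r)\<^sup>2)"
          by (auto simp: indicator_def simp del: of_nat_Suc)
      qed
      also have "\<dots> = ennreal (4 * C) * ennreal (m n)" unfolding mn by (rule nn_integral_cmult) simp
      also have "\<dots> = ennreal (4 * C * m n)" using C by (intro ennreal_mult'[symmetric]) simp
      finally show ?thesis .
    qed
    obtain n0 :: nat where n0: "R \<le> real n0" using real_arch_simple by blast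
    have "(\<lambda>n. ennreal (4 * C * m n)) \<longlonglongrightarrow> ennreal (4 * C * 0)"
      by (intro tendsto_ennrealI tendsto_mult tendsto_const m)
    then have "?Y \<le> ennreal (4 * C * 0)"
    proof (rule LIMSEQ_le_const)
      show "\<exists>n0. \<forall>n\<ge>n0. ?Y \<le> ennreal (4 * C * m n)"
        using le n0 by (intro exI[of _ n0]) (meson le_SucI of_nat_le_iff order_trans)
    qed
    then show ?thesis by simp
  qed
  have g: "gradsq v x = 0" for x by (rule continuous_nn_integral_ball_0[OF cg gradsq_nonneg G0])
  have D0: "D j (v i) x = 0" for i j x
  proof -
    have "(\<Sum>i\<in>UNIV. \<Sum>j\<in>UNIV. (D j (v i) x)\<^sup>2) = 0" using g[of x] by (simp only: gradsq_def)
    then have "(\<Sum>j\<in>UNIV. (D j (v i) x)\<^sup>2) = 0"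
      by (subst (asm) sum_nonneg_eq_0_iff) (auto intro!: sum_nonneg)
    then have "(D j (v i) x)\<^sup>2 = 0"
      by (subst (asm) sum_nonneg_eq_0_iff) auto
    then show "D j (v i) x = 0" by simp
  qed
  have const: "v i y = v i 0" for i y
  proof (rule has_derivative_zero_unique[where f="v i" and s=UNIV])
    show "(v i has_derivative (\<lambda>h. 0)) (at x within UNIV)" for x
      using has_derivative_partial[OF C_k_Suc_differentiable[OF v[of "Suc 0" i]], of x] by (simp add: D0)
  qed auto
  define c where "c = vsq v 0"
  have qc: "vsq v y = c" for y unfolding c_def vsq_def by (simp only: const[of _ y])
  have c0: "c \<ge> 0" unfolding c_def by (rule vsq_nonneg)
  let ?V = "unit_vol TYPE(3)"
  have V: "?V > 0" by (rule unit_vol_pos)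
  have "c * ?V * R \<le> N" if R: "R > 0" for R
  proof -
    have "ennreal (c * (R ^ 3 * ?V)) = ball_int (vsq v) R"
      using c0 R by (simp add: qc nn_integral_cmult emeasure_ball_3 ennreal_mult')
    also have "\<dots> \<le> ennreal (N * R\<^sup>2)" by (rule N[OF R])
    finally have "c * (R ^ 3 * ?V) \<le> N * R\<^sup>2" using N0 by simp
    then have "R\<^sup>2 * (c * ?V * R) \<le> R\<^sup>2 * N" by (simp add: power2_eq_square power3_eq_cube ac_simps)
    then show ?thesis using R by simp
  qed
  note bound = this
  have "c = 0"
  proof (rule ccontr)
    assume "c \<noteq> 0"
    then have cV: "c * ?V > 0" using c0 V by simp
    then have "c * ?V * ((N + 1) / (c * ?V)) \<le> N" using N0 by (intro bound) simp
    moreover have "c * ?V * ((N + 1) / (c * ?V)) = N + 1" using less_imp_neq[OF cV] by simp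
    ultimately show False by simp
  qed
  then have "(\<Sum>i\<in>UNIV. (v i x)\<^sup>2) = 0" using qc[of x] by (simp only: vsq_def)
  then have "(v i x)\<^sup>2 = 0" by (subst (asm) sum_nonneg_eq_0_iff) auto
  then show ?thesis by simp
qed

lemma smooth_componentD: "smooth v \<Longrightarrow> C_k k (\<lambda>y. v y $ i)"
  by (simp add: smooth_def C_k_component)

theorem theorem1p1:
  fixes u v :: "real^3 \<Rightarrow> real^3" and p :: "real^3 \<Rightarrow> real" and q s :: real
  assumes "smooth u" and "smooth v"
    and "p differentiable_on UNIV"
    and "\<forall>x. convection u v x - laplacian v x = grad p x"
    and "\<forall>x. divergence v x = 0"
    and "\<forall>x. divergence u x = 0"
    and "3 / 2 < q" and "q \<le> 3"
    and "(SUP R\<in>{0<..}. ennreal (R powr (1 - 3 / q)) * weak_Leb_norm q (ball 0 R) u) < \<infinity>"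
    and "2 \<le> s" and "s \<le> 6"
    and "(SUP R\<in>{0<..}. ennreal (R powr (1 / 2 - 3 / s)) * Leb_norm s (ball 0 R) v) < \<infinity>"
  shows "\<forall>x. v x = 0"
proof -
  define U where "U = (\<lambda>i x. u x $ i)"
  define V where "V = (\<lambda>i x. v x $ i)"
  have U: "C_k k (U i)" for k i unfolding U_def using assms(1) by (rule smooth_componentD)
  have V: "C_k k (V i)" for k i unfolding V_def using assms(2) by (rule smooth_componentD)
  define F where "F = (\<lambda>i x. (\<Sum>j\<in>UNIV. U j x * D j (V i) x) - (\<Sum>j\<in>UNIV. D j (D j (V i)) x))"
  have F: "F i = D i p" for i
  proof
    fix x
    have "(convection u v x - laplacian v x) $ i = grad p x $ i" using assms(4) by simp
    then show "F i x = D i p x"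
      by (simp add: convection_def laplacian_def grad_def F_def U_def V_def)
  qed
  have CF: "C_k k (F i)" for k i
    unfolding F_def by (intro C_k_diff C_k_sum C_k_mult U C_k_SucD[OF V] C_k_SucD[OF C_k_SucD[OF V]]) auto
  \<comment> \<open>The pressure inherits its smoothness from the equation.\<close>
  have "C_k (Suc (Suc 0)) p"
    using assms(3) CF[of "Suc 0"] unfolding F by (subst C_k.simps) blast
  then have p: "C_k 2 p" by (simp only: numeral_2_eq_2)
  have ds: "drift_system U V"
  proof
    show "C_k k (U i)" "C_k k (V i)" for i k by (rule U, rule V)
    show "(\<Sum>j\<in>UNIV. D j (U j) x) = 0" for x using assms(6) by (simp add: divergence_def U_def)
    show "(\<Sum>j\<in>UNIV. D j (V j) x) = 0" for x using assms(5) by (simp add: divergence_def V_def)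
    have "D k (F i) x = D i (F k) x" for i k x
      unfolding F by (rule partial_deriv_commute[OF p])
    then show "D k (\<lambda>x. (\<Sum>j\<in>UNIV. U j x * D j (V i) x) - (\<Sum>j\<in>UNIV. D j (D j (V i)) x)) x
      = D i (\<lambda>x. (\<Sum>j\<in>UNIV. U j x * D j (V k) x) - (\<Sum>j\<in>UNIV. D j (D j (V k)) x)) x" for i k x
      unfolding F_def .
  qed
  have cu: "continuous_on UNIV u" and cv: "continuous_on UNIV v"
    using assms(1,2) C_k_continuous unfolding smooth_def by blast+
  obtain M where M: "M \<ge> 0" "\<And>R. R > 0 \<Longrightarrow> ennreal (R powr (1 - 3 / q)) * weak_Leb_norm q (ball 0 R) u \<le> ennreal M"
  proof -
    let ?S = "SUP R\<in>{0<..}. ennreal (R powr (1 - 3 / q)) * weak_Leb_norm q (ball 0 R) u"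
    have "?S = ennreal (enn2real ?S)" using assms(9) by (simp add: less_top)
    moreover have "ennreal (R powr (1 - 3 / q)) * weak_Leb_norm q (ball 0 R) u \<le> ?S" if "R > 0" for R
      using that by (intro SUP_upper) simp
    ultimately show ?thesis using that[of "enn2real ?S"] by simp
  qed
  obtain N where N: "N \<ge> 0" "\<And>R. R > 0 \<Longrightarrow> ennreal (R powr (1 / 2 - 3 / s)) * Leb_norm s (ball 0 R) v \<le> ennreal N"
  proof -
    let ?S = "SUP R\<in>{0<..}. ennreal (R powr (1 / 2 - 3 / s)) * Leb_norm s (ball 0 R) v"
    have "?S = ennreal (enn2real ?S)" using assms(12) by (simp add: less_top)
    moreover have "ennreal (R powr (1 / 2 - 3 / s)) * Leb_norm s (ball 0 R) v \<le> ?S" if "R > 0" for R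
      using that by (intro SUP_upper) simp
    ultimately show ?thesis using that[of "enn2real ?S"] by simp
  qed
  \<comment> \<open>The Morrey exponent \<open>2 a = 3 / q\<close>; the range of \<open>q\<close> is exactly \<open>1/2 \<le> a < 1\<close>.\<close>
  define a where "a = 3 / (2 * q)"
  have a: "1 / 2 \<le> a" "a < 1" "2 * a = 3 / q" using assms(7,8) by (auto simp: a_def field_simps)
  have "V i x = 0" for i x
  proof (rule drift_liouville[OF ds])
    show "0 \<le> unit_vol TYPE(3) + M powr q * 2 powr (3 - q) / (q - 1)"
      using unit_vol_pos[where 'n=3] assms(7) by simp
    show "1 / 2 \<le> a" "a < 1" by (rule a)+
    show "continuous_on UNIV (\<lambda>x. norm (u x))" by (intro continuous_on_norm cu)
    show "\<bar>U j x\<bar> \<le> norm (u x)" for j x unfolding U_def by (rule component_le_norm_cart)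
    show "morrey (\<lambda>x. ennreal (R * norm (u (R *\<^sub>R x))) * indicator (ball 0 2) x)
       (unit_vol TYPE(3) + M powr q * 2 powr (3 - q) / (q - 1)) (2 * a)" if "R > 0" for R
      unfolding a(3) using cu assms(7) M that by (rule weak_norm_morrey)
    show "0 \<le> unit_vol TYPE(3) + N powr s" using unit_vol_pos[where 'n=3] by simp
    have e: "vsq V x = (norm (v x))\<^sup>2" for x
      unfolding vsq_def V_def power2_norm_eq_inner inner_vec_def by (simp add: power2_eq_square)
    show "ball_int (vsq V) R \<le> ennreal ((unit_vol TYPE(3) + N powr s) * R\<^sup>2)" if "R > 0" for R
      unfolding e using cv assms(10) N(1) that N(2)[OF that] by (rule Leb_norm_square)
  qed
  then show ?thesis by (simp add: V_def vec_eq_iff)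
qed

end
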